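(* Let $X=X(\Sigma)$ be a $\mathbb{Q}$-factorial complete toric variety of dimension $n$ and rank $r$. For each ray $\rho\in\Sigma(1)$ let $\mathbf v_\rho\in N$ be the minimal integral vector of $\rho$, and consider the subgroup of $N$ $$N_{\Sigma(1)}:=\langle \mathbf v_\rho \mid \rho\in\Sigma(1)\rangle_{\mathbb Z}.$$ Let $V$ be a (reduced) fan matrix of $\Sigma$ and let $T_n$ be the upper $n\times n$ part of the Hermite normal form of the transposed matrix $V^T$. Then $$N/N_{\Sigma(1)}\;\cong\;\mathrm{Tors}(\mathrm{Cl}(X))\;\cong\;\mathbb{Z}^n/\mathcal L_r(T_n).$$
   Context: $N$ is a lattice of rank $n$ (identified with $\mathbb Z^n$ by choosing a basis), and $\Sigma$ is a fan of rational strictly convex cones in $N\otimes\mathbb R$. $X(\Sigma)$ is the associated normal toric variety over $\mathbb C$; $\mathbb Q$-factorial and complete means that every cone of $\Sigma$ is simplicial and that the union of the cones is $N\otimes\mathbb R$. $\Sigma(1)$ is the set of rays; the rank of $X$ is $r=\mathrm{rk}\,\mathrm{Pic}(X)\ge 1$, and $|\Sigma(1)|=n+r$. The minimal integral vector of a ray $\rho$ is the generator of the monoid $\rho\cap N$. A (reduced) fan matrix of $\Sigma$ is the $n\times(n+r)$ integer matrix $V$ whose columns are the vectors $\mathbf v_\rho$, $\rho\in\Sigma(1)$, in some order. $\mathrm{Cl}(X)$ is the group of Weil divisors modulo linear equivalence and $\mathrm{Tors}$ denotes the torsion subgroup. $\mathcal L_r(A)$ denotes the lattice spanned over $\mathbb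 Z$ by the rows of an integer matrix $A$. Hermite normal form: an integer $p\times q$ matrix $(m_{ij})$ is in Hermite normal form (HNF) if there are $s\le p$ and a strictly increasing map $f:\{1,\dots,s\}\to\{1,\dots,q\}$ such that for $1\le i\le s$: $m_{i,f(i)}\ge1$, $m_{ij}=0$ if $j<f(i)$, and $0\le m_{i,f(k)}<m_{k,f(k)}$ if $i<k\leq s$; and the last $p-s$ rows are zero. For every integer $p\times q$ matrix $A$ there is a unique matrix $B$ in HNF of the form $B=UA$ with $U\in \mathrm{GL}_p(\mathbb Z)$; $B$ is the HNF of $A$. *)

theory Defs
  imports
    "HOL-Analysis.Analysis"
    "HOL-Algebra.Free_Abelian_Groups"
    "HOL-Algebra.Ideal"
    "HOL-Library.Poly_Mapping"
    "HOL-Computational_Algebra.Fraction_Field"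
    "Jordan_Normal_Form.Matrix"
begin

text \<open>
  The lattice \<open>N\<close> is \<open>int ^ 'n\<close>, sitting in \<open>real ^ 'n\<close>; its dual lattice \<open>M\<close> is
  \<open>'n \<Rightarrow>\<^sub>0 int\<close>, paired with \<open>N\<close> by the standard pairing. The linear order on the
  index type \<open>'n\<close> orders the basis of \<open>N\<close>, which Hermite normal forms depend on. It also orders \<open>M\<close>
  lexicographically, and this is how the library sees that the Laurent polynomial ring
  \<open>\<complex>[M]\<close> is an integral domain.
\<close>

section \<open>Cones and fans\<close>

definition real_pt :: "int ^ 'n \<Rightarrow> real ^ 'n" where
  "real_pt v = (\<chi> i. real_of_int (vec_nth v i))"

definition rational_cone :: "(real ^ 'n) set \<Rightarrow> bool" where
  "rational_cone \<sigma> \<longleftrightarrow> (\<exists>S. finite S \<and> \<sigma> = convex_cone hull (real_pt ` S))"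

definition strictly_convex :: "(real ^ 'n) set \<Rightarrow> bool" where
  "strictly_convex \<sigma> \<longleftrightarrow> \<sigma> \<inter> uminus ` \<sigma> = {0}"

definition simplicial_cone :: "(real ^ 'n) set \<Rightarrow> bool" where
  "simplicial_cone \<sigma> \<longleftrightarrow> (\<exists>B. independent B \<and> \<sigma> = convex_cone hull B)"

text \<open>
  For a polyhedral cone \<open>\<sigma>\<close>, the nonempty convex-geometric faces are exactly the
  sets \<open>\<sigma> \<inter> m\<^sup>\<bottom>\<close> with \<open>m\<close> in the dual cone. The library also counts the empty set as a
  face, hence the side condition.
\<close>
definition fan :: "(real ^ 'n) set set \<Rightarrow> bool" where
  "fan \<Sigma> \<longleftrightarrow> finite \<Sigma> \<and> \<Sigma> \<noteq> {} \<and>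
     (\<forall>\<sigma>\<in>\<Sigma>. rational_cone \<sigma> \<and> strictly_convex \<sigma>) \<and>
     (\<forall>\<sigma>\<in>\<Sigma>. \<forall>\<tau>. \<tau> face_of \<sigma> \<and> \<tau> \<noteq> {} \<longrightarrow> \<tau> \<in> \<Sigma>) \<and>
     (\<forall>\<sigma>\<in>\<Sigma>. \<forall>\<tau>\<in>\<Sigma>. (\<sigma> \<inter> \<tau>) face_of \<sigma> \<and> (\<sigma> \<inter> \<tau>) face_of \<tau>)"

definition simplicial_fan :: "(real ^ 'n) set set \<Rightarrow> bool" where
  "simplicial_fan \<Sigma> \<longleftrightarrow> (\<forall>\<sigma>\<in>\<Sigma>. simplicial_cone \<sigma>)"

definition complete_fan :: "(real ^ 'n) set set \<Rightarrow> bool" where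
  "complete_fan \<Sigma> \<longleftrightarrow> \<Union>\<Sigma> = UNIV"

definition rays :: "(real ^ 'n) set set \<Rightarrow> (real ^ 'n) set set" where
  "rays \<Sigma> = {\<rho>\<in>\<Sigma>. dim \<rho> = 1}"

definition ray_gen :: "(real ^ 'n) set \<Rightarrow> int ^ 'n" where
  "ray_gen \<rho> = (THE v. {w. real_pt w \<in> \<rho>} = range (\<lambda>k::nat. int k *s v))"

definition lattice_group :: "(int ^ 'n) monoid" where
  "lattice_group = \<lparr>carrier = UNIV, monoid.mult = (+), one = 0\<rparr>"

definition ray_subgroup :: "(real ^ 'n) set set \<Rightarrow> (int ^ 'n) set" where
  "ray_subgroup \<Sigma> = generate lattice_group (ray_gen ` rays \<Sigma>)"

section \<open>Integral separated schemes through their local rings\<close>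

text \<open>
  A point \<open>x\<close> of an integral separated scheme \<open>X\<close> is determined by its local ring, viewed
  as a subring of the function field \<open>K\<close>, and \<open>x\<close> lies in the closure of \<open>y\<close> iff the local
  ring of \<open>x\<close> is contained in that of \<open>y\<close>. We therefore represent \<open>X\<close>
  by the set of its local rings in \<open>K\<close> (as Chevalley and Zariski did). The field \<open>K\<close> is a type,
  and \<open>K = UNIV\<close> is the local ring of the generic point.
\<close>

definition subring_struct :: "'k::field set \<Rightarrow> 'k ring" where
  "subring_struct A = \<lparr>carrier = A, monoid.mult = (*), one = 1, ring.zero = 0, add = (+)\<rparr>"

definition localization :: "'k::field set \<Rightarrow> 'k set \<Rightarrow> 'k set" where
  "localization A P = {a / s | a s. a \<in> A \<and> s \<in> A - P}"

definition affine_points :: "'k::field set \<Rightarrow> 'k set set" where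
  "affine_points A = {localization A P | P. primeideal P (subring_struct A)}"

text \<open>Points of codimension one: their only proper generization is the generic point.\<close>
definition prime_divisors :: "'k::field set set \<Rightarrow> 'k set set" where
  "prime_divisors X = {R\<in>X. R \<noteq> UNIV \<and> (\<forall>R'\<in>X. R \<subset> R' \<longrightarrow> R' = UNIV)}"

definition maximal_ideal :: "'k::field set \<Rightarrow> 'k set" where
  "maximal_ideal R = {x\<in>R. x = 0 \<or> inverse x \<notin> R}"

definition uniformizer :: "'k::field set \<Rightarrow> 'k \<Rightarrow> bool" where
  "uniformizer R t \<longleftrightarrow> t \<noteq> 0 \<and> maximal_ideal R = {t * a | a. a \<in> R}"

text \<open>The discrete valuation of \<open>R\<close>; meaningful when \<open>R\<close> is a discrete valuation ring, as
  are the local rings of the codimension one points of a normal variety.\<close>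
definition val :: "'k::field set \<Rightarrow> 'k \<Rightarrow> int" where
  "val R f = (THE k. \<exists>t u. uniformizer R t \<and> u \<in> R - maximal_ideal R \<and> f = u * t powi k)"

definition weil_divisors :: "'k::field set set \<Rightarrow> ('k set \<Rightarrow>\<^sub>0 int) monoid" where
  "weil_divisors X = free_Abelian_group (prime_divisors X)"

definition principal_divisors :: "'k::field set set \<Rightarrow> ('k set \<Rightarrow>\<^sub>0 int) set" where
  "principal_divisors X = {D \<in> carrier (weil_divisors X).
     \<exists>f. f \<noteq> 0 \<and> (\<forall>P\<in>prime_divisors X. Poly_Mapping.lookup D P = val P f)}"

definition class_group :: "'k::field set set \<Rightarrow> ('k set \<Rightarrow>\<^sub>0 int) set monoid" where
  "class_group X = weil_divisors X Mod principal_divisors X"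

text \<open>
  On a normal variety, Cartier divisors are the locally principal Weil divisors. The prime
  divisors through the point \<open>x\<close> are the \<open>P\<close> with \<open>x \<subseteq> P\<close>. Since divisors have finite support,
  agreeing with a principal divisor along these is the same as agreeing with it on an
  open neighbourhood of \<open>x\<close>.
\<close>
definition cartier_divisors :: "'k::field set set \<Rightarrow> ('k set \<Rightarrow>\<^sub>0 int) set" where
  "cartier_divisors X = {D \<in> carrier (weil_divisors X).
     \<forall>x\<in>X. \<exists>f. f \<noteq> 0 \<and> (\<forall>P\<in>prime_divisors X. x \<subseteq> P \<longrightarrow> Poly_Mapping.lookup D P = val P f)}"

definition picard_group :: "'k::field set set \<Rightarrow> ('k set \<Rightarrow>\<^sub>0 int) set monoid" where
  "picard_group X =
     (weil_divisors X)\<lparr>carrier := cartier_divisors X\<rparr> Mod principal_divisors X"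

section \<open>Torsion and rank of abelian groups\<close>

definition torsion_group :: "('a, 'b) monoid_scheme \<Rightarrow> ('a, 'b) monoid_scheme" where
  "torsion_group G = G\<lparr>carrier := {x \<in> carrier G. \<exists>k::nat. k > 0 \<and> x [^]\<^bsub>G\<^esub> k = \<one>\<^bsub>G\<^esub>}\<rparr>"

definition Z_independent :: "('a, 'b) monoid_scheme \<Rightarrow> 'a set \<Rightarrow> bool" where
  "Z_independent G S \<longleftrightarrow> finite S \<and> S \<subseteq> carrier G \<and>
     (\<forall>c::'a \<Rightarrow> int. finprod G (\<lambda>x. x [^]\<^bsub>G\<^esub> c x) S = \<one>\<^bsub>G\<^esub> \<longrightarrow> (\<forall>x\<in>S. c x = 0))"

definition has_rank :: "('a, 'b) monoid_scheme \<Rightarrow> nat \<Rightarrow> bool" where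
  "has_rank G r \<longleftrightarrow> (\<exists>S. Z_independent G S \<and> card S = r) \<and>
     (\<forall>S. Z_independent G S \<longrightarrow> card S \<le> r)"

section \<open>The toric variety of a fan\<close>

type_synonym 'n ratfun = "(('n \<Rightarrow>\<^sub>0 int) \<Rightarrow>\<^sub>0 complex) fract"

definition dual_monoid :: "(real ^ 'n) set \<Rightarrow> ('n \<Rightarrow>\<^sub>0 int) set" where
  "dual_monoid \<sigma> = {m. \<forall>v\<in>\<sigma>. (\<Sum>i\<in>UNIV. of_int (Poly_Mapping.lookup m i) * vec_nth v i) \<ge> 0}"

text \<open>The coordinate ring \<open>\<complex>[\<sigma>\<^sup>\<or> \<inter> M]\<close> of the affine chart of \<open>\<sigma>\<close>, inside the function field.\<close>
definition chart_ring :: "(real ^ 'n::{finite,linorder}) set \<Rightarrow> 'n ratfun set" where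
  "chart_ring \<sigma> = {Fract p 1 | p. Poly_Mapping.keys p \<subseteq> dual_monoid \<sigma>}"

text \<open>Gluing the charts along their open subschemes amounts to forming the union of their sets of
  local rings, because toric varieties are separated.\<close>
definition toric_variety ::
    "(real ^ 'n::{finite,linorder}) set set \<Rightarrow> 'n ratfun set set" where
  "toric_variety \<Sigma> = (\<Union>\<sigma>\<in>\<Sigma>. affine_points (chart_ring \<sigma>))"

section \<open>Fan matrices and Hermite normal form\<close>

definition coord_vec :: "int ^ 'n::{finite,linorder} \<Rightarrow> int Matrix.vec" where
  "coord_vec v = vec_of_list (map (vec_nth v) (sorted_list_of_set UNIV))"

definition fan_matrix :: "(real ^ 'n::{finite,linorder}) set set \<Rightarrow> int mat \<Rightarrow> bool" where
  "fan_matrix \<Sigma> V \<longleftrightarrow> (\<exists>\<rho>s. distinct \<rho>s \<and> set \<rho>s = rays \<Sigma> \<and>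
     V = mat_of_cols CARD('n) (map (\<lambda>\<rho>. coord_vec (ray_gen \<rho>)) \<rho>s))"

text \<open>Rows and columns are numbered from 0.\<close>
definition hermite_normal_form :: "int mat \<Rightarrow> bool" where
  "hermite_normal_form A \<longleftrightarrow> (\<exists>s f. s \<le> dim_row A \<and>
     f ` {..<s} \<subseteq> {..<dim_col A} \<and> strict_mono_on {..<s} f \<and>
     (\<forall>i<s. A $$ (i, f i) \<ge> 1 \<and> (\<forall>j<f i. A $$ (i, j) = 0) \<and>
        (\<forall>k. i < k \<and> k < s \<longrightarrow> 0 \<le> A $$ (i, f k) \<and> A $$ (i, f k) < A $$ (k, f k))) \<and>
     (\<forall>i j. s \<le> i \<and> i < dim_row A \<and> j < dim_col A \<longrightarrow> A $$ (i, j) = 0))"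

definition hermite_normal_form_of :: "int mat \<Rightarrow> int mat \<Rightarrow> bool" where
  "hermite_normal_form_of A B \<longleftrightarrow> hermite_normal_form B \<and>
     (\<exists>U \<in> carrier_mat (dim_row A) (dim_row A). invertible_mat U \<and> B = U * A)"

definition upper_square :: "nat \<Rightarrow> int mat \<Rightarrow> int mat" where
  "upper_square n A = Matrix.mat n n (\<lambda>(i, j). A $$ (i, j))"

definition row_lattice :: "int mat \<Rightarrow> int Matrix.vec set" where
  "row_lattice A = generate (monoid_vec TYPE(int) (dim_col A)) (set (rows A))"

end

(*
  The Laurent polynomial ring is factorial, so the class group of the torus is trivial and its
  invertible functions are monomials; hence Cl(X) is the cokernel of the transposed fan matrix
  M -> Z^{Sigma(1)}. The points of codimension one outside the torus are the valuation rings of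
  the orders of vanishing along the rays, because a prime of a chart that contains a monomial
  contains the ideal of some ray. A basis of N adapted to N_{Sigma(1)} identifies N/N_{Sigma(1)}
  with the torsion of this cokernel. The rows of V^T generate N_{Sigma(1)}, and row operations
  do not change the row lattice.
*)
theory Submission
  imports Defs
begin

text \<open>Canonically the torsion of the cokernel is Ext^1 of the finite quotient of N:
  functionals integral on the sublattice modulo those integral on N. This is the character group of
  the quotient and not the quotient itself, so the first isomorphism must come from a choice. The
  adapted basis supplies it in the form of a pairing that is diagonal with entries 1/d_i.
  Factoriality is the main obstacle. Variables are adjoined one at a time inside the one full ring;
  since monomials are invertible, the degree is replaced by the span between highest and lowest
  exponent. Codimension one is encoded as maximality among proper local rings. It is therefore
  enough to place every point below one of the expected valuation rings, without classifying the
  primes of a chart. Cones are real objects while all divisor data are integral. The passage is made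
  by an orthogonal projection with denominators cleared, which turns real independence and real
  spans into statements about integral functionals and multiples.\<close>

type_synonym 'n laurent = "('n \<Rightarrow>\<^sub>0 int) \<Rightarrow>\<^sub>0 complex"

definition pairing :: "('n::finite \<Rightarrow>\<^sub>0 int) \<Rightarrow> int ^ 'n \<Rightarrow> int" where
  "pairing m v = (\<Sum>i\<in>UNIV. Poly_Mapping.lookup m i * vec_nth v i)"

lemma pairing_add_left [simp]: "pairing (m + m') v = pairing m v + pairing m' v"
  by (simp add: pairing_def lookup_add sum.distrib algebra_simps)

lemma pairing_zero_left [simp]: "pairing 0 v = 0"
  by (simp add: pairing_def)

lemma pairing_uminus_left [simp]: "pairing (- m) v = - pairing m v"
  by (simp add: pairing_def sum_negf)

lemma pairing_diff_left [simp]: "pairing (m - m') v = pairing m v - pairing m' v"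
  by (simp add: pairing_def lookup_minus sum_subtractf algebra_simps)

lemma pairing_uminus_right [simp]: "pairing m (- v) = - pairing m v"
  by (simp add: pairing_def sum_negf)

lemma pairing_axis [simp]: "pairing m (axis i 1) = Poly_Mapping.lookup m i"
proof -
  have "pairing m (axis i 1) = (\<Sum>j\<in>UNIV. if j = i then Poly_Mapping.lookup m i else 0)"
    unfolding pairing_def by (rule sum.cong) (auto simp: axis_def)
  then show ?thesis by simp
qed

section \<open>Gradings of the Laurent polynomial ring\<close>

definition graded_part :: "int ^ 'n::finite \<Rightarrow> int \<Rightarrow> 'n laurent \<Rightarrow> 'n laurent" where
  "graded_part v k f = Poly_Mapping.mapp (\<lambda>m c. c when pairing m v = k) f"

lemma lookup_graded_part:
  "Poly_Mapping.lookup (graded_part v k f) m = (if pairing m v = k then Poly_Mapping.lookup f m else 0)"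
  by (simp add: graded_part_def lookup_mapp when_def in_keys_iff)

lemma keys_graded_part: "Poly_Mapping.keys (graded_part v k f) = {m \<in> Poly_Mapping.keys f. pairing m v = k}"
  by (auto simp: in_keys_iff lookup_graded_part split: if_splits)

lemma graded_part_add: "graded_part v k (f + g) = graded_part v k f + graded_part v k g"
  by (rule poly_mapping_eqI) (simp add: lookup_graded_part lookup_add)

lemma graded_part_eq_self: "(\<And>m. m \<in> Poly_Mapping.keys f \<Longrightarrow> pairing m v = k) \<Longrightarrow> graded_part v k f = f"
  by (rule poly_mapping_eqI) (auto simp: lookup_graded_part in_keys_iff)

lemma graded_part_eq_0: "(\<And>m. m \<in> Poly_Mapping.keys f \<Longrightarrow> pairing m v \<noteq> k) \<Longrightarrow> graded_part v k f = 0"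
  by (rule poly_mapping_eqI) (auto simp: lookup_graded_part in_keys_iff)

lemma keys_mult_pairing:
  assumes "m \<in> Poly_Mapping.keys (f * g)"
  obtains a b where "a \<in> Poly_Mapping.keys f" "b \<in> Poly_Mapping.keys g" "m = a + b"
  using keys_mult[of f g] assms by blast

text \<open>Terms of \<open>f\<close> and \<open>g\<close> outside the extreme pieces have strictly
  larger degree, so degree \<open>a + b\<close> receives only the product of the two extreme
  pieces.\<close>

lemma graded_part_mult_bounded:
  fixes f g :: "'n::{finite,linorder} laurent"
  assumes f: "\<And>m. m \<in> Poly_Mapping.keys f \<Longrightarrow> a \<le> pairing m v"
    and g: "\<And>m. m \<in> Poly_Mapping.keys g \<Longrightarrow> b \<le> pairing m v"
  shows "graded_part v (a + b) (f * g) = graded_part v a f * graded_part v b g"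
proof -
  define f0 f1 g0 g1 where "f0 = graded_part v a f" and "f1 = f - graded_part v a f"
    and "g0 = graded_part v b g" and "g1 = g - graded_part v b g"
  have kf0: "pairing m v = a" if "m \<in> Poly_Mapping.keys f0" for m
    using that by (simp add: f0_def keys_graded_part)
  have kg0: "pairing m v = b" if "m \<in> Poly_Mapping.keys g0" for m
    using that by (simp add: g0_def keys_graded_part)
  have kf1: "pairing m v > a" if "m \<in> Poly_Mapping.keys f1" for m
    using that f[of m] by (auto simp: f1_def in_keys_iff lookup_minus lookup_graded_part split: if_splits)
  have kg1: "pairing m v > b" if "m \<in> Poly_Mapping.keys g1" for m
    using that g[of m] by (auto simp: g1_def in_keys_iff lookup_minus lookup_graded_part split: if_splits)
  have "f * g = f0 * g0 + (f0 * g1 + (f1 * g0 + f1 * g1))"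
    by (simp add: f0_def f1_def g0_def g1_def algebra_simps)
  moreover have "graded_part v (a + b) (f0 * g0) = f0 * g0"
    by (rule graded_part_eq_self) (auto elim!: keys_mult_pairing simp: kf0 kg0)
  moreover have "graded_part v (a + b) (f0 * g1) = 0"
    by (rule graded_part_eq_0) (force elim!: keys_mult_pairing dest: kf0 kg1)
  moreover have "graded_part v (a + b) (f1 * g0) = 0"
    by (rule graded_part_eq_0) (force elim!: keys_mult_pairing dest: kf1 kg0)
  moreover have "graded_part v (a + b) (f1 * g1) = 0"
    by (rule graded_part_eq_0) (force elim!: keys_mult_pairing dest: kf1 kg1)
  ultimately show ?thesis by (simp add: graded_part_add f0_def g0_def)
qed

lemma graded_part_mult_homogeneous:
  fixes f g :: "'n::{finite,linorder} laurent"
  assumes f: "\<And>m. m \<in> Poly_Mapping.keys f \<Longrightarrow> pairing m v = a"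
  shows "graded_part v (a + k) (f * g) = f * graded_part v k g"
proof -
  have kg1: "pairing m v \<noteq> k" if "m \<in> Poly_Mapping.keys (g - graded_part v k g)" for m
    using that by (auto simp: in_keys_iff lookup_minus lookup_graded_part split: if_splits)
  have "f * g = f * graded_part v k g + f * (g - graded_part v k g)"
    by (simp add: algebra_simps)
  moreover have "graded_part v (a + k) (f * graded_part v k g) = f * graded_part v k g"
    by (rule graded_part_eq_self) (auto elim!: keys_mult_pairing simp: f keys_graded_part)
  moreover have "graded_part v (a + k) (f * (g - graded_part v k g)) = 0"
    by (rule graded_part_eq_0) (auto elim!: keys_mult_pairing dest!: kg1 simp: f)
  ultimately show ?thesis by (simp add: graded_part_add)
qed

text \<open>For primitive \<open>v\<close> this is the order of vanishing along the divisor of the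
  ray through \<open>v\<close>. At \<open>f = 0\<close> it is the minimum of the empty set and
  carries no meaning, so zero is treated separately below.\<close>

definition low :: "int ^ 'n::finite \<Rightarrow> 'n laurent \<Rightarrow> int" where
  "low v f = Min ((\<lambda>m. pairing m v) ` Poly_Mapping.keys f)"

lemma low_le: "m \<in> Poly_Mapping.keys f \<Longrightarrow> low v f \<le> pairing m v"
  by (simp add: low_def)

lemma low_attained:
  assumes "f \<noteq> 0"
  obtains m where "m \<in> Poly_Mapping.keys f" "pairing m v = low v f"
proof -
  have "low v f \<in> (\<lambda>m. pairing m v) ` Poly_Mapping.keys f"
    unfolding low_def using assms by (intro Min_in) auto
  then show ?thesis using that by auto
qed

lemma low_eqI:
  assumes "\<And>m. m \<in> Poly_Mapping.keys f \<Longrightarrow> k \<le> pairing m v"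
    and "m \<in> Poly_Mapping.keys f" "pairing m v = k"
  shows "low v f = k"
  unfolding low_def by (rule Min_eqI) (use assms in auto)

lemma low_ge_iff:
  assumes "f \<noteq> 0"
  shows "k \<le> low v f \<longleftrightarrow> (\<forall>m\<in>Poly_Mapping.keys f. k \<le> pairing m v)"
  using low_le[of _ f v] low_attained[OF assms, of v] by (metis order_trans)

lemma graded_part_low_nonzero:
  assumes "f \<noteq> 0"
  shows "graded_part v (low v f) f \<noteq> 0"
proof -
  obtain m where "m \<in> Poly_Mapping.keys f" "pairing m v = low v f"
    using low_attained[OF assms] .
  then have "m \<in> Poly_Mapping.keys (graded_part v (low v f) f)" by (simp add: keys_graded_part)
  then show ?thesis by auto
qed

text \<open>The product of the lowest pieces is the piece of degree
  \<open>low v f + low v g\<close>; it is nonzero because the Laurent ring is a domain, so no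
  cancellation can raise the order.\<close>

lemma low_mult:
  fixes f g :: "'n::{finite,linorder} laurent"
  assumes "f \<noteq> 0" "g \<noteq> 0"
  shows "low v (f * g) = low v f + low v g"
proof -
  have "graded_part v (low v f + low v g) (f * g) = graded_part v (low v f) f * graded_part v (low v g) g"
    by (rule graded_part_mult_bounded) (auto simp: low_le)
  then have "graded_part v (low v f + low v g) (f * g) \<noteq> 0"
    using graded_part_low_nonzero[OF assms(1), of v] graded_part_low_nonzero[OF assms(2), of v] by simp
  then obtain m where "m \<in> Poly_Mapping.keys (graded_part v (low v f + low v g) (f * g))"
    by (meson ex_in_conv keys_eq_empty)
  then have "m \<in> Poly_Mapping.keys (f * g)" "pairing m v = low v f + low v g"
    by (auto simp: keys_graded_part)
  moreover have "low v f + low v g \<le> pairing m v" if "m \<in> Poly_Mapping.keys (f * g)" for m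
    using that by (rule keys_mult_pairing) (simp add: add_mono low_le)
  ultimately show ?thesis by (intro low_eqI)
qed

lemma low_add_ge:
  assumes "f + g \<noteq> 0" "k \<le> low v f" "k \<le> low v g"
  shows "k \<le> low v (f + g)"
  unfolding low_ge_iff[OF assms(1)]
proof
  fix m assume "m \<in> Poly_Mapping.keys (f + g)"
  then have "m \<in> Poly_Mapping.keys f \<union> Poly_Mapping.keys g" using keys_add[of f g] by blast
  then show "k \<le> pairing m v" using assms low_le[of m f v] low_le[of m g v] by auto
qed

lemma low_uminus [simp]: "low v (- f) = low v f"
  by (simp add: low_def)

section \<open>Monomials, and the span of exponents in a direction\<close>

definition chi :: "('n \<Rightarrow>\<^sub>0 int) \<Rightarrow> 'n laurent" where
  "chi m = Poly_Mapping.single m 1"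

lemma keys_chi [simp]: "Poly_Mapping.keys (chi m) = {m}"
  by (simp add: chi_def)

lemma chi_0 [simp]: "chi 0 = 1"
  by (simp add: chi_def)

lemma chi_mult: "chi m * chi m' = chi (m + m')"
  by (simp add: chi_def mult_single)

lemma chi_nonzero [simp]: "chi m \<noteq> 0"
  by (metis keys_chi keys_zero insert_not_empty)

lemma chi_inverse [simp]: "chi m * chi (- m) = 1" "chi (- m) * chi m = 1"
  by (simp_all add: chi_mult)

lemma chi_dvd_1: "chi m dvd 1"
  using chi_inverse(1)[of m] by (metis dvd_triv_left)

lemma low_chi [simp]: "low v (chi m) = pairing m v"
  by (simp add: low_def)

lemma low_const: "c \<noteq> 0 \<Longrightarrow> low v (Poly_Mapping.single m c) = pairing m v"
  by (simp add: low_def)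

lemma low_1 [simp]: "low v 1 = 0"
  using low_chi[of v 0] by simp

text \<open>Highest minus lowest degree, since \<open>- low (- v) f\<close> is the highest. It is
  additive on products and vanishes on monomials, so it serves as a Euclidean degree in a ring whose
  variables are invertible.\<close>

definition width :: "int ^ 'n::finite \<Rightarrow> 'n laurent \<Rightarrow> int" where
  "width v f = - low (- v) f - low v f"

lemma width_nonneg:
  assumes "f \<noteq> 0" shows "0 \<le> width v f"
proof -
  obtain m where "m \<in> Poly_Mapping.keys f" using assms by (meson ex_in_conv keys_eq_empty)
  then show ?thesis using low_le[of m f v] low_le[of m f "- v"] by (simp add: width_def)
qed

lemma width_mult:
  fixes f g :: "'n::{finite,linorder} laurent"
  shows "f \<noteq> 0 \<Longrightarrow> g \<noteq> 0 \<Longrightarrow> width v (f * g) = width v f + width v g"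
  by (simp add: width_def low_mult)

lemma width_0_homogeneous:
  assumes "width v f = 0" "m \<in> Poly_Mapping.keys f"
  shows "pairing m v = low v f"
  using low_le[OF assms(2), of v] low_le[OF assms(2), of "- v"] assms(1) by (simp add: width_def)

section \<open>Unique factorization of Laurent polynomials\<close>

text \<open>A prime \<open>p * c\<close> divides one of its two factors. If \<open>p\<close> is not
  a unit, cancellation makes \<open>c\<close> a unit, so a prime is associate to each of its nonunit
  divisors.\<close>

lemma cofactor_unit:
  fixes p c :: "'a::idom"
  assumes "p * c \<noteq> 0" "\<not> p dvd 1" "p * c dvd p \<or> p * c dvd c"
  shows "c dvd 1"
  using assms(3)
proof
  assume "p * c dvd p"
  then have "p * c dvd p * 1" by simp
  then show ?thesis using assms(1) by (subst (asm) dvd_mult_cancel_left) auto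
next
  assume "p * c dvd c"
  then have "p * c dvd 1 * c" by simp
  then show ?thesis using assms(1,2) by (subst (asm) dvd_mult_cancel_right) auto
qed

text \<open>The Laurent ring in the variables from \<open>S\<close>, kept as a subset of the one
  full ring: variables can then be adjoined one at a time without a change of type.\<close>

definition lring :: "'n::finite set \<Rightarrow> 'n laurent set" where
  "lring S = {f. \<forall>m\<in>Poly_Mapping.keys f. \<forall>j. j \<notin> S \<longrightarrow> Poly_Mapping.lookup m j = 0}"

lemma lring_add: "f \<in> lring S \<Longrightarrow> g \<in> lring S \<Longrightarrow> f + g \<in> lring S"
  using keys_add[of f g] by (fastforce simp: lring_def)

lemma lring_uminus: "f \<in> lring S \<Longrightarrow> - f \<in> lring S"
  by (simp add: lring_def)

lemma lring_diff: "f \<in> lring S \<Longrightarrow> g \<in> lring S \<Longrightarrow> f - g \<in> lring S"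
  using lring_add[of f S "- g"] lring_uminus[of g S] by simp

lemma lring_mult: "f \<in> lring S \<Longrightarrow> g \<in> lring S \<Longrightarrow> f * g \<in> lring S"
  by (auto simp: lring_def lookup_add elim!: keys_mult_pairing)

lemma lring_0 [simp]: "0 \<in> lring S" and lring_1 [simp]: "1 \<in> lring S"
  by (auto simp: lring_def)

lemma lring_graded_part: "f \<in> lring S \<Longrightarrow> graded_part v k f \<in> lring S"
  by (auto simp: lring_def keys_graded_part)

lemma lring_mono: "S \<subseteq> T \<Longrightarrow> lring S \<subseteq> lring T"
  by (auto simp: lring_def)

lemma lring_UNIV [simp]: "lring UNIV = UNIV"
  by (auto simp: lring_def)

lemma lring_low:
  assumes "f \<in> lring S" "f \<noteq> 0" "j \<notin> S"
  shows "low (axis j 1) f = 0" "low (- axis j 1) f = 0"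
proof -
  obtain m where m: "m \<in> Poly_Mapping.keys f" using assms by (meson ex_in_conv keys_eq_empty)
  show "low (axis j 1) f = 0" "low (- axis j 1) f = 0"
    by (rule low_eqI[OF _ m]; use assms m in \<open>auto simp: lring_def\<close>)+
qed

text \<open>Hence divisibility in \<open>lring S\<close> is divisibility in the whole ring, and \<open>dvd\<close> can be used for both.\<close>
lemma lring_cancel:
  fixes p h :: "'n::{finite,linorder} laurent"
  assumes p: "p \<in> lring S" "p \<noteq> 0" and ph: "p * h \<in> lring S"
  shows "h \<in> lring S"
proof (cases "h = 0")
  case False
  show ?thesis unfolding lring_def
  proof (intro CollectI ballI allI impI)
    fix m j assume m: "m \<in> Poly_Mapping.keys h" and j: "j \<notin> S"
    have "p * h \<noteq> 0" using p False by simp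
    \<comment> \<open>The lowest degrees in both directions are additive and vanish on
      \<open>p\<close> and \<open>p * h\<close>, hence on \<open>h\<close>.\<close>
    then have "low (axis j 1) h = 0" "low (- axis j 1) h = 0"
      using lring_low[OF p j] lring_low[OF ph _ j] low_mult[of p h] p False by simp_all
    then show "Poly_Mapping.lookup m j = 0"
      using low_le[OF m, of "axis j 1"] low_le[OF m, of "- axis j 1"] by simp
  qed
qed simp

section \<open>Primes and prime factorizations over a set of variables\<close>

definition prime_in :: "'n::{finite,linorder} set \<Rightarrow> 'n laurent \<Rightarrow> bool" where
  "prime_in S p \<longleftrightarrow> p \<in> lring S \<and> p \<noteq> 0 \<and> \<not> p dvd 1 \<and>
     (\<forall>f\<in>lring S. \<forall>g\<in>lring S. p dvd f * g \<longrightarrow> p dvd f \<or> p dvd g)"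

lemma prime_in_UNIV: "prime_in UNIV p \<longleftrightarrow> prime_elem p"
  by (auto simp: prime_in_def prime_elem_def)

text \<open>The number of prime factors is recorded because it measures progress when the content is
  split off in \<open>primitive_part\<close>.\<close>

inductive factorizes :: "'n::{finite,linorder} set \<Rightarrow> nat \<Rightarrow> 'n laurent \<Rightarrow> bool" for S where
  unit: "u \<in> lring S \<Longrightarrow> u dvd 1 \<Longrightarrow> factorizes S 0 u"
| prime: "prime_in S p \<Longrightarrow> factorizes S k f \<Longrightarrow> factorizes S (Suc k) (p * f)"

lemma factorizes_lring: "factorizes S k f \<Longrightarrow> f \<in> lring S"
  by (induction rule: factorizes.induct) (auto simp: prime_in_def intro: lring_mult)

lemma factorizes_nonzero: "factorizes S k f \<Longrightarrow> f \<noteq> 0"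
  by (induction rule: factorizes.induct) (auto simp: prime_in_def)

lemma factorizes_mult_unit:
  "factorizes S k f \<Longrightarrow> u \<in> lring S \<Longrightarrow> u dvd 1 \<Longrightarrow> factorizes S k (u * f)"
proof (induction rule: factorizes.induct)
  case (unit w)
  then show ?case by (intro factorizes.unit) (auto intro: lring_mult mult_dvd_mono[of _ 1 _ 1, simplified])
next
  case (prime p k f)
  then show ?case using factorizes.prime[of S p k "u * f"] by (simp add: mult.left_commute)
qed

lemma factorizes_mult:
  "factorizes S k f \<Longrightarrow> factorizes S l g \<Longrightarrow> factorizes S (k + l) (f * g)"
proof (induction rule: factorizes.induct)
  case (unit u) then show ?case using factorizes_mult_unit by simp
next
  case (prime p k f) then show ?case using factorizes.prime[of S p "k + l" "f * g"] by (simp add: mult.assoc)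
qed

lemma factorizes_primeI: "prime_in S p \<Longrightarrow> factorizes S 1 p"
  using factorizes.prime[of S p 0 1] factorizes.unit[of 1 S] by simp

text \<open>A prime dividing the product divides one of its primes \<open>q\<close>; then
  \<open>q = p * c\<close> with \<open>c\<close> a unit, which is absorbed into the remaining
  factors.\<close>

lemma factorizes_divide_prime:
  assumes "factorizes S k f" "prime_in S p" "p dvd f"
  shows "\<exists>l g. k = Suc l \<and> f = p * g \<and> factorizes S l g"
  using assms
proof (induction rule: factorizes.induct)
  case (unit u)
  then show ?case by (meson dvd_trans prime_in_def)
next
  case (prime q k f)
  note fq = factorizes_lring[OF prime.hyps(2)]
  show ?case
  proof (cases "p dvd f")
    case True
    then obtain l g where lg: "k = Suc l" "f = p * g" "factorizes S l g"
      using prime by blast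
    then have "q * f = p * (q * g)" by (simp add: mult.left_commute)
    then show ?thesis using lg factorizes.prime[OF prime.hyps(1) lg(3)] by blast
  next
    case False
    then have "p dvd q" using prime fq unfolding prime_in_def by blast
    then obtain c where c: "q = p * c" by blast
    have "\<not> p dvd 1" using prime.prems by (simp add: prime_in_def)
    have cS: "c \<in> lring S"
      using c prime lring_cancel[of p S c] by (auto simp: prime_in_def)
    have "q dvd p * c" by (simp add: c)
    then have "q dvd p \<or> q dvd c" using prime cS by (auto simp: prime_in_def)
    moreover have "q \<noteq> 0" using prime.hyps(1) by (simp add: prime_in_def)
    ultimately have "c dvd 1" using \<open>\<not> p dvd 1\<close> cofactor_unit[of p c] by (simp add: c)
    then have "factorizes S k (c * f)" using factorizes_mult_unit prime.hyps(2) cS by blast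
    moreover have "q * f = p * (c * f)" by (simp add: c mult.assoc)
    ultimately show ?thesis by blast
  qed
qed

text \<open>The part of degree \<open>k\<close> in the variable \<open>i\<close> is a coefficient
  times a power of that variable; the monomial in front strips the power.\<close>

lemma lring_coeff:
  assumes "f \<in> lring (insert i S)"
  shows "chi (Poly_Mapping.single i (- k)) * graded_part (axis i 1) k f \<in> lring S"
  using assms by (fastforce simp: lring_def keys_graded_part lookup_add lookup_single when_def
      elim!: keys_mult_pairing)

text \<open>Gauss's lemma, in the form of extension of primes: the lowest coefficient of a product with
  respect to the new variable is the product of the lowest coefficients.\<close>
lemma prime_in_insert:
  fixes p :: "'n::{finite,linorder} laurent"
  assumes p: "prime_in S p"
  shows "prime_in (insert i S) p"
proof (cases "i \<in> S")
  case True then show ?thesis using p by (simp add: insert_absorb)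
next
  case iS: False
  define e :: "int ^ 'n::{finite,linorder}" where "e = axis i 1"
  define x :: "int \<Rightarrow> 'n laurent" where "x k = chi (Poly_Mapping.single i k)" for k
  have pS: "p \<in> lring S" "p \<noteq> 0" "\<not> p dvd 1" using p by (auto simp: prime_in_def)
  have pk: "pairing m e = 0" if "m \<in> Poly_Mapping.keys p" for m
    using pS(1) that iS by (simp add: lring_def e_def)
  have unit: "x k * x (- k) = 1" for k
    by (simp add: x_def chi_mult flip: single_add)
  have coeff: "x (- k) * graded_part e k f \<in> lring S" if f: "f \<in> lring (insert i S)" for k f
    using lring_coeff[OF f] by (simp add: x_def e_def)
  have main: "p dvd f \<or> p dvd g" if "f \<in> lring (insert i S)" "g \<in> lring (insert i S)" "p dvd f * g"
    for f g
    using that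
  proof (induction "card (Poly_Mapping.keys f) + card (Poly_Mapping.keys g)" arbitrary: f g
      rule: less_induct)
    case less
    show ?case
    proof (cases "f = 0 \<or> g = 0")
      case False
      then have nz: "f \<noteq> 0" "g \<noteq> 0" by auto
      define a b f0 g0 where "a = low e f" and "b = low e g"
        and "f0 = graded_part e a f" and "g0 = graded_part e b g"
      obtain h where h: "f * g = p * h" using less.prems by blast
      have "graded_part e (a + b) (f * g) = f0 * g0"
        unfolding f0_def g0_def by (rule graded_part_mult_bounded) (auto simp: a_def b_def low_le)
      moreover have "graded_part e (0 + (a + b)) (p * h) = p * graded_part e (a + b) h"
        by (rule graded_part_mult_homogeneous) (rule pk)
      ultimately have "p dvd f0 * g0" using h by simp
      \<comment> \<open>The shifts by powers of the variable turn the lowest parts into coefficients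
        in \<open>lring S\<close>, where \<open>p\<close> is known to be prime.\<close>
      then have "p dvd (x (- a) * f0) * (x (- b) * g0)"
        using dvd_mult[of p "f0 * g0" "x (- a) * x (- b)"] by (simp add: algebra_simps)
      then have "p dvd x (- a) * f0 \<or> p dvd x (- b) * g0"
        using p coeff less.prems unfolding prime_in_def f0_def g0_def by blast
      then have dv: "p dvd f0 \<or> p dvd g0"
        using dvd_mult[of p "x (- a) * f0" "x a"] dvd_mult[of p "x (- b) * g0" "x b"]
        by (auto simp: unit simp flip: mult.assoc)
      \<comment> \<open>Removing a lowest part divisible by \<open>p\<close> preserves the
        divisibility of the product and loses at least one term, which drives the induction.\<close>
      have smaller: "card (Poly_Mapping.keys (h - graded_part e (low e h) h)) < card (Poly_Mapping.keys h)"
        if "h \<noteq> 0" for h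
      proof (rule psubset_card_mono)
        obtain m where "m \<in> Poly_Mapping.keys h" "pairing m e = low e h"
          using low_attained[OF \<open>h \<noteq> 0\<close>] .
        moreover from this have "m \<notin> Poly_Mapping.keys (h - graded_part e (low e h) h)"
          by (simp add: in_keys_iff lookup_minus lookup_graded_part)
        moreover have "Poly_Mapping.keys (h - graded_part e (low e h) h) \<subseteq> Poly_Mapping.keys h"
          by (auto simp: in_keys_iff lookup_minus lookup_graded_part split: if_splits)
        ultimately show "Poly_Mapping.keys (h - graded_part e (low e h) h) \<subset> Poly_Mapping.keys h" by blast
      qed simp
      from dv show ?thesis
      proof
        assume d: "p dvd f0"
        have "p dvd (f - f0) * g"
          using less.prems(3) d by (simp add: left_diff_distrib)
        moreover have "f - f0 \<in> lring (insert i S)"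
          using less.prems by (auto simp: f0_def intro: lring_diff lring_graded_part)
        ultimately have "p dvd f - f0 \<or> p dvd g"
          using less.hyps[of "f - f0" g] smaller[OF nz(1)] less.prems by (simp add: f0_def a_def)
        then show ?thesis using d dvd_add[of p "f - f0" f0] by auto
      next
        assume d: "p dvd g0"
        have "p dvd f * (g - g0)"
          using less.prems(3) d by (simp add: right_diff_distrib)
        moreover have "g - g0 \<in> lring (insert i S)"
          using less.prems by (auto simp: g0_def intro: lring_diff lring_graded_part)
        ultimately have "p dvd f \<or> p dvd g - g0"
          using less.hyps[of f "g - g0"] smaller[OF nz(2)] less.prems by (simp add: g0_def b_def)
        then show ?thesis using d dvd_add[of p "g - g0" g0] by auto
      qed
    qed auto
  qed
  show ?thesis
    unfolding prime_in_def using pS main lring_mono[of S "insert i S"] by blast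
qed

lemma factorizes_insert: "factorizes S k f \<Longrightarrow> factorizes (insert i S) k f"
proof (induction rule: factorizes.induct)
  case (unit u) then show ?case using lring_mono[of S "insert i S"] by (blast intro: factorizes.unit)
next
  case (prime p k f) then show ?case by (intro factorizes.prime prime_in_insert)
qed

section \<open>Division with remainder and Bezout's identity in one variable\<close>

lemma chi_single_lring: "chi (Poly_Mapping.single i k) \<in> lring (insert i S)"
  by (auto simp: lring_def lookup_single when_def)

lemma width_0_lring:
  fixes f :: "'n::{finite,linorder} laurent"
  assumes f: "f \<in> lring (insert i S)" "f \<noteq> 0" and w: "width (axis i 1) f = 0"
  obtains a k where "a \<in> lring S" "a \<noteq> 0" "f = a * chi (Poly_Mapping.single i k)"
proof
  define k where "k = low (axis i 1) f"
  have "graded_part (axis i 1) k f = f"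
    by (rule graded_part_eq_self) (use width_0_homogeneous[OF w] in \<open>auto simp: k_def\<close>)
  then show "chi (Poly_Mapping.single i (- k)) * f \<in> lring S"
    using lring_coeff[OF f(1), of k] by simp
  show "chi (Poly_Mapping.single i (- k)) * f \<noteq> 0" using f by simp
  show "f = chi (Poly_Mapping.single i (- k)) * f * chi (Poly_Mapping.single i k)"
    by (simp add: single_uminus mult.commute mult.left_commute flip: mult.assoc)
qed

text \<open>As long as \<open>f\<close> is at least as wide as \<open>D\<close>, the top terms in
  the variable \<open>i\<close> are cancelled by cross-multiplying with the leading coefficients.
  The multiplier \<open>s\<close> collects the leading coefficients of \<open>D\<close> used on the
  way.\<close>

lemma pseudo_division:
  fixes f D :: "'n::{finite,linorder} laurent"
  assumes i: "i \<notin> S" and D: "D \<in> lring (insert i S)" "D \<noteq> 0" and f: "f \<in> lring (insert i S)"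
  shows "\<exists>s q. s \<in> lring S \<and> s \<noteq> 0 \<and> q \<in> lring (insert i S) \<and>
    (s * f = q * D \<or> s * f - q * D \<noteq> 0 \<and> width (axis i 1) (s * f - q * D) < width (axis i 1) D)"
  using f
proof (induction "nat (width (axis i 1) f)" arbitrary: f rule: less_induct)
  case less
  define e :: "int ^ 'n::{finite,linorder}" where "e = axis i 1"
  consider "f = 0" | "f \<noteq> 0" "width e f < width e D" | "f \<noteq> 0" "width e f \<ge> width e D" by linarith
  then show ?case
  proof cases
    case 1 then show ?thesis by (intro exI[of _ 1] exI[of _ 0]) simp
  next
    case 2 then show ?thesis by (intro exI[of _ 1] exI[of _ 0]) (simp add: e_def)
  next
    case 3
    define a b where "a = - low (- e) f" and "b = - low (- e) D"
    define x :: "int \<Rightarrow> 'n laurent" where "x k = chi (Poly_Mapping.single i k)" for k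
    define cf cD where "cf = x (- a) * graded_part e a f" and "cD = x (- b) * graded_part e b D"
    \<comment> \<open>The top part is the lowest part for the opposite grading, so the facts about
      lowest parts apply to it.\<close>
    have neg: "graded_part (- e) (- k) h = graded_part e k h" for k h
      by (rule poly_mapping_eqI) (simp add: lookup_graded_part)
    have x: "x k * x l = x (k + l)" for k l by (simp add: x_def chi_mult single_add)
    have xnz: "x k \<noteq> 0" for k by (simp add: x_def)
    have xB: "x k \<in> lring (insert i S)" for k by (simp add: x_def chi_single_lring)
    have xlow: "low e (x k) = k" "low (- e) (x k) = - k" for k by (simp_all add: x_def e_def)
    have cS: "cf \<in> lring S" "cD \<in> lring S"
      using less.prems D lring_coeff by (auto simp: cf_def cD_def x_def e_def)
    have cnz: "cf \<noteq> 0" "cD \<noteq> 0"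
      using graded_part_low_nonzero[OF 3(1), of "- e"] graded_part_low_nonzero[OF D(2), of "- e"]
      by (auto simp: cf_def cD_def a_def b_def xnz simp flip: neg)
    have clow: "low e cf = 0" "low (- e) cf = 0" "low e cD = 0" "low (- e) cD = 0"
      using lring_low[OF cS(1) cnz(1) i] lring_low[OF cS(2) cnz(2) i] by (auto simp: e_def)
    have cB: "cf \<in> lring (insert i S)" "cD \<in> lring (insert i S)"
      using cS lring_mono[of S "insert i S"] by blast+
    \<comment> \<open>The factor \<open>h\<close> shifts the top of \<open>D\<close> to the top of
      \<open>f\<close>, with coefficients matched so that the parts of degree \<open>a\<close>
      cancel in \<open>g\<close>.\<close>
    define h g where "h = cf * x (a - b)" and "g = cD * f - h * D"
    have hB: "h \<in> lring (insert i S)" unfolding h_def by (intro lring_mult cB xB)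
    have gB: "g \<in> lring (insert i S)"
      unfolding g_def by (intro lring_diff lring_mult cB hB D less.prems)
    have hnz: "h \<noteq> 0" using cnz xnz by (simp add: h_def)
    have hlow: "low e h = a - b" "low (- e) h = b - a"
      using cnz xnz by (simp_all add: h_def low_mult clow xlow)
    have homog: "pairing m e = 0" if "m \<in> Poly_Mapping.keys cD" for m
      using cS(2) that i by (auto simp: lring_def e_def)
    have homogh: "pairing m e = a - b" if "m \<in> Poly_Mapping.keys h" for m
      using width_0_homogeneous[OF _ that, of e] hlow by (simp add: width_def)
    have "graded_part e a (cD * f) = cD * graded_part e a f"
      using graded_part_mult_homogeneous[of cD e 0 a f] homog by simp
    moreover have "graded_part e a (h * D) = h * graded_part e b D"
      using graded_part_mult_homogeneous[of h e "a - b" b D] homogh by simp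
    moreover have "cD * graded_part e a f = h * graded_part e b D"
    proof -
      have "h * graded_part e b D = (x (- a) * x (a - b)) * graded_part e a f * graded_part e b D"
        by (simp add: h_def cf_def mult_ac)
      also have "x (- a) * x (a - b) = x (- b)" by (simp add: x)
      finally show ?thesis by (simp only: cD_def mult_ac)
    qed
    moreover have "g + h * D = cD * f" by (simp add: g_def)
    then have "graded_part e a g + graded_part e a (h * D) = graded_part e a (cD * f)"
      by (metis graded_part_add)
    ultimately have ga: "graded_part e a g = 0" by simp
    have lt: "width e g < width e f" if "g \<noteq> 0"
    proof -
      have g: "g = cD * f + - (h * D)" by (simp add: g_def)
      \<comment> \<open>This is where \<open>f\<close> being at least as wide as \<open>D\<close>
        enters: the shifted \<open>D\<close> does not reach below the lowest degree of
        \<open>f\<close>.\<close>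
      have "low e f \<le> low e g"
        unfolding g
        by (rule low_add_ge) (use that 3 D hnz cnz in \<open>auto simp: g_def low_mult clow hlow width_def a_def b_def\<close>)
      moreover have "- a \<le> low (- e) g"
        unfolding g
        by (rule low_add_ge) (use that 3 D hnz cnz in \<open>auto simp: g_def low_mult clow hlow width_def a_def b_def\<close>)
      moreover have "low (- e) g \<noteq> - a"
        using graded_part_low_nonzero[OF that, of "- e"] ga neg by auto
      ultimately show ?thesis by (simp add: width_def a_def)
    qed
    have "\<exists>s q. s \<in> lring S \<and> s \<noteq> 0 \<and> q \<in> lring (insert i S) \<and>
      (s * g = q * D \<or> s * g - q * D \<noteq> 0 \<and> width e (s * g - q * D) < width e D)"
    proof (cases "g = 0")
      case True then show ?thesis by (intro exI[of _ 1] exI[of _ 0]) simp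
    next
      case False
      then show ?thesis
        using less.hyps[OF _ gB] lt width_nonneg[OF False, of e] unfolding e_def by simp
    qed
    then obtain s q where sq: "s \<in> lring S" "s \<noteq> 0" "q \<in> lring (insert i S)"
      "s * g = q * D \<or> s * g - q * D \<noteq> 0 \<and> width e (s * g - q * D) < width e D" by blast
    have "s * cD \<in> lring S" "s * cD \<noteq> 0" using sq cS cnz by (auto intro: lring_mult)
    moreover have "s * h + q \<in> lring (insert i S)"
      using sq hB lring_mono[of S "insert i S"] by (intro lring_add lring_mult) auto
    moreover have "s * cD * f - (s * h + q) * D = s * g - q * D"
      by (simp add: g_def algebra_simps)
    ultimately show ?thesis using sq(4) unfolding e_def
      by (metis eq_iff_diff_eq_0)
  qed
qed

text \<open>Bezout's identity over the fraction field of \<open>lring S\<close> with denominators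
  cleared: \<open>D\<close> is a nonzero combination of least width, and \<open>s\<close> and
  \<open>t\<close> are multipliers from pseudo-division.\<close>

lemma lring_common_divisor:
  fixes f g :: "'n::{finite,linorder} laurent"
  assumes i: "i \<notin> S" and f: "f \<in> lring (insert i S)" "f \<noteq> 0" and g: "g \<in> lring (insert i S)"
  obtains D u v s q t r where "D = u * f + v * g" "D \<noteq> 0"
    "u \<in> lring (insert i S)" "v \<in> lring (insert i S)"
    "s \<in> lring S" "s \<noteq> 0" "q \<in> lring (insert i S)" "s * f = q * D"
    "t \<in> lring S" "t \<noteq> 0" "r \<in> lring (insert i S)" "t * g = r * D"
proof -
  let ?B = "lring (insert i S)"
  define P where "P = (\<lambda>(u, v). u \<in> ?B \<and> v \<in> ?B \<and> u * f + v * g \<noteq> 0)"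
  define w where "w = (\<lambda>(u, v). nat (width (axis i 1) (u * f + v * g)))"
  have "P (1, 0)" using f by (simp add: P_def)
  then obtain uv where "P uv" and least: "\<And>uv'. P uv' \<Longrightarrow> w uv \<le> w uv'"
    using ex_has_least_nat[of P "(1, 0)" w] by blast
  then obtain u v where uv: "uv = (u, v)" "u \<in> ?B" "v \<in> ?B" and nz: "u * f + v * g \<noteq> 0"
    by (cases uv) (auto simp: P_def)
  define D where "D = u * f + v * g"
  have DB: "D \<in> ?B" unfolding D_def by (intro lring_add lring_mult uv f g)
  have Dnz: "D \<noteq> 0" using nz by (simp add: D_def)
  have divides: "\<exists>s q. s \<in> lring S \<and> s \<noteq> 0 \<and> q \<in> ?B \<and> s * (u' * f + v' * g) = q * D"
    if "u' \<in> ?B" "v' \<in> ?B" for u' v'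
  proof -
    have "u' * f + v' * g \<in> ?B" by (intro lring_add lring_mult that f g)
    from pseudo_division[OF i DB Dnz this]
    obtain s q where sq: "s \<in> lring S" "s \<noteq> 0" "q \<in> ?B"
      and alt: "s * (u' * f + v' * g) = q * D \<or> s * (u' * f + v' * g) - q * D \<noteq> 0 \<and>
        width (axis i 1) (s * (u' * f + v' * g) - q * D) < width (axis i 1) D" by blast
    have sB: "s \<in> ?B" using sq lring_mono[of S "insert i S"] by blast
    \<comment> \<open>The remainder is again a combination of \<open>f\<close> and \<open>g\<close>,
      so a nonzero one of smaller width would contradict the choice of \<open>D\<close>.\<close>
    have eq: "s * (u' * f + v' * g) - q * D = (s * u' - q * u) * f + (s * v' - q * v) * g"
      by (simp add: D_def algebra_simps)
    have "\<not> (s * (u' * f + v' * g) - q * D \<noteq> 0 \<and>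
        width (axis i 1) (s * (u' * f + v' * g) - q * D) < width (axis i 1) D)"
    proof
      assume *: "s * (u' * f + v' * g) - q * D \<noteq> 0 \<and>
        width (axis i 1) (s * (u' * f + v' * g) - q * D) < width (axis i 1) D"
      have "P (s * u' - q * u, s * v' - q * v)"
        using * unfolding P_def prod.case eq
        by (auto intro!: lring_diff lring_mult sB sq uv that)
      from least[OF this] show False
        using * width_nonneg[of "s * (u' * f + v' * g) - q * D" "axis i 1"]
        unfolding w_def prod.case uv(1) eq[symmetric] D_def[symmetric] by linarith
    qed
    then show ?thesis using sq alt by blast
  qed
  from divides[of 1 0] obtain s q where 1: "s \<in> lring S" "s \<noteq> 0" "q \<in> ?B" "s * f = q * D" by auto
  from divides[of 0 1] obtain t r where 2: "t \<in> lring S" "t \<noteq> 0" "r \<in> ?B" "t * g = r * D" by auto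
  show thesis using that[OF D_def Dnz uv(2,3) 1 2] .
qed

text \<open>The primes of \<open>s\<close> are cancelled one at a time: each stays prime over
  \<open>T\<close>, so it divides \<open>q\<close> or \<open>D\<close>. What is removed is collected
  in \<open>d\<close> and \<open>c\<close>, and a genuine factorization of \<open>f\<close>
  remains.\<close>

lemma cancel_factorizes:
  fixes f q D :: "'n::{finite,linorder} laurent"
  assumes "factorizes S k s" "s * f = q * D" "q \<in> lring T" "D \<in> lring T" "S \<subseteq> T"
    and ext: "\<And>p. prime_in S p \<Longrightarrow> prime_in T p"
  shows "\<exists>q' D' c d. f = q' * D' \<and> D = c * D' \<and> q = d * q' \<and> c \<in> lring S \<and> d \<in> lring S \<and>
    c \<noteq> 0 \<and> d \<noteq> 0 \<and> q' \<in> lring T \<and> D' \<in> lring T"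
  using assms(1-4)
proof (induction arbitrary: q D rule: factorizes.induct)
  case (unit u)
  then obtain w where w: "u * w = 1" by (auto elim: dvdE)
  have u0: "u \<noteq> 0" using unit by auto
  have wS: "w \<in> lring S" using lring_cancel[OF unit(1) u0, of w] w by simp
  have "f = (w * q) * D"
    using arg_cong[OF unit(3), of "\<lambda>h. w * h"] w by (simp add: mult.commute[of w] flip: mult.assoc)
  moreover have "q = u * (w * q)" using w by (simp flip: mult.assoc)
  moreover have "w * q \<in> lring T"
    using wS lring_mono[OF assms(5)] by (intro lring_mult unit(4)) blast
  ultimately show ?case using unit(1,5) u0
    by (intro exI[of _ "w * q"] exI[of _ D] exI[of _ 1] exI[of _ u] conjI) simp_all
next
  case (prime p k s)
  have pT: "prime_in T p" using ext prime by blast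
  have p: "p \<noteq> 0" "p \<in> lring S" "p \<in> lring T" using prime.hyps pT by (auto simp: prime_in_def)
  have "p dvd q * D" by (simp add: mult.assoc flip: prime.prems(1))
  then consider "p dvd q" | "p dvd D" using pT prime.prems by (auto simp: prime_in_def)
  then show ?case
  proof cases
    case 1
    then obtain q1 where q1: "q = p * q1" by blast
    have q1T: "q1 \<in> lring T" using lring_cancel[of p T q1] p prime.prems(2,3) q1 by simp
    have "p * (s * f) = p * (q1 * D)"
      using prime.prems(1) by (simp only: q1 mult.assoc)
    then have eq: "s * f = q1 * D" using p by simp
    from prime.IH[OF eq q1T prime.prems(3)] obtain q' D' c d where *: "f = q' * D'" "D = c * D'" "q1 = d * q'" "c \<in> lring S" "d \<in> lring S"
      "c \<noteq> 0" "d \<noteq> 0" "q' \<in> lring T" "D' \<in> lring T" by blast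
    have "q = p * d * q'" by (simp add: q1 *(3) mult.assoc)
    moreover have "p * d \<in> lring S" by (intro lring_mult p *)
    moreover have "p * d \<noteq> 0" using p * by simp
    ultimately show ?thesis using * by blast
  next
    case 2
    then obtain q1 where q1: "D = p * q1" by blast
    have q1T: "q1 \<in> lring T" using lring_cancel[of p T q1] p prime.prems(2,3) q1 by simp
    have "p * (s * f) = p * (q * q1)"
      using prime.prems(1) by (simp only: q1 mult.assoc mult.left_commute)
    then have eq: "s * f = q * q1" using p by simp
    from prime.IH[OF eq prime.prems(2) q1T] obtain q' D' c d where *: "f = q' * D'" "q1 = c * D'" "q = d * q'" "c \<in> lring S" "d \<in> lring S"
      "c \<noteq> 0" "d \<noteq> 0" "q' \<in> lring T" "D' \<in> lring T" by blast
    have "D = p * c * D'" by (simp add: q1 *(2) mult.assoc)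
    moreover have "p * c \<in> lring S" by (intro lring_mult p *)
    moreover have "p * c \<noteq> 0" using p * by simp
    ultimately show ?thesis using * by blast
  qed
qed

section \<open>Primitive polynomials and factorization after adjoining a variable\<close>

definition primitive :: "'n::{finite,linorder} set \<Rightarrow> 'n laurent \<Rightarrow> bool" where
  "primitive S f \<longleftrightarrow> (\<forall>p. prime_in S p \<longrightarrow> \<not> p dvd f)"

text \<open>With \<open>h\<close> the cofactor, a prime of \<open>s\<close> divides
  \<open>f * h\<close> but not the primitive \<open>f\<close>; as it stays prime over
  \<open>T\<close>, it divides \<open>h\<close> and cancels.\<close>

lemma primitive_dvd_cancel:
  fixes f s t :: "'n::{finite,linorder} laurent"
  assumes "factorizes S k s" "primitive S f" "f \<in> lring T" "f \<noteq> 0" "t \<in> lring T" "f dvd s * t" "S \<subseteq> T"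
    and ext: "\<And>p. prime_in S p \<Longrightarrow> prime_in T p"
  shows "f dvd t"
  using assms(1,6)
proof (induction rule: factorizes.induct)
  case (unit u)
  then obtain w where "u * w = 1" by (auto elim: dvdE)
  moreover have "w * (u * t) = u * w * t" by (simp only: mult_ac)
  ultimately have "w * (u * t) = t" by (simp only: mult_1_left)
  then show ?case using dvd_mult[OF unit(3), of w] by (simp only:)
next
  case (prime p k s)
  have pT: "prime_in T p" using ext prime by blast
  have p: "p \<noteq> 0" "p \<in> lring T" using pT by (auto simp: prime_in_def)
  obtain h where h: "p * s * t = f * h" using prime.prems by blast
  have "s \<in> lring T" using factorizes_lring[OF prime.hyps(2)] lring_mono[OF assms(7)] by blast
  then have "f * h \<in> lring T" using p assms(5) by (auto simp flip: h intro!: lring_mult)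
  then have "h \<in> lring T" using lring_cancel assms(3,4) by blast
  moreover have "p dvd f * h" by (simp add: mult.assoc flip: h)
  moreover have "\<not> p dvd f" using assms(2) prime.hyps by (auto simp: primitive_def)
  ultimately have "p dvd h" using pT assms(3) unfolding prime_in_def by blast
  then obtain h1 where "h = p * h1" by blast
  then have "p * (s * t) = p * (f * h1)" using h by (simp only: mult_ac)
  then have "s * t = f * h1" using p by simp
  then show ?case using prime.IH by simp
qed

text \<open>Termination is read off the lowest coefficient in the variable \<open>i\<close>: a prime
  over \<open>S\<close> that divides \<open>f\<close> also divides this coefficient, and dividing it
  out lowers the number of prime factors of the coefficient.\<close>

lemma primitive_part:
  fixes f :: "'n::{finite,linorder} laurent"
  assumes "factorizes S k (chi (Poly_Mapping.single i (- low (axis i 1) f)) * graded_part (axis i 1) (low (axis i 1) f) f)"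
    and "i \<notin> S" "f \<in> lring (insert i S)" "f \<noteq> 0"
  shows "\<exists>c f' l. factorizes S l c \<and> f = c * f' \<and> f' \<in> lring (insert i S) \<and> primitive S f'"
  using assms
proof (induction k arbitrary: f rule: less_induct)
  case (less k)
  let ?e = "axis i 1 :: int ^ 'n::{finite,linorder}"
  show ?case
  proof (cases "primitive S f")
    case True
    then show ?thesis using less.prems factorizes.unit[of 1 S] by (intro exI[of _ 1] exI[of _ f] exI[of _ 0]) auto
  next
    case False
    then obtain p where p: "prime_in S p" "p dvd f" by (auto simp: primitive_def)
    then obtain g where g: "f = p * g" by blast
    have pS: "p \<in> lring S" "p \<noteq> 0" using p by (auto simp: prime_in_def)
    have gnz: "g \<noteq> 0" using less.prems g by auto
    have low: "low ?e f = low ?e g"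
      using low_mult[of p g ?e] lring_low[OF pS less.prems(2)] pS gnz by (simp add: g)
    have "pairing m ?e = 0" if "m \<in> Poly_Mapping.keys p" for m
      using pS that less.prems by (auto simp: lring_def)
    then have "graded_part ?e (low ?e f) f = p * graded_part ?e (low ?e g) g"
      using graded_part_mult_homogeneous[of p ?e 0 "low ?e g" g] low by (simp add: g)
    then have *: "chi (Poly_Mapping.single i (- low ?e f)) * graded_part ?e (low ?e f) f
      = p * (chi (Poly_Mapping.single i (- low ?e g)) * graded_part ?e (low ?e g) g)" (is "_ = p * ?cg")
      by (simp add: low mult.left_commute)
    obtain l where l: "k = Suc l" "factorizes S l ?cg"
      using factorizes_divide_prime[OF less.prems(1) p(1)] * pS by auto
    have pB: "p \<in> lring (insert i S)" using pS lring_mono[of S "insert i S"] by blast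
    have gB: "g \<in> lring (insert i S)"
      using lring_cancel[OF pB pS(2)] less.prems g by blast
    from less.IH[OF _ l(2) less.prems(2) gB gnz] l(1)
    obtain c f' l' where "factorizes S l' c" "g = c * f'" "f' \<in> lring (insert i S)" "primitive S f'" by auto
    then show ?thesis
      using factorizes.prime[OF p(1)] g by (intro exI[of _ "p * c"] exI[of _ f'] exI[of _ "Suc l'"])
        (auto simp: mult.assoc)
  qed
qed

lemma factorizes_primitive_unit:
  "factorizes S k a \<Longrightarrow> primitive S f \<Longrightarrow> a dvd f \<Longrightarrow> a dvd 1"
  by (induction rule: factorizes.induct) (auto simp: primitive_def dest: dvd_mult_left)

text \<open>A Bezout combination \<open>D\<close> of \<open>f\<close> and \<open>g\<close> is, up to
  a coefficient, a factor of \<open>f\<close>. By irreducibility in the variable \<open>i\<close>,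
  either the complementary factor is a unit and \<open>f\<close> divides a coefficient times
  \<open>g\<close>, or \<open>D\<close> is a coefficient times a monomial and the Bezout identity
  multiplied by \<open>h\<close> shows that \<open>f\<close> divides a coefficient times
  \<open>h\<close>. Primitivity cancels the coefficient.\<close>

lemma primitive_irreducible_prime_in:
  fixes f :: "'n::{finite,linorder} laurent"
  assumes fact: "\<And>a. a \<in> lring S \<Longrightarrow> a \<noteq> 0 \<Longrightarrow> \<exists>k. factorizes S k a"
    and i: "i \<notin> S" and f: "f \<in> lring (insert i S)" "f \<noteq> 0" "\<not> f dvd 1" "primitive S f"
    and irr: "\<And>g h. g \<in> lring (insert i S) \<Longrightarrow> h \<in> lring (insert i S) \<Longrightarrow> f = g * h \<Longrightarrow>
      width (axis i 1) g = 0 \<or> width (axis i 1) h = 0"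
  shows "prime_in (insert i S) f"
  unfolding prime_in_def
proof (intro conjI ballI impI)
  let ?B = "lring (insert i S)"
  have sub: "S \<subseteq> insert i S" by blast
  fix g h assume g: "g \<in> ?B" and h: "h \<in> ?B" and dvd: "f dvd g * h"
  obtain D u v s q t r where D: "D = u * f + v * g" "D \<noteq> 0" "u \<in> ?B" "v \<in> ?B"
    and s: "s \<in> lring S" "s \<noteq> 0" "q \<in> ?B" "s * f = q * D"
    and t: "t \<in> lring S" "t \<noteq> 0" "r \<in> ?B" "t * g = r * D"
    by (rule lring_common_divisor[OF i f(1,2) g])
  obtain k where k: "factorizes S k s" using fact s by blast
  obtain l where l: "factorizes S l t" using fact t by blast
  have DB: "D \<in> ?B" unfolding D(1) by (intro lring_add lring_mult D f g)
  obtain q' D' c d where qD: "f = q' * D'" "D = c * D'" "q = d * q'" "c \<in> lring S" "d \<in> lring S"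
    "c \<noteq> 0" "d \<noteq> 0" "q' \<in> ?B" "D' \<in> ?B"
    using cancel_factorizes[OF k s(4,3) DB sub prime_in_insert] by blast
  have nz: "q' \<noteq> 0" "D' \<noteq> 0" using f qD by auto
  consider "width (axis i 1) q' = 0" | "width (axis i 1) D' = 0" using irr qD by blast
  then show "f dvd g \<or> f dvd h"
  proof cases
    case 1
    obtain a n where a: "a \<in> lring S" "a \<noteq> 0" "q' = a * chi (Poly_Mapping.single i n)"
      using width_0_lring[OF qD(8) nz(1) 1] .
    have "a dvd f" by (simp add: qD(1) a(3) mult.assoc)
    then have "a dvd 1" using fact[OF a(1,2)] factorizes_primitive_unit f(4) by blast
    then have "q' dvd 1" using a(3) mult_dvd_mono[OF _ chi_dvd_1] by fastforce
    then have "f dvd 1 * D'" unfolding qD(1) by (intro mult_dvd_mono) auto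
    then have "f dvd t * g" by (simp add: t(4) qD(2) dvd_mult)
    then show ?thesis using primitive_dvd_cancel[OF l f(4,1,2) g _ sub prime_in_insert] by blast
  next
    case 2
    obtain a n where a: "a \<in> lring S" "a \<noteq> 0" "D' = a * chi (Poly_Mapping.single i n)"
      using width_0_lring[OF qD(9) nz(2) 2] .
    obtain m where m: "factorizes S m (c * a)"
      using fact[of "c * a"] qD a by (auto intro: lring_mult)
    have "D * h = f * (u * h) + v * (g * h)" by (simp add: D(1) algebra_simps)
    then have "f dvd D * h" using dvd by simp
    then have "f dvd chi (Poly_Mapping.single i (- n)) * (D * h)" by (rule dvd_mult)
    also have "chi (Poly_Mapping.single i (- n)) * (D * h) =
      (chi (Poly_Mapping.single i (- n)) * chi (Poly_Mapping.single i n)) * (c * a * h)"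
      by (simp add: qD(2) a(3) mult_ac)
    also have "\<dots> = c * a * h" by (simp add: single_uminus)
    finally show ?thesis using primitive_dvd_cancel[OF m f(4,1,2) h _ sub prime_in_insert] by blast
  qed
qed (use f in auto)

text \<open>The content factors over \<open>S\<close> by assumption. A primitive part that is
  neither a unit nor prime splits into two factors of positive, hence smaller, width.\<close>

lemma lring_insert_factorizes:
  fixes f :: "'n::{finite,linorder} laurent"
  assumes fact: "\<And>a. a \<in> lring S \<Longrightarrow> a \<noteq> 0 \<Longrightarrow> \<exists>k. factorizes S k a" and i: "i \<notin> S"
    and f: "f \<in> lring (insert i S)" "f \<noteq> 0"
  shows "\<exists>k. factorizes (insert i S) k f"
  using f
proof (induction "nat (width (axis i 1) f)" arbitrary: f rule: less_induct)
  case less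
  let ?B = "lring (insert i S)" and ?e = "axis i 1 :: int ^ 'n::{finite,linorder}"
  have "chi (Poly_Mapping.single i (- low ?e f)) * graded_part ?e (low ?e f) f \<noteq> 0"
    using graded_part_low_nonzero less.prems by simp
  then obtain k where "factorizes S k (chi (Poly_Mapping.single i (- low ?e f)) * graded_part ?e (low ?e f) f)"
    using fact lring_coeff[OF less.prems(1)] by blast
  from primitive_part[OF this i less.prems]
  obtain c f' l where c: "factorizes S l c" "f = c * f'" "f' \<in> ?B" "primitive S f'" by blast
  have nz: "c \<noteq> 0" "f' \<noteq> 0" using c less.prems by auto
  have "width ?e c = 0"
    using lring_low[OF factorizes_lring[OF c(1)] nz(1) i] by (simp add: width_def)
  then have w: "width ?e f = width ?e f'" using nz by (simp add: c(2) width_mult)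
  have "\<exists>k. factorizes (insert i S) k f'"
  proof (cases "f' dvd 1 \<or> prime_in (insert i S) f'")
    case True
    then show ?thesis using c(3) factorizes.unit factorizes_primeI by blast
  next
    case False
    then have "\<exists>g h. g \<in> ?B \<and> h \<in> ?B \<and> f' = g * h \<and> width ?e g \<noteq> 0 \<and> width ?e h \<noteq> 0"
      using primitive_irreducible_prime_in[OF fact i c(3) nz(2) _ c(4)] by blast
    then obtain g h where gh: "g \<in> ?B" "h \<in> ?B" "f' = g * h" "width ?e g \<noteq> 0" "width ?e h \<noteq> 0" by blast
    have ghnz: "g \<noteq> 0" "h \<noteq> 0" using gh nz by auto
    have "width ?e f' = width ?e g + width ?e h" using gh ghnz by (simp add: width_mult)
    then have "nat (width ?e g) < nat (width ?e f)" "nat (width ?e h) < nat (width ?e f)"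
      using width_nonneg[OF ghnz(1), of ?e] width_nonneg[OF ghnz(2), of ?e] gh w by linarith+
    then show ?thesis using less.hyps gh ghnz factorizes_mult by metis
  qed
  then show ?case using factorizes_mult[OF factorizes_insert[OF c(1)]] c(2) by blast
qed

text \<open>Induction over the set of variables. It starts from \<open>lring {}\<close>, whose
  nonzero elements are complex constants and so units. The factors are primes and not merely
  irreducibles, which is the form of unique factorization used from here on.\<close>

theorem laurent_factorizes:
  fixes f :: "'n::{finite,linorder} laurent"
  assumes "f \<noteq> 0"
  shows "\<exists>k. factorizes UNIV k f"
proof -
  have "\<forall>f\<in>lring S. f \<noteq> 0 \<longrightarrow> (\<exists>k. factorizes S k f)" for S :: "'n set"
  proof (induction rule: finite_induct[OF finite[of S]])
    case 1
    show ?case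
    proof (intro ballI impI)
      fix f :: "'n laurent" assume f: "f \<in> lring {}" "f \<noteq> 0"
      have "m = 0" if "m \<in> Poly_Mapping.keys f" for m
        using f that by (intro poly_mapping_eqI) (simp add: lring_def)
      then have fc: "f = Poly_Mapping.single 0 (Poly_Mapping.lookup f 0)"
        by (intro poly_mapping_eqI) (auto simp: lookup_single when_def in_keys_iff)
      then have "Poly_Mapping.lookup f 0 \<noteq> 0" using f by auto
      then have "f * Poly_Mapping.single 0 (inverse (Poly_Mapping.lookup f 0)) = 1"
        by (subst fc) (simp add: mult_single)
      then have "f dvd 1" by (metis dvd_triv_left)
      then show "\<exists>k. factorizes {} k f" using factorizes.unit f by blast
    qed
  next
    case (2 i S)
    then show ?case using lring_insert_factorizes[of S i] by blast
  qed
  from this[of UNIV] show ?thesis using assms by simp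
qed

section \<open>Induction over prime factors, and the units\<close>

lemma laurent_prime_induct [consumes 1, case_names unit prime]:
  fixes f :: "'n::{finite,linorder} laurent"
  assumes "f \<noteq> 0" and unit: "\<And>u. u dvd 1 \<Longrightarrow> P u"
    and prime: "\<And>p f. prime_elem p \<Longrightarrow> f \<noteq> 0 \<Longrightarrow> P f \<Longrightarrow> P (p * f)"
  shows "P f"
proof -
  obtain k where "factorizes UNIV k f" using laurent_factorizes[OF assms(1)] by blast
  then show ?thesis
  proof (induction rule: factorizes.induct)
    case (prime p k f)
    then show ?case using assms(3)[of p f] factorizes_nonzero by (auto simp: prime_in_UNIV)
  qed (rule unit)
qed

text \<open>The widths of \<open>u\<close> and of its inverse are nonnegative and add up to zero in
  every direction, so \<open>u\<close> is homogeneous for every coordinate and has a single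
  exponent.\<close>

lemma laurent_unit:
  fixes u :: "'n::{finite,linorder} laurent"
  assumes "u dvd 1"
  obtains m c where "c \<noteq> 0" "u = Poly_Mapping.single m c"
proof -
  obtain w where w: "u * w = 1" using assms by (auto elim: dvdE)
  have nz: "u \<noteq> 0" "w \<noteq> 0" using w by auto
  have "width v u + width v w = 0" for v
    using width_mult[OF nz, of v] by (simp add: w width_def)
  then have "width v u = 0" for v
    using width_nonneg[OF nz(1), of v] width_nonneg[OF nz(2), of v] by (smt (verit))
  note homog = width_0_homogeneous[OF this]
  obtain m where m: "m \<in> Poly_Mapping.keys u" using nz by (meson ex_in_conv keys_eq_empty)
  have "m' = m" if "m' \<in> Poly_Mapping.keys u" for m'
    using homog[OF that] homog[OF m] by (intro poly_mapping_eqI) (metis pairing_axis)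
  then have "u = Poly_Mapping.single m (Poly_Mapping.lookup u m)"
    by (intro poly_mapping_eqI) (auto simp: lookup_single when_def in_keys_iff)
  moreover have "Poly_Mapping.lookup u m \<noteq> 0" using m by (simp add: in_keys_iff)
  ultimately show thesis using that by blast
qed

section \<open>Discrete valuations\<close>

definition valuation_ring :: "('k::field \<Rightarrow> int) \<Rightarrow> 'k set" where
  "valuation_ring w = {x. x = 0 \<or> 0 \<le> w x}"

text \<open>The element \<open>t\<close> of value 1 makes the value group all of the integers; this
  is what ties \<open>w\<close> to \<open>val\<close>, which is defined through
  uniformizers.\<close>

locale field_valuation =
  fixes w :: "'k::field \<Rightarrow> int" and t :: 'k
  assumes w_mult: "x \<noteq> 0 \<Longrightarrow> y \<noteq> 0 \<Longrightarrow> w (x * y) = w x + w y"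
    and t_nonzero: "t \<noteq> 0" and w_t: "w t = 1"
begin

lemma w_1: "w 1 = 0"
  using w_mult[of 1 1] by simp

lemma w_inverse: "x \<noteq> 0 \<Longrightarrow> w (inverse x) = - w x"
  using w_mult[of x "inverse x"] w_1 by simp

lemma w_divide: "x \<noteq> 0 \<Longrightarrow> y \<noteq> 0 \<Longrightarrow> w (x / y) = w x - w y"
  using w_mult[of x "inverse y"] w_inverse[of y] by (simp add: field_simps)

lemma w_power: "x \<noteq> 0 \<Longrightarrow> w (x ^ k) = int k * w x"
  by (induction k) (auto simp: w_1 w_mult algebra_simps)

lemma w_powi: "x \<noteq> 0 \<Longrightarrow> w (x powi k) = k * w x"
  by (auto simp: power_int_def w_power w_inverse power_inverse)

lemma maximal_ideal_valuation_ring: "maximal_ideal (valuation_ring w) = {x. x = 0 \<or> 0 < w x}"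
  by (auto simp: maximal_ideal_def valuation_ring_def w_inverse)

text \<open>A uniformizer has positive value, and since \<open>t\<close> is a multiple of it within
  the ring, its value is at most 1.\<close>

lemma uniformizer_valuation_ring: "uniformizer (valuation_ring w) s \<longleftrightarrow> s \<noteq> 0 \<and> w s = 1"
proof
  assume s: "s \<noteq> 0 \<and> w s = 1"
  have "x \<in> {s * a |a. a \<in> valuation_ring w}" if "x = 0 \<or> 0 < w x" for x
    using that s by (intro CollectI exI[of _ "x / s"], cases "x = 0") (auto simp: valuation_ring_def w_divide)
  moreover have "s * a = 0 \<or> 0 < w (s * a)" if "a \<in> valuation_ring w" for a
    using that s by (cases "a = 0") (auto simp: valuation_ring_def w_mult)
  ultimately have "{x. x = 0 \<or> 0 < w x} = {s * a |a. a \<in> valuation_ring w}" by blast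
  then show "uniformizer (valuation_ring w) s"
    using s by (simp add: uniformizer_def maximal_ideal_valuation_ring)
next
  assume "uniformizer (valuation_ring w) s"
  then have s: "s \<noteq> 0" and *: "{x. x = 0 \<or> 0 < w x} = {s * a |a. a \<in> valuation_ring w}"
    unfolding uniformizer_def maximal_ideal_valuation_ring by auto
  have "s * 1 \<in> {s * a |a. a \<in> valuation_ring w}" by (force simp: valuation_ring_def w_1)
  then have "0 < w s" using s by (simp flip: *)
  moreover have "t \<in> {s * a |a. a \<in> valuation_ring w}" by (simp add: w_t flip: *)
  then obtain a where a: "t = s * a" "a \<in> valuation_ring w" by blast
  then have "1 = w s + w a" "0 \<le> w a"
    using t_nonzero w_t w_mult[of s a] s by (auto simp: valuation_ring_def)
  ultimately show "s \<noteq> 0 \<and> w s = 1" using s by linarith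
qed

lemma val_valuation_ring:
  assumes "x \<noteq> 0"
  shows "val (valuation_ring w) x = w x"
  unfolding val_def uniformizer_valuation_ring maximal_ideal_valuation_ring
proof (rule the_equality)
  have "x / t powi (w x) \<noteq> 0" "w (x / t powi (w x)) = 0"
    using assms t_nonzero by (auto simp: w_divide w_powi w_t)
  then show "\<exists>s u. (s \<noteq> 0 \<and> w s = 1) \<and> u \<in> valuation_ring w - {x. x = 0 \<or> 0 < w x} \<and> x = u * s powi w x"
    using t_nonzero w_t
    by (intro exI[of _ t] exI[of _ "x / t powi (w x)"]) (auto simp: valuation_ring_def)
next
  fix k assume "\<exists>s u. (s \<noteq> 0 \<and> w s = 1) \<and> u \<in> valuation_ring w - {x. x = 0 \<or> 0 < w x} \<and> x = u * s powi k"
  then obtain s u where "s \<noteq> 0" "w s = 1" "u \<noteq> 0" "w u = 0" "x = u * s powi k"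
    by (auto simp: valuation_ring_def)
  then show "k = w x" by (simp add: w_mult w_powi)
qed

lemma valuation_ring_neq_UNIV: "valuation_ring w \<noteq> UNIV"
proof -
  have "inverse t \<notin> valuation_ring w" using t_nonzero w_t by (simp add: valuation_ring_def w_inverse)
  then show ?thesis by blast
qed

text \<open>A larger set contains some \<open>x\<close> of negative value. Powers of
  \<open>x\<close> have arbitrarily negative value, so every \<open>y\<close> is such a power times
  an element of the valuation ring. Closure under products is available for all local rings of the
  variety.\<close>

lemma valuation_ring_maximal:
  assumes "valuation_ring w \<subset> R'" and mult: "\<And>x y. x \<in> R' \<Longrightarrow> y \<in> R' \<Longrightarrow> x * y \<in> R'"
  shows "R' = UNIV"
proof -
  obtain x where x: "x \<in> R'" "x \<noteq> 0" "w x < 0"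
    using assms(1) by (fastforce simp: valuation_ring_def)
  have pow: "x ^ n \<in> R'" if "n > 0" for n
    using that by (induction n rule: nat_induct_non_zero) (auto simp: x mult)
  have "y \<in> R'" for y
  proof (cases "y = 0 \<or> w y \<ge> 0")
    case True then show ?thesis using assms(1) by (auto simp: valuation_ring_def)
  next
    case False
    define n where "n = nat (- w y)"
    have n: "n > 0" "int n = - w y" using False by (auto simp: n_def)
    have "w (y / x ^ n) = w y - int n * w x" using False x by (simp add: w_divide w_power)
    \<comment> \<open>The value is \<open>w y * (w x + 1)\<close>, a product of two nonpositive
      factors, because \<open>w x\<close> is at most -1.\<close>
    also have "\<dots> = (- w y) * (w x - (- 1)) * (- 1) * (- 1) * (- 1)" using n by (simp add: algebra_simps)
    also have "\<dots> \<ge> 0" using False x by (simp add: mult_nonneg_nonpos mult_nonpos_nonneg zero_le_mult_iff)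
    finally have "y / x ^ n \<in> R'" using assms(1) by (auto simp: valuation_ring_def)
    then have "y / x ^ n * x ^ n \<in> R'" using mult pow n by blast
    then show ?thesis using x by simp
  qed
  then show ?thesis by blast
qed

end

section \<open>Valuations on the field of fractions\<close>

definition fract_val :: "('a::idom \<Rightarrow> int) \<Rightarrow> 'a fract \<Rightarrow> int" where
  "fract_val \<nu> x = (case SOME (a, b). b \<noteq> 0 \<and> x = Fract a b of (a, b) \<Rightarrow> \<nu> a - \<nu> b)"

text \<open>Two fractions for one element agree after cross-multiplication, so multiplicativity
  makes the choice inside \<open>fract_val\<close> irrelevant.\<close>

lemma fract_val_Fract:
  assumes mult: "\<And>a b. a \<noteq> 0 \<Longrightarrow> b \<noteq> 0 \<Longrightarrow> \<nu> (a * b) = \<nu> a + \<nu> b" and nz: "a \<noteq> 0" "b \<noteq> 0"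
  shows "fract_val \<nu> (Fract a b) = \<nu> a - \<nu> b"
proof -
  define ab where "ab = (SOME (a', b'). b' \<noteq> 0 \<and> Fract a b = Fract a' b')"
  have val: "fract_val \<nu> (Fract a b) = (case ab of (a', b') \<Rightarrow> \<nu> a' - \<nu> b')"
    by (simp add: fract_val_def ab_def)
  have "case ab of (a', b') \<Rightarrow> b' \<noteq> 0 \<and> Fract a b = Fract a' b'"
    unfolding ab_def by (rule someI[of _ "(a, b)"]) (use nz in auto)
  then obtain a' b' where *: "ab = (a', b')" "b' \<noteq> 0" "Fract a b = Fract a' b'" by auto
  then have eq: "a * b' = a' * b" using nz by (simp add: eq_fract)
  then have "a' \<noteq> 0" using nz * by auto
  then have "\<nu> a + \<nu> b' = \<nu> a' + \<nu> b" using mult eq nz * by metis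
  then show ?thesis unfolding val using * by simp
qed

lemma Fract_eq_0_iff: "b \<noteq> 0 \<Longrightarrow> Fract a b = 0 \<longleftrightarrow> a = 0"
  by (simp add: Zero_fract_def eq_fract)

lemma field_valuation_fract_val:
  fixes \<nu> :: "'a::idom \<Rightarrow> int"
  assumes mult: "\<And>a b. a \<noteq> 0 \<Longrightarrow> b \<noteq> 0 \<Longrightarrow> \<nu> (a * b) = \<nu> a + \<nu> b" and t: "t \<noteq> 0" "\<nu> t = 1"
  shows "field_valuation (fract_val \<nu>) (Fract t 1)"
proof
  have "\<nu> 1 = 0" using mult[of 1 1] by simp
  then show "fract_val \<nu> (Fract t 1) = 1" using t by (simp add: fract_val_Fract mult)
  show "Fract t 1 \<noteq> 0" using t by (simp add: Fract_eq_0_iff)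
  fix x y :: "'a fract" assume nz: "x \<noteq> 0" "y \<noteq> 0"
  obtain a b c d where *: "x = Fract a b" "b \<noteq> 0" "y = Fract c d" "d \<noteq> 0"
    by (metis Fract_cases)
  then have "a \<noteq> 0" "c \<noteq> 0" using nz by (auto simp: Fract_eq_0_iff)
  then show "fract_val \<nu> (x * y) = fract_val \<nu> x + fract_val \<nu> y"
    using * by (simp add: fract_val_Fract mult)
qed

lemma in_fract_valuation_ring_iff:
  assumes mult: "\<And>a b. a \<noteq> 0 \<Longrightarrow> b \<noteq> 0 \<Longrightarrow> \<nu> (a * b) = \<nu> a + \<nu> b" and b: "b \<noteq> 0"
  shows "Fract a b \<in> valuation_ring (fract_val \<nu>) \<longleftrightarrow> a = 0 \<or> \<nu> b \<le> \<nu> a"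
  using b by (cases "a = 0") (auto simp: valuation_ring_def Fract_eq_0_iff fract_val_Fract[OF mult])

text \<open>For the primitive generator of a ray this is the local ring at the generic point of the
  torus-invariant divisor of that ray.\<close>

definition ray_ring :: "int ^ 'n::{finite,linorder} \<Rightarrow> 'n ratfun set" where
  "ray_ring v = valuation_ring (fract_val (low v))"

lemma field_valuation_low:
  assumes "pairing m v = 1"
  shows "field_valuation (fract_val (low v)) (Fract (chi m) 1)"
  by (rule field_valuation_fract_val) (use assms in \<open>auto simp: low_mult\<close>)

lemma in_ray_ring_iff: "b \<noteq> 0 \<Longrightarrow> Fract a b \<in> ray_ring v \<longleftrightarrow> a = 0 \<or> low v b \<le> low v a"
  unfolding ray_ring_def by (rule in_fract_valuation_ring_iff) (auto simp: low_mult)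

lemma val_ray_ring:
  assumes "pairing m v = 1" "a \<noteq> 0" "b \<noteq> 0"
  shows "val (ray_ring v) (Fract a b) = low v a - low v b"
  using assms field_valuation.val_valuation_ring[OF field_valuation_low, of m v "Fract a b"]
  by (simp add: ray_ring_def Fract_eq_0_iff fract_val_Fract low_mult)

section \<open>The exponent of a prime element\<close>

definition prime_exp :: "'n::{finite,linorder} laurent \<Rightarrow> 'n laurent \<Rightarrow> int" where
  "prime_exp g f = (THE k. \<exists>n h. k = int n \<and> f = g ^ n * h \<and> \<not> g dvd h)"

text \<open>Along the prime factors of \<open>f\<close>, a factor not divisible by \<open>g\<close>
  leaves the exponent unchanged, and any other is associate to \<open>g\<close> and raises it by
  one.\<close>

lemma prime_exp_exists:
  fixes f g :: "'n::{finite,linorder} laurent"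
  assumes g: "prime_elem g" and f: "f \<noteq> 0"
  shows "\<exists>n h. f = g ^ n * h \<and> \<not> g dvd h"
  using f
proof (induction rule: laurent_prime_induct)
  case (unit u)
  have "\<not> g dvd u" using unit g dvd_trans prime_elem_not_unit by blast
  then show ?case by (intro exI[of _ 0] exI[of _ u]) simp
next
  case (prime p f)
  then obtain n h where h: "f = g ^ n * h" "\<not> g dvd h" by blast
  show ?case
  proof (cases "g dvd p")
    case False
    then have "\<not> g dvd p * h" using h g prime_elem_dvd_multD by blast
    moreover have "p * f = g ^ n * (p * h)" by (simp add: h mult.left_commute)
    ultimately show ?thesis by blast
  next
    case True
    then obtain c where c: "p = g * c" by blast
    then have "p dvd g * c" by simp
    then have "p dvd g \<or> p dvd c" using prime.hyps(1) prime_elem_dvd_multD by blast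
    moreover have "p \<noteq> 0" using prime.hyps(1) by auto
    ultimately have "c dvd 1"
      using cofactor_unit[of g c] prime_elem_not_unit[OF g] by (simp add: c)
    then have "\<not> g dvd c" using dvd_trans prime_elem_not_unit[OF g] by blast
    then have "\<not> g dvd c * h" using h g prime_elem_dvd_multD by blast
    moreover have "p * f = g ^ Suc n * (c * h)" by (simp add: h c mult_ac)
    ultimately show ?thesis by blast
  qed
qed

lemma prime_exp_eqI:
  fixes g h :: "'n::{finite,linorder} laurent"
  assumes g: "prime_elem g" and h: "\<not> g dvd h"
  shows "prime_exp g (g ^ n * h) = int n"
  unfolding prime_exp_def
proof (rule the_equality)
  fix k assume "\<exists>n' h'. k = int n' \<and> g ^ n * h = g ^ n' * h' \<and> \<not> g dvd h'"
  then obtain n' h' where *: "k = int n'" "g ^ n * h = g ^ n' * h'" "\<not> g dvd h'" by blast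
  have le: "b \<le> a" if "g ^ a * x = g ^ b * y" "\<not> g dvd x" for a b x y
  proof (rule ccontr)
    assume "\<not> b \<le> a"
    then obtain d where d: "b = a + Suc d" by (metis add_Suc_right less_imp_Suc_add not_le)
    have "g ^ a * x = g ^ a * (g * (g ^ d * y))" using that(1) by (simp add: d power_add mult_ac)
    then have "x = g * (g ^ d * y)" using g by auto
    then show False using that(2) by simp
  qed
  show "k = int n" using le[OF *(2) h] le[OF *(2)[symmetric] *(3)] * by simp
qed (use h in blast)

lemma prime_exp_mult:
  fixes a b g :: "'n::{finite,linorder} laurent"
  assumes g: "prime_elem g" and nz: "a \<noteq> 0" "b \<noteq> 0"
  shows "prime_exp g (a * b) = prime_exp g a + prime_exp g b"
proof -
  obtain n h where a: "a = g ^ n * h" "\<not> g dvd h" using prime_exp_exists[OF g nz(1)] by blast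
  obtain l k where b: "b = g ^ l * k" "\<not> g dvd k" using prime_exp_exists[OF g nz(2)] by blast
  have "a * b = g ^ (n + l) * (h * k)" by (simp add: a b power_add mult_ac)
  moreover have "\<not> g dvd h * k" using a b g prime_elem_dvd_multD by blast
  ultimately have "prime_exp g (a * b) = int (n + l)" using g prime_exp_eqI[of g "h * k" "n + l"] by simp
  then show ?thesis using a b g by (simp add: prime_exp_eqI)
qed

lemma prime_exp_eq_0_iff:
  fixes a g :: "'n::{finite,linorder} laurent"
  assumes g: "prime_elem g" and a: "a \<noteq> 0"
  shows "prime_exp g a = 0 \<longleftrightarrow> \<not> g dvd a"
proof
  assume "\<not> g dvd a" then show "prime_exp g a = 0" using prime_exp_eqI[OF g, of a 0] by simp
next
  assume "prime_exp g a = 0"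
  moreover obtain n h where "a = g ^ n * h" "\<not> g dvd h" using prime_exp_exists[OF g a] by blast
  ultimately show "\<not> g dvd a" using g by (simp add: prime_exp_eqI)
qed

lemma prime_exp_nonneg:
  "prime_elem g \<Longrightarrow> a \<noteq> 0 \<Longrightarrow> 0 \<le> prime_exp g a"
  using prime_exp_exists[of g a] by (auto simp: prime_exp_eqI)

lemma prime_exp_self: "prime_elem g \<Longrightarrow> prime_exp g g = 1"
  using prime_exp_eqI[of g 1 1] prime_elem_not_unit[of g] by simp

text \<open>The local ring of the divisor \<open>g = 0\<close> of the torus; it is obtained as a
  localization in \<open>localization_prime_elem\<close>.\<close>

definition prime_ring :: "'n::{finite,linorder} laurent \<Rightarrow> 'n ratfun set" where
  "prime_ring g = valuation_ring (fract_val (prime_exp g))"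

lemma field_valuation_prime_exp:
  assumes "prime_elem g"
  shows "field_valuation (fract_val (prime_exp g)) (Fract g 1)"
  by (rule field_valuation_fract_val) (use assms in \<open>auto simp: prime_exp_mult prime_exp_self\<close>)

lemma in_prime_ring_iff:
  "prime_elem g \<Longrightarrow> b \<noteq> 0 \<Longrightarrow> Fract a b \<in> prime_ring g \<longleftrightarrow> a = 0 \<or> prime_exp g b \<le> prime_exp g a"
  unfolding prime_ring_def by (rule in_fract_valuation_ring_iff) (auto simp: prime_exp_mult)

lemma val_prime_ring:
  assumes "prime_elem g" "a \<noteq> 0" "b \<noteq> 0"
  shows "val (prime_ring g) (Fract a b) = prime_exp g a - prime_exp g b"
  using assms field_valuation.val_valuation_ring[OF field_valuation_prime_exp, of g "Fract a b"]
  by (simp add: prime_ring_def Fract_eq_0_iff fract_val_Fract prime_exp_mult)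

text \<open>A rational function without zeros and poles along divisors of the torus is invertible there.\<close>
lemma prime_exps_eq_imp_unit:
  fixes a b :: "'n::{finite,linorder} laurent"
  assumes "a \<noteq> 0" "b \<noteq> 0" "\<And>g. prime_elem g \<Longrightarrow> prime_exp g a = prime_exp g b"
  shows "\<exists>u. u dvd 1 \<and> a = u * b"
  using assms
proof (induction arbitrary: b rule: laurent_prime_induct)
  case (unit u)
  have u0: "u \<noteq> 0" using unit.hyps by auto
  \<comment> \<open>A prime factor of \<open>b\<close> would have positive exponent in the unit
    \<open>u\<close>.\<close>
  have "b dvd 1"
    using unit.prems
  proof (induction rule: laurent_prime_induct)
    case (prime p f)
    have "prime_exp p u = 1 + prime_exp p f"
      using prime by (auto simp: prime_exp_mult prime_exp_self)
    then have "p dvd u" using prime_exp_nonneg[OF prime.hyps(1,2)] prime_exp_eq_0_iff[OF prime.hyps(1) u0] by auto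
    then show ?case using unit.hyps prime.hyps dvd_trans prime_elem_not_unit by blast
  qed
  then obtain c where "b * c = 1" by (auto elim: dvdE)
  then have "c * b = 1" by (simp add: mult.commute)
  then have "u = (u * c) * b" "c dvd 1" by (simp add: mult.assoc, metis dvd_triv_left)
  then show ?case using mult_dvd_mono[OF unit.hyps \<open>c dvd 1\<close>] by auto
next
  case (prime p f)
  have "prime_exp p b = 1 + prime_exp p f"
    using prime by (auto simp: prime_exp_mult prime_exp_self simp flip: prime.prems(2))
  then have "p dvd b" using prime_exp_nonneg[OF prime.hyps(1,2)] prime_exp_eq_0_iff[OF prime.hyps(1) prime.prems(1)] by auto
  then obtain c where c: "b = p * c" by blast
  have cnz: "c \<noteq> 0" using c prime.prems by auto
  have "prime_exp g f = prime_exp g c" if "prime_elem g" for g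
    using prime.prems(2)[OF that] prime.hyps that cnz by (auto simp: c prime_exp_mult)
  from prime.IH[OF cnz this] obtain u where "u dvd 1" "f = u * c" by blast
  then show ?case by (auto simp: c mult.left_commute)
qed

section \<open>Affine charts\<close>

lemma Fract_1_eq_iff [simp]: "Fract a 1 = Fract b 1 \<longleftrightarrow> a = b"
  by (simp add: eq_fract)

text \<open>The chart ring inside the Laurent ring, described by integral generators of the cone
  instead of the real cone.\<close>

definition dual_ring :: "(int ^ 'n::finite) set \<Rightarrow> 'n laurent set" where
  "dual_ring V = {p. \<forall>m\<in>Poly_Mapping.keys p. \<forall>v\<in>V. 0 \<le> pairing m v}"

lemma dual_ring_0 [simp]: "0 \<in> dual_ring V" and dual_ring_1 [simp]: "1 \<in> dual_ring V"
  by (auto simp: dual_ring_def)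

lemma dual_ring_add: "p \<in> dual_ring V \<Longrightarrow> q \<in> dual_ring V \<Longrightarrow> p + q \<in> dual_ring V"
  using keys_add[of p q] by (fastforce simp: dual_ring_def)

lemma dual_ring_uminus: "p \<in> dual_ring V \<Longrightarrow> - p \<in> dual_ring V"
  by (simp add: dual_ring_def)

lemma dual_ring_mult: "p \<in> dual_ring V \<Longrightarrow> q \<in> dual_ring V \<Longrightarrow> p * q \<in> dual_ring V"
  by (fastforce simp: dual_ring_def elim!: keys_mult_pairing)

lemma chi_dual_ring: "chi m \<in> dual_ring V \<longleftrightarrow> (\<forall>v\<in>V. 0 \<le> pairing m v)"
  by (simp add: dual_ring_def)

lemma keys_chi_mult: "Poly_Mapping.keys (chi m * f) \<subseteq> (+) m ` Poly_Mapping.keys f"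
  by (auto elim!: keys_mult_pairing)

lemma chi_mult_dual_ringI:
  assumes "\<And>k v. k \<in> Poly_Mapping.keys f \<Longrightarrow> v \<in> V \<Longrightarrow> 0 \<le> pairing k v + pairing m v"
  shows "chi m * f \<in> dual_ring V"
  using assms keys_chi_mult[of m f] by (fastforce simp: dual_ring_def)

lemma pairing_frag_cmul [simp]: "pairing (frag_cmul c m) v = c * pairing m v"
  by (simp add: pairing_def sum_distrib_left mult.assoc)

lemma pairing_sum: "pairing (\<Sum>i\<in>I. m i) v = (\<Sum>i\<in>I. pairing (m i) v)"
  by (induction I rule: infinite_finite_induct) auto

text \<open>A positive integral pairing is at least 1, so a multiple of \<open>m\<close> by the sum
  of all absolute values that occur outweighs each of them.\<close>

lemma clear_exponents:
  assumes "finite V" "finite F" and pos: "\<And>v. v \<in> V \<Longrightarrow> 0 < pairing m v"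
  shows "\<exists>N::nat. \<forall>k\<in>F. \<forall>v\<in>V. 0 \<le> pairing k v + pairing (frag_cmul (int N) m) v"
proof -
  define N where "N = (\<Sum>(k, v)\<in>F \<times> V. nat \<bar>pairing k v\<bar>)"
  have "0 \<le> pairing k v + pairing (frag_cmul (int N) m) v" if kv: "k \<in> F" "v \<in> V" for k v
  proof -
    have "nat \<bar>pairing k v\<bar> \<le> N"
      unfolding N_def using assms kv member_le_sum[of "(k, v)" "F \<times> V" "\<lambda>(k, v). nat \<bar>pairing k v\<bar>"] by auto
    then have "- pairing k v \<le> int N" by linarith
    also have "int N \<le> int N * pairing m v" using pos[OF kv(2)] by (simp add: mult_le_cancel_left1)
    finally show ?thesis by simp
  qed
  then show ?thesis by blast
qed

section \<open>Prime ideals and localizations of subrings of a field\<close>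

lemma primeideal_subringD:
  fixes A :: "'k::field set"
  assumes "primeideal P (subring_struct A)"
  shows "P \<subseteq> A" "0 \<in> P" "\<And>x y. x \<in> P \<Longrightarrow> y \<in> P \<Longrightarrow> x + y \<in> P" "\<And>a x. a \<in> A \<Longrightarrow> x \<in> P \<Longrightarrow> a * x \<in> P"
    "1 \<in> A" "1 \<notin> P" "\<And>a b. a \<in> A \<Longrightarrow> b \<in> A \<Longrightarrow> a * b \<in> P \<Longrightarrow> a \<in> P \<or> b \<in> P"
    "\<And>a b. a \<in> A \<Longrightarrow> b \<in> A \<Longrightarrow> a * b \<in> A"
proof -
  interpret primeideal P "subring_struct A" by fact
  show "P \<subseteq> A" using a_subset by (simp add: subring_struct_def)
  show "0 \<in> P" using additive_subgroup.zero_closed[OF additive_subgroup_axioms] by (simp add: subring_struct_def)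
  show "x + y \<in> P" if "x \<in> P" "y \<in> P" for x y using additive_subgroup.a_closed[OF additive_subgroup_axioms that] by (simp add: subring_struct_def)
  show "a * x \<in> P" if "a \<in> A" "x \<in> P" for a x using I_l_closed[of x a] that by (simp add: subring_struct_def)
  show "1 \<in> A" using one_closed by (simp add: subring_struct_def)
  show "1 \<notin> P" using one_imp_carrier I_notcarr by (auto simp: subring_struct_def)
  show "a \<in> P \<or> b \<in> P" if "a \<in> A" "b \<in> A" "a * b \<in> P" for a b
    using I_prime[of a b] that by (simp add: subring_struct_def)
  show "a * b \<in> A" if "a \<in> A" "b \<in> A" for a b using m_closed[of a b] that by (simp add: subring_struct_def)
qed

lemma primeideal_subringI:
  fixes A :: "'k::field set"
  assumes A: "0 \<in> A" "1 \<in> A" "\<And>a b. a \<in> A \<Longrightarrow> b \<in> A \<Longrightarrow> a + b \<in> A" "\<And>a. a \<in> A \<Longrightarrow> - a \<in> A"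
      "\<And>a b. a \<in> A \<Longrightarrow> b \<in> A \<Longrightarrow> a * b \<in> A"
    and P: "P \<subseteq> A" "0 \<in> P" "\<And>x y. x \<in> P \<Longrightarrow> y \<in> P \<Longrightarrow> x + y \<in> P" "\<And>a x. a \<in> A \<Longrightarrow> x \<in> P \<Longrightarrow> a * x \<in> P"
      "1 \<notin> P" "\<And>a b. a \<in> A \<Longrightarrow> b \<in> A \<Longrightarrow> a * b \<in> P \<Longrightarrow> a \<in> P \<or> b \<in> P"
  shows "primeideal P (subring_struct A)"
proof -
  have "abelian_group (subring_struct A)"
    by (rule abelian_groupI) (use A in \<open>auto simp: subring_struct_def add_ac intro: bexI[of _ "- x" for x]\<close>)
  moreover have "comm_monoid (subring_struct A)"
    by (rule comm_monoidI) (use A in \<open>auto simp: subring_struct_def mult_ac\<close>)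
  ultimately have cring: "cring (subring_struct A)"
    by (rule cringI) (simp add: subring_struct_def algebra_simps)
  have neg: "- x \<in> P" if "x \<in> P" for x
    using P(4)[OF A(4)[OF A(2)] that] by simp
  interpret cring "subring_struct A" by fact
  have minv: "\<ominus>\<^bsub>subring_struct A\<^esub> x = - x" if "x \<in> A" for x
    by (rule minus_equality) (use that A in \<open>auto simp: subring_struct_def\<close>)
  have "ideal P (subring_struct A)"
  proof (rule idealI)
    show "subgroup P (add_monoid (subring_struct A))"
    proof (rule group.subgroupI)
      show "inv\<^bsub>add_monoid (subring_struct A)\<^esub> x \<in> P" if "x \<in> P" for x
        using minv[of x] neg[OF that] P that by (auto simp: a_inv_def)
    qed (use P a_group in \<open>auto simp: subring_struct_def\<close>)
    show "x \<otimes>\<^bsub>subring_struct A\<^esub> a \<in> P" "a \<otimes>\<^bsub>subring_struct A\<^esub> x \<in> P"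
      if "a \<in> P" "x \<in> carrier (subring_struct A)" for a x
      using P(4)[of x a] that by (simp_all add: subring_struct_def mult.commute)
  qed (rule ring_axioms)
  then show ?thesis
    by (rule primeidealI) (use cring P A in \<open>auto simp: subring_struct_def\<close>)
qed

lemma localization_mult_closed:
  assumes "primeideal P (subring_struct A)" "x \<in> localization A P" "y \<in> localization A P"
  shows "x * y \<in> localization A P"
proof -
  note P = primeideal_subringD[OF assms(1)]
  obtain a s b t where "x = a / s" "y = b / t" "a \<in> A" "b \<in> A" "s \<in> A - P" "t \<in> A - P"
    using assms by (auto simp: localization_def)
  moreover from this have "s * t \<in> A - P" "a * b \<in> A" using P(7,8) by blast+
  ultimately show ?thesis unfolding localization_def by (intro CollectI exI[of _ "a * b"] exI[of _ "s * t"]) simp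
qed

lemma localization_antimono: "Q \<subseteq> P \<Longrightarrow> localization A P \<subseteq> localization A Q"
  by (auto simp: localization_def)

abbreviation fract_embed :: "'n::{finite,linorder} laurent set \<Rightarrow> 'n ratfun set" where
  "fract_embed A \<equiv> (\<lambda>p. Fract p 1) ` A"

lemma primeideal_embedI:
  fixes A :: "'n::{finite,linorder} laurent set"
  assumes A: "0 \<in> A" "1 \<in> A" "\<And>a b. a \<in> A \<Longrightarrow> b \<in> A \<Longrightarrow> a + b \<in> A" "\<And>a. a \<in> A \<Longrightarrow> - a \<in> A"
      "\<And>a b. a \<in> A \<Longrightarrow> b \<in> A \<Longrightarrow> a * b \<in> A"
    and P: "P \<subseteq> A" "0 \<in> P" "\<And>x y. x \<in> P \<Longrightarrow> y \<in> P \<Longrightarrow> x + y \<in> P" "\<And>a x. a \<in> A \<Longrightarrow> x \<in> P \<Longrightarrow> a * x \<in> P"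
      "1 \<notin> P" "\<And>a b. a \<in> A \<Longrightarrow> b \<in> A \<Longrightarrow> a * b \<in> P \<Longrightarrow> a \<in> P \<or> b \<in> P"
  shows "primeideal (fract_embed P) (subring_struct (fract_embed A))"
proof (rule primeideal_subringI)
  fix a b assume "a \<in> fract_embed A" "b \<in> fract_embed A" "a * b \<in> fract_embed P"
  then obtain p q where "a = Fract p 1" "b = Fract q 1" "p \<in> A" "q \<in> A" "p * q \<in> P" by auto
  then show "a \<in> fract_embed P \<or> b \<in> fract_embed P" using P(6) by blast
qed (use A P(1-5) in \<open>auto simp: Zero_fract_def One_fract_def image_iff\<close>)

lemma localization_embed:
  fixes A P :: "'n::{finite,linorder} laurent set"
  assumes "0 \<in> P"
  shows "localization (fract_embed A) (fract_embed P) = {Fract a s | a s. a \<in> A \<and> s \<in> A \<and> s \<notin> P}"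
proof -
  have div: "Fract a 1 / Fract s 1 = Fract a s" for a s :: "'n laurent" by simp
  have mem: "Fract s 1 \<in> fract_embed P \<longleftrightarrow> s \<in> P" for s by auto
  show ?thesis
  proof (intro equalityI subsetI)
    fix x assume "x \<in> localization (fract_embed A) (fract_embed P)"
    then obtain a s where "x = Fract a 1 / Fract s 1" "a \<in> A" "s \<in> A" "Fract s 1 \<notin> fract_embed P"
      by (auto simp: localization_def)
    then show "x \<in> {Fract a s | a s. a \<in> A \<and> s \<in> A \<and> s \<notin> P}"
      unfolding div mem by blast
  next
    fix x assume "x \<in> {Fract a s | a s. a \<in> A \<and> s \<in> A \<and> s \<notin> P}"
    then obtain a s where "x = Fract a 1 / Fract s 1" "a \<in> A" "s \<in> A" "Fract s 1 \<notin> fract_embed P"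
      unfolding div mem by blast
    then show "x \<in> localization (fract_embed A) (fract_embed P)" unfolding localization_def by blast
  qed
qed

text \<open>If the exponent of a fraction is nonnegative, the power of \<open>g\<close> in its
  denominator cancels against the numerator.\<close>

lemma localization_prime_elem:
  fixes g :: "'n::{finite,linorder} laurent"
  assumes g: "prime_elem g"
  shows "primeideal (fract_embed {p. g dvd p}) (subring_struct (fract_embed UNIV))"
    "localization (fract_embed UNIV) (fract_embed {p. g dvd p}) = prime_ring g"
proof -
  show "primeideal (fract_embed {p. g dvd p}) (subring_struct (fract_embed UNIV))"
    by (rule primeideal_embedI) (use g prime_elem_not_unit prime_elem_dvd_multD in auto)
  have "x \<in> prime_ring g \<longleftrightarrow> (\<exists>a s. x = Fract a s \<and> \<not> g dvd s)" for x
  proof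
    assume "\<exists>a s. x = Fract a s \<and> \<not> g dvd s"
    then obtain a s where x: "x = Fract a s" and s: "\<not> g dvd s" by blast
    have "s \<noteq> 0" using s by auto
    then show "x \<in> prime_ring g"
      using s g prime_exp_eq_0_iff[OF g, of s] prime_exp_nonneg[OF g, of a]
      by (simp add: x in_prime_ring_iff) blast
  next
    assume x: "x \<in> prime_ring g"
    obtain a b where ab: "x = Fract a b" "b \<noteq> 0" by (metis Fract_cases)
    show "\<exists>a s. x = Fract a s \<and> \<not> g dvd s"
    proof (cases "a = 0")
      case True
      then have "x = Fract 0 1" using ab by (simp add: Zero_fract_def eq_fract)
      then show ?thesis using g prime_elem_not_unit by blast
    next
      case False
      obtain n h where a: "a = g ^ n * h" "\<not> g dvd h" using prime_exp_exists[OF g False] by blast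
      obtain l k where b: "b = g ^ l * k" "\<not> g dvd k" using prime_exp_exists[OF g ab(2)] by blast
      have "prime_exp g a = int n" "prime_exp g b = int l" using a b g prime_exp_eqI by simp_all
      then have "l \<le> n" using x ab False g by (simp add: in_prime_ring_iff)
      then obtain d where d: "n = l + d" using le_Suc_ex by blast
      have "k \<noteq> 0" using b by auto
      moreover have "a * k = (g ^ d * h) * b" by (simp only: a(1) b(1) d power_add mult_ac)
      ultimately have "x = Fract (g ^ d * h) k" using ab by (simp add: eq_fract)
      then show ?thesis using b by blast
    qed
  qed
  then show "localization (fract_embed UNIV) (fract_embed {p. g dvd p}) = prime_ring g"
    by (subst localization_embed) auto
qed

text \<open>The assumption \<open>dual\<close> expresses linear independence through integral functionals.\<close>
locale simplicial_gens =
  fixes V :: "(int ^ 'n::{finite,linorder}) set"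
  assumes fin: "finite V"
    and primitive: "\<And>v. v \<in> V \<Longrightarrow> \<exists>m. pairing m v = 1"
    and dual: "\<And>v. v \<in> V \<Longrightarrow> \<exists>m. 0 < pairing m v \<and> (\<forall>v'\<in>V - {v}. pairing m v' = 0)"
begin

text \<open>The dual functionals of the elements of \<open>W\<close> are added up: at
  \<open>v\<close> in \<open>W\<close> only its own summand survives, and elsewhere none
  does.\<close>

lemma separating:
  assumes "W \<subseteq> V"
  shows "\<exists>m. (\<forall>v\<in>W. 0 < pairing m v) \<and> (\<forall>v\<in>V - W. pairing m v = 0)"
proof -
  obtain d where d: "\<And>v. v \<in> V \<Longrightarrow> 0 < pairing (d v) v"
    "\<And>v v'. v \<in> V \<Longrightarrow> v' \<in> V \<Longrightarrow> v' \<noteq> v \<Longrightarrow> pairing (d v) v' = 0"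
    using dual by (metis Diff_iff singletonD)
  have finW: "finite W" using assms fin finite_subset by blast
  show ?thesis
  proof (intro exI[of _ "sum d W"] conjI ballI)
    fix v assume v: "v \<in> W"
    have "(\<Sum>w\<in>W. pairing (d w) v) = (\<Sum>w\<in>W. if w = v then pairing (d v) v else 0)"
      using d v assms by (intro sum.cong) auto
    then show "0 < pairing (sum d W) v" using d v assms finW by (auto simp: pairing_sum)
  next
    fix v assume v: "v \<in> V - W"
    then show "pairing (sum d W) v = 0"
      using d assms by (auto simp: pairing_sum intro!: sum.neutral)
  qed
qed

lemma clear:
  assumes "finite F"
  shows "\<exists>m. \<forall>k\<in>F. \<forall>v\<in>V. 0 \<le> pairing k v + pairing m v"
proof -
  obtain m where m: "\<forall>v\<in>V. 0 < pairing m v" using separating[OF subset_refl] by blast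
  have "\<exists>N::nat. \<forall>k\<in>F. \<forall>v\<in>V. 0 \<le> pairing k v + pairing (frag_cmul (int N) m) v"
    by (rule clear_exponents[OF fin assms]) (use m in blast)
  then show ?thesis by blast
qed

text \<open>The prime ideal of the divisor of \<open>v\<close> in the chart.\<close>

definition ray_ideal :: "int ^ 'n::{finite,linorder} \<Rightarrow> 'n laurent set" where
  "ray_ideal v = {p \<in> dual_ring V. p = 0 \<or> 0 < low v p}"

lemma low_nonneg: "p \<in> dual_ring V \<Longrightarrow> p \<noteq> 0 \<Longrightarrow> v \<in> V \<Longrightarrow> 0 \<le> low v p"
  by (auto simp: low_ge_iff dual_ring_def)

lemma ray_ideal_prime:
  assumes v: "v \<in> V"
  shows "primeideal (fract_embed (ray_ideal v)) (subring_struct (fract_embed (dual_ring V)))"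
proof (rule primeideal_embedI)
  show "x + y \<in> ray_ideal v" if "x \<in> ray_ideal v" "y \<in> ray_ideal v" for x y
    using that low_add_ge[of x y 1 v] by (cases "x = 0 \<or> y = 0 \<or> x + y = 0") (auto simp: ray_ideal_def dual_ring_add)
  show "a * x \<in> ray_ideal v" if "a \<in> dual_ring V" "x \<in> ray_ideal v" for a x
    using that low_nonneg[of a v] v by (cases "a = 0 \<or> x = 0") (auto simp: ray_ideal_def dual_ring_mult low_mult)
  show "a \<in> ray_ideal v \<or> b \<in> ray_ideal v"
    if "a \<in> dual_ring V" "b \<in> dual_ring V" "a * b \<in> ray_ideal v" for a b
    using that low_nonneg[of a v] low_nonneg[of b v] v
    by (cases "a = 0 \<or> b = 0") (auto simp: ray_ideal_def low_mult)
qed (auto simp: ray_ideal_def dual_ring_add dual_ring_mult dual_ring_uminus)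

text \<open>Numerator and denominator are multiplied by a common monomial. Its exponent has to bring
  the denominator to order exactly zero along \<open>v\<close> and be large on the other generators,
  so that both parts enter the chart ring.\<close>

lemma localization_ray_ideal:
  assumes v: "v \<in> V"
  shows "localization (fract_embed (dual_ring V)) (fract_embed (ray_ideal v)) = ray_ring v"
proof -
  have "x \<in> ray_ring v \<longleftrightarrow> (\<exists>a s. x = Fract a s \<and> a \<in> dual_ring V \<and> s \<in> dual_ring V \<and> s \<notin> ray_ideal v)" for x
  proof
    assume "\<exists>a s. x = Fract a s \<and> a \<in> dual_ring V \<and> s \<in> dual_ring V \<and> s \<notin> ray_ideal v"
    then obtain a s where *: "x = Fract a s" "a \<in> dual_ring V" "s \<noteq> 0" "low v s \<le> 0"
      by (auto simp: ray_ideal_def)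
    then show "x \<in> ray_ring v"
      using low_nonneg[OF *(2) _ v] by (cases "a = 0") (auto simp: in_ray_ring_iff)
  next
    assume x: "x \<in> ray_ring v"
    obtain a b where ab: "x = Fract a b" "b \<noteq> 0" by (metis Fract_cases)
    have le: "a = 0 \<or> low v b \<le> low v a" using x ab by (simp add: in_ray_ring_iff)
    obtain m0 where m0: "pairing m0 v = 1" using primitive[OF v] by blast
    obtain m1 where m1: "\<forall>w\<in>V - {v}. 0 < pairing m1 w" "pairing m1 v = 0"
      using separating[OF Diff_subset[of V "{v}"]] v by blast
    \<comment> \<open>\<open>m2\<close> sets the order along \<open>v\<close>; multiples of
      \<open>m1\<close>, which vanishes on \<open>v\<close>, then take care of the other generators
      without disturbing it.\<close>
    define m2 where "m2 = frag_cmul (- low v b) m0"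
    have "finite (V - {v})" "finite ((\<lambda>k. k + m2) ` (Poly_Mapping.keys a \<union> Poly_Mapping.keys b))"
      using fin by simp_all
    from clear_exponents[OF this m1(1)[rule_format]]
    obtain N :: nat where N: "\<forall>k\<in>(\<lambda>k. k + m2) ` (Poly_Mapping.keys a \<union> Poly_Mapping.keys b).
        \<forall>w\<in>V - {v}. 0 \<le> pairing k w + pairing (frag_cmul (int N) m1) w" by blast
    define m where "m = m2 + frag_cmul (int N) m1"
    have mv: "pairing m v = - low v b" by (simp add: m_def m2_def m0 m1)
    have pos: "0 \<le> pairing k w + pairing m w"
      if "k \<in> Poly_Mapping.keys a \<union> Poly_Mapping.keys b" "w \<in> V" for k w
    proof (cases "w = v")
      case True
      have "low v b \<le> pairing k v"
        using that(1) le low_le[of k a v] low_le[of k b v] by auto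
      then show ?thesis using mv True by simp
    next
      case False
      have "k + m2 \<in> (\<lambda>k. k + m2) ` (Poly_Mapping.keys a \<union> Poly_Mapping.keys b)" "w \<in> V - {v}"
        using that False by auto
      with N have "0 \<le> pairing (k + m2) w + pairing (frag_cmul (int N) m1) w" by blast
      then show ?thesis by (simp add: m_def)
    qed
    have "chi m * a \<in> dual_ring V" "chi m * b \<in> dual_ring V"
      using pos by (auto intro!: chi_mult_dual_ringI)
    moreover have "chi m * b \<notin> ray_ideal v" using ab by (simp add: ray_ideal_def low_mult mv)
    moreover have "x = Fract (chi m * a) (chi m * b)" using ab by (simp add: eq_fract mult_ac)
    ultimately show "\<exists>a s. x = Fract a s \<and> a \<in> dual_ring V \<and> s \<in> dual_ring V \<and> s \<notin> ray_ideal v" by blast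
  qed
  then show ?thesis by (subst localization_embed) (auto simp: ray_ideal_def)
qed

text \<open>An inclusion in the last two cases suffices for finding the points of codimension one,
  because valuation rings are maximal. A nonzero prime without monomials contains a prime element of
  the Laurent ring; a prime with a monomial is studied through the monomials outside it.\<close>

lemma chart_point_cases:
  assumes "primeideal P' (subring_struct (fract_embed (dual_ring V)))"
  shows "localization (fract_embed (dual_ring V)) P' = UNIV \<or>
    (\<exists>g. prime_elem g \<and> localization (fract_embed (dual_ring V)) P' \<subseteq> prime_ring g) \<or>
    (\<exists>v\<in>V. localization (fract_embed (dual_ring V)) P' \<subseteq> ray_ring v)"
proof -
  let ?A = "dual_ring V"
  note P' = primeideal_subringD[OF assms]
  define P where "P = {p. Fract p 1 \<in> P'}"
  have P'_eq: "P' = fract_embed P" using P'(1) by (auto simp: P_def)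
  have PA: "P \<subseteq> ?A" using P'(1) by (auto simp: P_def)
  have P0: "0 \<in> P" using P'(2) by (simp add: P_def Zero_fract_def)
  have P1: "1 \<notin> P" using P'(6) by (simp add: P_def One_fract_def)
  have Padd: "x + y \<in> P" if "x \<in> P" "y \<in> P" for x y
    using P'(3)[of "Fract x 1" "Fract y 1"] that by (simp add: P_def)
  have Pmult: "a * x \<in> P" if "a \<in> ?A" "x \<in> P" for a x
    using P'(4)[of "Fract a 1" "Fract x 1"] that by (simp add: P_def)
  have Pprime: "a \<in> P \<or> b \<in> P" if "a \<in> ?A" "b \<in> ?A" "a * b \<in> P" for a b
    using P'(7)[of "Fract a 1" "Fract b 1"] that by (simp add: P_def)
  have loc: "localization (fract_embed ?A) P' = {Fract a s | a s. a \<in> ?A \<and> s \<in> ?A \<and> s \<notin> P}"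
    unfolding P'_eq by (rule localization_embed) (rule P0)
  consider "P = {0}" | m where "chi m \<in> P" | f where "f \<in> P" "f \<noteq> 0" "\<And>m. chi m \<notin> P"
    using P0 by blast
  then show ?thesis
  proof cases
    case 1
    have "x \<in> localization (fract_embed ?A) P'" for x
    proof -
      obtain a b where ab: "x = Fract a b" "b \<noteq> 0" by (metis Fract_cases)
      obtain m where "\<forall>k\<in>Poly_Mapping.keys a \<union> Poly_Mapping.keys b. \<forall>v\<in>V. 0 \<le> pairing k v + pairing m v"
        using clear[OF finite_UnI[OF finite_keys finite_keys]] by blast
      then have "chi m * a \<in> ?A" "chi m * b \<in> ?A" by (auto intro!: chi_mult_dual_ringI)
      moreover have "chi m * b \<notin> P" using 1 ab by simp
      moreover have "x = Fract (chi m * a) (chi m * b)" using ab by (simp add: eq_fract mult_ac)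
      ultimately show ?thesis unfolding loc by blast
    qed
    then show ?thesis by blast
  next
    case (2 m)
    \<comment> \<open>Exponents of the chart monomials outside \<open>P\<close>; primality makes
      them a monoid.\<close>
    define Q where "Q = {k. chi k \<in> ?A \<and> chi k \<notin> P}"
    have Q0: "0 \<in> Q" using P1 by (simp add: Q_def)
    have Qadd: "k + l \<in> Q" if "k \<in> Q" "l \<in> Q" for k l
      using that Pprime[of "chi k" "chi l"] dual_ring_mult[of "chi k" V "chi l"] by (auto simp: Q_def chi_mult)
    have Qmul: "frag_cmul (int N) k \<in> Q" if "k \<in> Q" for k N
      by (induction N) (auto simp: Q0 frag_cmul_distrib that Qadd)
    have Qsum: "(\<Sum>w\<in>W. k w) \<in> Q" if "\<And>w. w \<in> W \<Longrightarrow> k w \<in> Q" for W :: "(int ^ 'n::{finite,linorder}) set" and k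
      using that by (induction W rule: infinite_finite_induct) (auto simp: Q0 Qadd)
    have "\<exists>v\<in>V. ray_ideal v \<subseteq> P"
    proof (rule ccontr)
      assume contra: "\<not> (\<exists>v\<in>V. ray_ideal v \<subseteq> P)"
      have "\<exists>k\<in>Q. 0 < pairing k v" if v: "v \<in> V" for v
      proof -
        obtain p where p: "p \<in> ray_ideal v" "p \<notin> P" using contra v by blast
        have pnz: "p \<noteq> 0" using p P0 by auto
        \<comment> \<open>Otherwise every term of \<open>p\<close> would lie in \<open>P\<close>,
          and so would \<open>p\<close>.\<close>
        have "\<exists>k\<in>Poly_Mapping.keys p. chi k \<notin> P"
        proof (rule ccontr)
          assume *: "\<not> (\<exists>k\<in>Poly_Mapping.keys p. chi k \<notin> P)"
          have "Poly_Mapping.single 0 (Poly_Mapping.lookup p k) * chi k \<in> P" if "k \<in> Poly_Mapping.keys p" for k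
            using * that by (intro Pmult) (auto simp: dual_ring_def)
          then have "Poly_Mapping.single k (Poly_Mapping.lookup p k) \<in> P" if "k \<in> Poly_Mapping.keys p" for k
            using that by (simp add: chi_def mult_single)
          then have "(\<Sum>k\<in>K. Poly_Mapping.single k (Poly_Mapping.lookup p k)) \<in> P" if "K \<subseteq> Poly_Mapping.keys p" for K
            using that by (induction K rule: infinite_finite_induct) (auto simp: P0 Padd)
          then have "(\<Sum>k\<in>Poly_Mapping.keys p. Poly_Mapping.single k (Poly_Mapping.lookup p k)) \<in> P" by blast
          moreover have "(\<Sum>k\<in>Poly_Mapping.keys p. Poly_Mapping.single k (Poly_Mapping.lookup p k)) = p"
            by (rule poly_mapping_eqI) (auto simp: lookup_sum lookup_single when_def in_keys_iff)
          ultimately show False using p by simp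
        qed
        then obtain k where k: "k \<in> Poly_Mapping.keys p" "chi k \<notin> P" by blast
        have "chi k \<in> ?A" "0 < pairing k v"
          using p pnz k low_le[OF k(1), of v] by (auto simp: ray_ideal_def dual_ring_def)
        then show ?thesis using k by (auto simp: Q_def)
      qed
      then obtain k where k: "\<And>v. v \<in> V \<Longrightarrow> k v \<in> Q" "\<And>v. v \<in> V \<Longrightarrow> 0 < pairing (k v) v" by metis
      \<comment> \<open>The sum stays in \<open>Q\<close> and is positive on every generator, as all
        summands are nonnegative on \<open>V\<close>. A high multiple of it then dominates
        \<open>m\<close>, so its monomial is a chart multiple of \<open>chi m\<close> and lies in
        \<open>P\<close>, against the definition of \<open>Q\<close>.\<close>
      define k0 where "k0 = (\<Sum>v\<in>V. k v)"
      have k0: "k0 \<in> Q" unfolding k0_def by (rule Qsum) (rule k)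
      have k0pos: "0 < pairing k0 v" if v: "v \<in> V" for v
      proof -
        have "pairing (k v) v \<le> (\<Sum>w\<in>V. pairing (k w) v)"
          by (rule member_le_sum[of v V "\<lambda>w. pairing (k w) v"]) (use v k(1) fin in \<open>auto simp: Q_def chi_dual_ring\<close>)
        then show ?thesis using k(2)[OF v] by (simp add: k0_def pairing_sum)
      qed
      obtain N :: nat where N: "\<forall>k\<in>{- m}. \<forall>v\<in>V. 0 \<le> pairing k v + pairing (frag_cmul (int N) k0) v"
        using clear_exponents[OF fin _ k0pos, of "{- m}"] by blast
      have "chi (frag_cmul (int N) k0 - m) \<in> ?A" using N by (auto simp: chi_dual_ring)
      then have "chi (frag_cmul (int N) k0 - m) * chi m \<in> P" using Pmult 2 by blast
      then have "chi (frag_cmul (int N) k0) \<in> P" by (simp add: chi_mult)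
      then show False using Qmul[OF k0, of N] by (simp add: Q_def)
    qed
    then obtain v where v: "v \<in> V" "ray_ideal v \<subseteq> P" by blast
    have "localization (fract_embed ?A) P' \<subseteq> localization (fract_embed ?A) (fract_embed (ray_ideal v))"
      using v by (intro localization_antimono) (auto simp: P_def)
    then show ?thesis using v localization_ray_ideal by auto
  next
    case (3 f)
    have single: "Poly_Mapping.single m c \<notin> P" if "c \<noteq> 0" for m c
    proof
      assume "Poly_Mapping.single m c \<in> P"
      then have "Poly_Mapping.single 0 (inverse c) * Poly_Mapping.single m c \<in> P"
        by (intro Pmult) (auto simp: dual_ring_def)
      then show False using 3(3)[of m] that by (simp add: mult_single chi_def)
    qed
    \<comment> \<open>The Laurent factors of \<open>f\<close> may leave the chart ring; admitting a
      monomial multiplier makes the induction over prime factors possible.\<close>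
    have "(\<exists>m. chi m * f \<in> P) \<longrightarrow> (\<exists>g\<in>P. prime_elem g)"
      using 3(2)
    proof (induction rule: laurent_prime_induct)
      case (unit u)
      then obtain m c where "c \<noteq> 0" "u = Poly_Mapping.single m c" by (rule laurent_unit)
      then show ?case using single by (auto simp: chi_def mult_single)
    next
      case (prime p f)
      show ?case
      proof
        assume "\<exists>m. chi m * (p * f) \<in> P"
        then obtain m where m: "chi m * (p * f) \<in> P" by blast
        obtain a where a: "\<forall>k\<in>Poly_Mapping.keys p. \<forall>v\<in>V. 0 \<le> pairing k v + pairing a v"
          using clear[OF finite_keys] by blast
        \<comment> \<open>Including \<open>a - m\<close> makes \<open>chi (a - m + b)\<close> a
          chart function. It trades the multiplier \<open>chi m\<close> for
          \<open>chi a * chi b\<close>, one monomial for each factor.\<close>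
        obtain b where b: "\<forall>k\<in>insert (a - m) (Poly_Mapping.keys f). \<forall>v\<in>V. 0 \<le> pairing k v + pairing b v"
          using clear[OF finite.insertI[OF finite_keys]] by blast
        have A: "chi a * p \<in> ?A" "chi b * f \<in> ?A" using a b by (auto intro!: chi_mult_dual_ringI)
        have "chi (a - m + b) \<in> ?A" using b by (auto simp: chi_dual_ring)
        then have "chi (a - m + b) * (chi m * (p * f)) \<in> P" using m Pmult by blast
        moreover have "chi (a - m + b) * (chi m * (p * f)) = (chi (a - m + b) * chi m) * (p * f)"
          by (simp only: mult.assoc)
        moreover have "chi (a - m + b) * chi m = chi a * (chi b :: 'n laurent)"
          by (simp add: chi_mult add.commute)
        ultimately have "chi a * p * (chi b * f) \<in> P" by (simp only: mult_ac)
        then consider "chi a * p \<in> P" | "chi b * f \<in> P" using Pprime A by blast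
        then show "\<exists>g\<in>P. prime_elem g"
        proof cases
          case 1
          have "prime_elem (chi a * p)"
          proof -
            have dvd: "chi a * p dvd x \<longleftrightarrow> p dvd x" for x
            proof
              assume "p dvd x"
              then have "chi a * p dvd chi a * x" by (rule mult_dvd_mono[OF dvd_refl])
              then have "chi a * p dvd chi (- a) * (chi a * x)" by (rule dvd_mult)
              then show "chi a * p dvd x" by (simp flip: mult.assoc)
            qed (rule dvd_mult_right)
            show ?thesis using prime.hyps(1) unfolding prime_elem_def dvd by auto
          qed
          then show ?thesis using 1 by blast
        next
          case 2 then show ?thesis using prime.IH by blast
        qed
      qed
    qed
    moreover have "chi 0 * f \<in> P" using 3 by simp
    ultimately obtain g where g: "g \<in> P" "prime_elem g" by blast
    have "x \<in> prime_ring g" if "x \<in> localization (fract_embed ?A) P'" for x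
    proof -
      obtain a s where *: "x = Fract a s" "s \<in> ?A" "s \<notin> P"
        using \<open>x \<in> localization (fract_embed ?A) P'\<close> unfolding loc by blast
      \<comment> \<open>A cofactor of \<open>g\<close> in \<open>s\<close> enters the chart ring
        after multiplication by some chart monomial \<open>chi k\<close>. Since \<open>chi k\<close>
        is outside \<open>P\<close>, primality would force \<open>s\<close> into
        \<open>P\<close>.\<close>
      have "\<not> g dvd s"
      proof
        assume "g dvd s"
        then obtain h where h: "s = g * h" by blast
        obtain k where k: "\<forall>l\<in>insert 0 (Poly_Mapping.keys h). \<forall>v\<in>V. 0 \<le> pairing l v + pairing k v"
          using clear[OF finite.insertI[OF finite_keys]] by blast
        have kA: "chi k \<in> ?A" using k by (auto simp: chi_dual_ring)
        have "chi k * h \<in> ?A" using k by (auto intro!: chi_mult_dual_ringI)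
        then have "(chi k * h) * g \<in> P" using g Pmult by blast
        then have "chi k * s \<in> P" by (simp only: h mult_ac)
        then show False using Pprime[OF kA *(2)] 3(3) * by blast
      qed
      moreover have "s \<noteq> 0" using * P0 by auto
      ultimately show ?thesis
        using g(2) prime_exp_eq_0_iff[OF g(2), of s] prime_exp_nonneg[OF g(2), of a]
        by (simp add: *(1) in_prime_ring_iff) blast
    qed
    then show ?thesis using g by blast
  qed
qed

end

section \<open>Integral projections\<close>

definition zspan :: "(int ^ 'n) set \<Rightarrow> (int ^ 'n) set" where
  "zspan B = generate lattice_group B"

lemma group_lattice_group: "comm_group (lattice_group :: (int ^ 'n) monoid)"
  by (rule comm_groupI) (auto simp: lattice_group_def add_ac intro: exI[of _ "- x" for x])

lemma carrier_lattice_group [simp]: "carrier lattice_group = UNIV"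
  and mult_lattice_group [simp]: "x \<otimes>\<^bsub>lattice_group\<^esub> y = x + y"
  and one_lattice_group [simp]: "\<one>\<^bsub>lattice_group\<^esub> = 0"
  by (simp_all add: lattice_group_def)

lemma inv_lattice_group [simp]: "inv\<^bsub>lattice_group\<^esub> x = - x"
proof -
  interpret comm_group "lattice_group :: (int ^ 'n) monoid" by (rule group_lattice_group)
  show ?thesis by (rule inv_equality) auto
qed

lemma zspan_base: "b \<in> B \<Longrightarrow> b \<in> zspan B"
  unfolding zspan_def by (rule generate.incl)

lemma zspan_0: "0 \<in> zspan B"
  unfolding zspan_def using generate.one[of lattice_group B] by simp

lemma zspan_add: "x \<in> zspan B \<Longrightarrow> y \<in> zspan B \<Longrightarrow> x + y \<in> zspan B"
  unfolding zspan_def using generate.eng[of x lattice_group B y] by simp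

lemma zspan_induct [consumes 1, case_names zero base neg add]:
  assumes "x \<in> zspan B" "P 0" "\<And>b. b \<in> B \<Longrightarrow> P b" "\<And>b. b \<in> B \<Longrightarrow> P (- b)"
    "\<And>x y. P x \<Longrightarrow> P y \<Longrightarrow> P (x + y)"
  shows "P x"
  using assms(1) unfolding zspan_def by (induction rule: generate.induct) (use assms in auto)

lemma zspan_uminus: "x \<in> zspan B \<Longrightarrow> - x \<in> zspan B"
proof (induction rule: zspan_induct)
  case (neg b) then show ?case by (simp add: zspan_base)
next
  case (base b) then show ?case
    unfolding zspan_def using generate.inv[of b B lattice_group] by simp
next
  case (add x y) then show ?case using zspan_add[of "- x" B "- y"] by (simp add: add.commute)
qed (simp add: zspan_0)

lemma zspan_diff: "x \<in> zspan B \<Longrightarrow> y \<in> zspan B \<Longrightarrow> x - y \<in> zspan B"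
  using zspan_add[of x B "- y"] zspan_uminus[of y B] by simp

lemma zspan_scale: "x \<in> zspan B \<Longrightarrow> c *s x \<in> zspan B"
proof (induction c rule: int_induct[where k = 0])
  case base show ?case by (simp add: zspan_0)
next
  case (step1 i) then show ?case using zspan_add[of "i *s x" B x] by (simp add: vector_sadd_rdistrib)
next
  case (step2 i) then show ?case
    using zspan_diff[of "i *s x" B x] by (simp add: vector_ssub_ldistrib left_diff_distrib Finite_Cartesian_Product.vec_eq_iff)
qed

lemma zspan_mono: "B \<subseteq> C \<Longrightarrow> zspan B \<subseteq> zspan C"
  unfolding zspan_def using group.mono_generate comm_group.axioms(2)[OF group_lattice_group] by blast

section \<open>The integral dot product and orthogonal projection\<close>

definition dot :: "int ^ 'n::finite \<Rightarrow> int ^ 'n \<Rightarrow> int" where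
  "dot v w = (\<Sum>i\<in>UNIV. vec_nth v i * vec_nth w i)"

lemma dot_simps:
  "dot (v + v') w = dot v w + dot v' w" "dot (v - v') w = dot v w - dot v' w"
  "dot (c *s v) w = c * dot v w" "dot v (w + w') = dot v w + dot v w'"
  "dot v (w - w') = dot v w - dot v w'" "dot v (c *s w) = c * dot v w"
  "dot v (- w) = - dot v w" "dot v 0 = 0" "dot 0 w = 0"
  by (simp_all add: dot_def sum.distrib sum_subtractf sum_distrib_left sum_negf algebra_simps)

lemma dot_self_eq_0: "dot v v = 0 \<longleftrightarrow> v = 0"
proof
  assume "dot v v = 0"
  then have "\<forall>i\<in>UNIV. vec_nth v i * vec_nth v i = 0"
    unfolding dot_def by (subst (asm) sum_nonneg_eq_0_iff) auto
  then show "v = 0" by (simp add: Finite_Cartesian_Product.vec_eq_iff)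
qed (simp add: dot_simps)

lemma dot_self_nonneg: "0 \<le> dot v v"
  by (simp add: dot_def sum_nonneg)

lemma dot_zspan:
  assumes "x \<in> zspan B" "\<And>b. b \<in> B \<Longrightarrow> dot v b = 0" shows "dot v x = 0"
  using assms(1) by (induction rule: zspan_induct) (simp_all add: dot_simps assms(2))

text \<open>Gram-Schmidt over the integers: the multiplier \<open>k\<close> clears the denominators,
  so that \<open>u\<close>, a multiple of the projection, is an integral combination of
  \<open>B\<close>.\<close>

lemma integral_projection:
  assumes "finite B"
  shows "\<exists>k u. 0 < k \<and> u \<in> zspan B \<and> (\<forall>c\<in>B. dot (k *s b - u) c = 0)"
  using assms
proof (induction arbitrary: b rule: finite_induct)
  case empty
  show ?case by (intro exI[of _ 1] exI[of _ 0]) (simp add: zspan_0)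
next
  case (insert c B)
  obtain k u where u: "0 < k" "u \<in> zspan B" "\<forall>d\<in>B. dot (k *s c - u) d = 0" using insert.IH by blast
  obtain l x where x: "0 < l" "x \<in> zspan B" "\<forall>d\<in>B. dot (l *s b - x) d = 0" using insert.IH by blast
  define c' b' where "c' = k *s c - u" and "b' = l *s b - x"
  define n where "n = dot c' c'"
  have sub: "zspan B \<subseteq> zspan (insert c B)" by (rule zspan_mono) blast
  have xS: "x \<in> zspan (insert c B)" and uS: "u \<in> zspan (insert c B)" using x u sub by auto
  have c'S: "c' \<in> zspan (insert c B)"
    unfolding c'_def by (intro zspan_diff zspan_scale zspan_base uS) simp
  have perp: "dot b' u = 0" "dot c' u = 0"
    using dot_zspan[OF u(2)] x u by (auto simp: c'_def b'_def)
  show ?case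
  proof (cases "n = 0")
    case True
    \<comment> \<open>The new vector depends rationally on \<open>B\<close>, so the residue of
      \<open>b\<close> is already orthogonal to it.\<close>
    then have "k *s c = u" by (simp add: n_def c'_def dot_self_eq_0)
    then have "dot b' c = 0" using perp dot_simps(6)[of b' k c] u by simp
    then show ?thesis using x xS by (intro exI[of _ l] exI[of _ x]) (simp add: b'_def)
  next
    case False
    then have n: "0 < n" using dot_self_nonneg[of c'] by (simp add: n_def)
    \<comment> \<open>The usual Gram-Schmidt correction, multiplied by \<open>dot c' c'\<close> to
      stay integral.\<close>
    define w where "w = n *s b' - dot b' c' *s c'"
    have w: "w = (n * l) *s b - (n *s x + dot b' c' *s c')"
      by (simp add: w_def b'_def Finite_Cartesian_Product.vec_eq_iff algebra_simps)
    have "dot w c' = 0" by (simp add: w_def dot_simps n_def)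
    moreover have "dot w u = 0" by (simp add: w_def dot_simps perp)
    moreover have "k *s c = c' + u" by (simp add: c'_def)
    ultimately have "k * dot w c = 0" by (metis dot_simps(4,6) add_0)
    then have "dot w c = 0" using u by simp
    moreover have "dot w d = 0" if "d \<in> B" for d
    proof -
      have "dot b' d = 0" "dot c' d = 0" using that u x by (auto simp: b'_def c'_def)
      then show ?thesis by (simp add: w_def dot_simps(2,3))
    qed
    moreover have "n *s x + dot b' c' *s c' \<in> zspan (insert c B)"
      by (intro zspan_add zspan_scale xS c'S)
    ultimately show ?thesis using n x unfolding w
      by (intro exI[of _ "n * l"] exI[of _ "n *s x + dot b' c' *s c'"]) simp
  qed
qed

section \<open>Integral vectors in real subspaces\<close>

lemma real_pt_simps [simp]:
  "real_pt (v + w) = real_pt v + real_pt w" "real_pt (v - w) = real_pt v - real_pt w"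
  "real_pt (- v) = - real_pt v" "real_pt (c *s v) = of_int c *\<^sub>R real_pt v" "real_pt 0 = 0"
  by (simp_all add: real_pt_def Finite_Cartesian_Product.vec_eq_iff)

lemma real_pt_inject [simp]: "real_pt v = real_pt w \<longleftrightarrow> v = w"
  by (simp add: real_pt_def Finite_Cartesian_Product.vec_eq_iff)

lemma real_pt_eq_0_iff [simp]: "real_pt v = 0 \<longleftrightarrow> v = 0"
  using real_pt_inject[of v 0] by (simp del: real_pt_inject)

lemma real_pt_inner: "real_pt v \<bullet> real_pt w = of_int (dot v w)"
  by (simp add: inner_vec_def real_pt_def dot_def)

lemma real_pt_zspan: "x \<in> zspan B \<Longrightarrow> real_pt x \<in> span (real_pt ` B)"
  by (induction rule: zspan_induct) (auto intro: span_base span_neg span_add span_zero)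

text \<open>The integral residue \<open>k *s b - u\<close> lies in the real span and is orthogonal
  to it, hence vanishes.\<close>

lemma span_imp_zspan_multiple:
  assumes "finite B" "real_pt b \<in> span (real_pt ` B)"
  shows "\<exists>k>0. k *s b \<in> zspan B"
proof -
  obtain k u where u: "0 < k" "u \<in> zspan B" "\<forall>c\<in>B. dot (k *s b - u) c = 0"
    using integral_projection[OF assms(1)] by blast
  let ?z = "k *s b - u"
  have "real_pt ?z \<in> span (real_pt ` B)"
    using assms(2) real_pt_zspan[OF u(2)] by (auto intro: span_diff span_scale)
  moreover have "span (real_pt ` B) \<subseteq> {x. inner (real_pt ?z) x = 0}"
    by (rule span_minimal[OF _ subspace_hyperplane])
      (use u(3) in \<open>auto simp: real_pt_inner simp del: real_pt_simps\<close>)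
  ultimately have "inner (real_pt ?z) (real_pt ?z) = 0" by blast
  then have "k *s b = u" by (simp del: real_pt_simps)
  then show ?thesis using u by blast
qed

lemma pairing_eq_dot: "pairing m v = dot (\<chi> i. Poly_Mapping.lookup m i) v"
  by (simp add: pairing_def dot_def)

lemma pairing_realize: "\<exists>m. \<forall>v. pairing m v = dot w v"
proof -
  have "Poly_Mapping.lookup (\<Sum>i\<in>UNIV. Poly_Mapping.single i (vec_nth w i)) j = vec_nth w j" for j
    by (simp add: lookup_sum lookup_single when_def)
  then show ?thesis
    by (intro exI[of _ "\<Sum>i\<in>UNIV. Poly_Mapping.single i (vec_nth w i)"]) (simp add: pairing_def dot_def)
qed

text \<open>The residue \<open>w\<close> of the integral projection serves as the functional. It is
  nonzero since \<open>b\<close> is outside the span, and \<open>dot w w = k * dot w b\<close> gives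
  the sign.\<close>

lemma dual_vector:
  assumes "finite B" "real_pt b \<notin> span (real_pt ` B)"
  shows "\<exists>m. 0 < pairing m b \<and> (\<forall>c\<in>B. pairing m c = 0)"
proof -
  obtain k u where u: "0 < k" "u \<in> zspan B" "\<forall>c\<in>B. dot (k *s b - u) c = 0"
    using integral_projection[OF assms(1)] by blast
  define w where "w = k *s b - u"
  have "w \<noteq> 0"
  proof
    assume "w = 0"
    then have "of_int k *\<^sub>R real_pt b \<in> span (real_pt ` B)"
      using real_pt_zspan[OF u(2)] by (simp add: w_def flip: real_pt_simps(4))
    then have "inverse (of_int k) *\<^sub>R of_int k *\<^sub>R real_pt b \<in> span (real_pt ` B)" by (rule span_scale)
    then show False using assms u by simp
  qed
  then have "0 < dot w w" using dot_self_nonneg[of w] dot_self_eq_0[of w] by linarith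
  moreover have "dot w u = 0" by (rule dot_zspan[OF u(2)]) (use u in \<open>simp add: w_def\<close>)
  then have "dot w w = k * dot w b" by (subst (2) w_def) (simp add: dot_simps)
  ultimately have "0 < dot w b" using u by (simp add: zero_less_mult_iff)
  moreover obtain m where "\<forall>v. pairing m v = dot w v" using pairing_realize by blast
  ultimately show ?thesis using u by (intro exI[of _ m]) (simp add: w_def)
qed

section \<open>Cones and rays\<close>

lemma convex_cone_hull_finite:
  assumes "finite B"
  shows "convex_cone hull B = {\<Sum>b\<in>B. c b *\<^sub>R b | c. \<forall>b\<in>B. 0 \<le> c b}" (is "_ = ?R")
proof
  have "convex_cone ?R"
    unfolding convex_cone_iff
  proof (intro conjI ballI allI impI)
    show "0 \<in> ?R" by (intro CollectI exI[of _ "\<lambda>_. 0"]) simp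
    fix x y assume "x \<in> ?R" "y \<in> ?R"
    then obtain c d where "x = (\<Sum>b\<in>B. c b *\<^sub>R b)" "y = (\<Sum>b\<in>B. d b *\<^sub>R b)"
      "\<forall>b\<in>B. 0 \<le> c b" "\<forall>b\<in>B. 0 \<le> d b" by auto
    then show "x + y \<in> ?R"
      by (intro CollectI exI[of _ "\<lambda>b. c b + d b"]) (simp add: scaleR_add_left sum.distrib)
  next
    fix x and a :: real assume "x \<in> ?R" "0 \<le> a"
    then obtain c where "x = (\<Sum>b\<in>B. c b *\<^sub>R b)" "\<forall>b\<in>B. 0 \<le> c b" by auto
    then show "a *\<^sub>R x \<in> ?R" using \<open>0 \<le> a\<close>
      by (intro CollectI exI[of _ "\<lambda>b. a * c b"]) (simp add: scaleR_sum_right)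
  qed
  moreover have "B \<subseteq> ?R"
  proof
    fix b assume b: "b \<in> B"
    have "(\<Sum>d\<in>B. (if d = b then 1 else 0) *\<^sub>R d) = (\<Sum>d\<in>B. if d = b then b else 0)"
      by (rule sum.cong) auto
    then show "b \<in> ?R"
      using b assms by (intro CollectI exI[of _ "\<lambda>d. if d = b then 1 else 0"]) simp
  qed
  ultimately show "convex_cone hull B \<subseteq> ?R" by (intro hull_minimal)
  show "?R \<subseteq> convex_cone hull B"
  proof
    fix x assume "x \<in> ?R"
    then obtain c where c: "x = (\<Sum>b\<in>B. c b *\<^sub>R b)" "\<forall>b\<in>B. 0 \<le> c b" by auto
    have "(\<Sum>b\<in>C. c b *\<^sub>R b) \<in> convex_cone hull B" if "C \<subseteq> B" for C
      using that
    proof (induction C rule: infinite_finite_induct)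
      case (insert b C)
      then have "c b *\<^sub>R b \<in> convex_cone hull B"
        using c(2) by (intro convex_cone_hull_mul hull_inc) auto
      then show ?case using insert by (simp add: convex_cone_hull_add)
    qed (simp_all add: convex_cone_hull_contains_0)
    then show "x \<in> convex_cone hull B" using c by blast
  qed
qed

lemma convex_cone_hull_singleton: "convex_cone hull {b} = {t *\<^sub>R b | t. 0 \<le> t}"
  by (auto simp: convex_cone_hull_finite)

lemma convex_cone_hull_subset_span: "convex_cone hull B \<subseteq> span B"
  by (rule hull_minimal) (auto simp: convex_cone_iff intro: span_base span_add span_scale span_zero)

lemma independent_sum_unique:
  assumes "independent B" "finite B" "(\<Sum>b\<in>B. c b *\<^sub>R b) = (\<Sum>b\<in>B. d b *\<^sub>R b)" "b \<in> B"
  shows "c b = d b"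
proof -
  have "(\<Sum>b\<in>B. (c b - d b) *\<^sub>R b) = 0" using assms(3) by (simp add: scaleR_diff_left sum_subtractf)
  moreover have "\<forall>u. (\<exists>v\<in>B. u v \<noteq> 0) \<longrightarrow> (\<Sum>v\<in>B. u v *\<^sub>R v) \<noteq> 0"
    using assms(1,2) by (auto simp: dependent_finite)
  from spec[OF this, of "\<lambda>b. c b - d b"] have "(\<exists>v\<in>B. c v - d v \<noteq> 0) \<longrightarrow> (\<Sum>b\<in>B. (c b - d b) *\<^sub>R b) \<noteq> 0" .
  ultimately show ?thesis using assms(4) by auto
qed

text \<open>Coordinates over \<open>B\<close> are unique, so the points over \<open>C\<close> are
  those whose other coordinates vanish. A combination of nonnegative numbers with positive weights
  vanishes only if both numbers do.\<close>

lemma simplicial_face: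
  fixes B :: "'a::euclidean_space set"
  assumes B: "independent B" and C: "C \<subseteq> B"
  shows "convex_cone hull C face_of convex_cone hull B"
proof -
  have finB: "finite B" using B by (rule finiteI_independent)
  then have finC: "finite C" using C finite_subset by blast
  have C_iff: "(\<Sum>b\<in>B. c b *\<^sub>R b) \<in> convex_cone hull C \<longleftrightarrow> (\<forall>b\<in>B - C. c b = 0)"
    if c: "\<forall>b\<in>B. 0 \<le> c b" for c
  proof
    assume "(\<Sum>b\<in>B. c b *\<^sub>R b) \<in> convex_cone hull C"
    then obtain d where d: "(\<Sum>b\<in>B. c b *\<^sub>R b) = (\<Sum>b\<in>C. d b *\<^sub>R b)"
      unfolding convex_cone_hull_finite[OF finC] by blast
    have "(\<Sum>b\<in>C. d b *\<^sub>R b) = (\<Sum>b\<in>B. (if b \<in> C then d b else 0) *\<^sub>R b)"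
      using C finB by (intro sum.mono_neutral_cong_left) auto
    then have "c b = (if b \<in> C then d b else 0)" if "b \<in> B" for b
      using independent_sum_unique[OF B finB _ that, of c "\<lambda>b. if b \<in> C then d b else 0"] d by simp
    then show "\<forall>b\<in>B - C. c b = 0" by auto
  next
    assume "\<forall>b\<in>B - C. c b = 0"
    then have "(\<Sum>b\<in>B. c b *\<^sub>R b) = (\<Sum>b\<in>C. c b *\<^sub>R b)"
      using C finB by (intro sum.mono_neutral_right) auto
    then show "(\<Sum>b\<in>B. c b *\<^sub>R b) \<in> convex_cone hull C"
      unfolding convex_cone_hull_finite[OF finC] using c C by auto
  qed
  show ?thesis
    unfolding face_of_def
  proof (intro conjI ballI impI)
    show "convex_cone hull C \<subseteq> convex_cone hull B" using C by (rule hull_mono)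
    show "convex (convex_cone hull C)" by (rule convex_convex_cone_hull)
    fix x y z assume x: "x \<in> convex_cone hull B" and y: "y \<in> convex_cone hull B"
      and z: "z \<in> convex_cone hull C" "z \<in> open_segment x y"
    obtain u where u: "0 < u" "u < 1" "z = (1 - u) *\<^sub>R x + u *\<^sub>R y"
      using z(2) by (auto simp: in_segment)
    obtain c where c: "x = (\<Sum>b\<in>B. c b *\<^sub>R b)" "\<forall>b\<in>B. 0 \<le> c b"
      using x unfolding convex_cone_hull_finite[OF finB] by blast
    obtain d where d: "y = (\<Sum>b\<in>B. d b *\<^sub>R b)" "\<forall>b\<in>B. 0 \<le> d b"
      using y unfolding convex_cone_hull_finite[OF finB] by blast
    have "z = (\<Sum>b\<in>B. ((1 - u) * c b + u * d b) *\<^sub>R b)"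
      unfolding u c d by (simp add: scaleR_sum_right scaleR_add_left sum.distrib)
    then have "(\<Sum>b\<in>B. ((1 - u) * c b + u * d b) *\<^sub>R b) \<in> convex_cone hull C" using z(1) by (simp only:)
    moreover have "\<forall>b\<in>B. 0 \<le> (1 - u) * c b + u * d b" using c d u by simp
    ultimately have "\<forall>b\<in>B - C. (1 - u) * c b + u * d b = 0" by (simp only: C_iff)
    then have "\<forall>b\<in>B - C. c b = 0 \<and> d b = 0"
      using c(2) d(2) u by (auto simp: add_nonneg_eq_0_iff)
    then show "x \<in> convex_cone hull C" "y \<in> convex_cone hull C"
      unfolding c(1) d(1) C_iff[OF c(2)] C_iff[OF d(2)] by blast+
  qed
qed

section \<open>Rays and cones of a complete simplicial fan\<close>

locale simplicial_complete_fan =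
  fixes \<Sigma> :: "(real ^ 'n::{finite,linorder}) set set"
  assumes fan: "fan \<Sigma>" and simplicial: "simplicial_fan \<Sigma>" and complete: "complete_fan \<Sigma>"
begin

lemma finite_rays: "finite (rays \<Sigma>)"
  using fan by (simp add: fan_def rays_def)

lemma simplicial_coneE:
  assumes "\<sigma> \<in> \<Sigma>"
  obtains B where "independent B" "finite B" "\<sigma> = convex_cone hull B"
proof -
  obtain B where "independent B" "\<sigma> = convex_cone hull B"
    using assms simplicial by (auto simp: simplicial_fan_def simplicial_cone_def)
  then show thesis using that finiteI_independent by blast
qed

lemma face_in_fan:
  assumes "\<sigma> \<in> \<Sigma>" "independent B" "\<sigma> = convex_cone hull B" "C \<subseteq> B"
  shows "convex_cone hull C \<in> \<Sigma>"
proof -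
  have "convex_cone hull C face_of \<sigma>" unfolding assms(3) by (rule simplicial_face) fact+
  moreover have "\<forall>\<sigma>\<in>\<Sigma>. \<forall>\<tau>. \<tau> face_of \<sigma> \<and> \<tau> \<noteq> {} \<longrightarrow> \<tau> \<in> \<Sigma>" using fan by (simp add: fan_def)
  ultimately show ?thesis using assms(1) convex_cone_hull_nonempty[of C] by simp
qed

text \<open>Its chart is the torus, which carries the prime divisors not coming from rays.\<close>

lemma zero_cone: "{0} \<in> \<Sigma>"
proof -
  obtain \<sigma> where \<sigma>: "\<sigma> \<in> \<Sigma>" using fan by (auto simp: fan_def)
  obtain B where "independent B" "finite B" "\<sigma> = convex_cone hull B" by (rule simplicial_coneE[OF \<sigma>])
  from face_in_fan[OF \<sigma> this(1,3), of "{}"] show ?thesis by simp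
qed

lemma dim_convex_cone_hull: "dim (convex_cone hull B) = dim (B :: (real ^ 'n::{finite,linorder}) set)"
  by (rule span_eq_dim)
    (intro subset_antisym span_minimal subspace_span convex_cone_hull_subset_span
      order_trans[OF hull_subset span_superset])

lemma face_ray:
  assumes "\<sigma> \<in> \<Sigma>" "independent B" "\<sigma> = convex_cone hull B" "b \<in> B"
  shows "convex_cone hull {b} \<in> rays \<Sigma>"
proof -
  have "independent {b}" by (rule independent_mono[OF assms(2)]) (use assms(4) in simp)
  then have "dim (convex_cone hull {b}) = 1" unfolding dim_convex_cone_hull by (simp add: dim_eq_card_independent)
  moreover have "convex_cone hull {b} \<in> \<Sigma>" by (rule face_in_fan[OF assms(1,2,3)]) (use assms(4) in simp)
  ultimately show ?thesis by (simp add: rays_def)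
qed

text \<open>The generator is a nonzero lattice point of the ray with least sum of absolute
  coordinates. The functional of value 1 on it supplies the uniformizing monomial of the ray
  divisor.\<close>

lemma primitive_generator:
  assumes \<rho>: "\<rho> \<in> rays \<Sigma>"
  shows "\<exists>v. v \<noteq> 0 \<and> {w. real_pt w \<in> \<rho>} = range (\<lambda>k::nat. int k *s v) \<and>
    \<rho> = convex_cone hull {real_pt v} \<and> (\<exists>m. pairing m v = 1)"
proof -
  have \<rho>\<Sigma>: "\<rho> \<in> \<Sigma>" and dim: "dim \<rho> = 1" using \<rho> by (auto simp: rays_def)
  obtain B where B: "independent B" "finite B" "\<rho> = convex_cone hull B" by (rule simplicial_coneE[OF \<rho>\<Sigma>])
  have "card B = 1" using dim B by (simp add: dim_convex_cone_hull dim_eq_card_independent)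
  then obtain b where b: "B = {b}" by (auto simp: card_1_singleton_iff)
  have b0: "b \<noteq> 0" using B b dependent_zero by blast
  have \<rho>b: "\<rho> = {t *\<^sub>R b | t. 0 \<le> t}" using B b convex_cone_hull_singleton by simp
  have "rational_cone \<rho>" using fan \<rho>\<Sigma> by (simp add: fan_def)
  then obtain S where S: "finite S" "\<rho> = convex_cone hull (real_pt ` S)"
    unfolding rational_cone_def by (elim exE conjE)
  have "\<exists>s\<in>S. s \<noteq> 0"
  proof (rule ccontr)
    assume "\<not> ?thesis"
    then have "real_pt ` S \<subseteq> {0}" by auto
    then have "convex_cone hull (real_pt ` S) \<subseteq> {0}" by (rule hull_minimal) simp
    moreover have "b \<in> \<rho>" unfolding \<rho>b by (intro CollectI exI[of _ 1]) simp
    ultimately show False using S b0 by auto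
  qed
  then obtain s where s: "s \<in> S" "s \<noteq> 0" by blast
  define L where "L = {w. real_pt w \<in> \<rho>}"
  define size where "size w = nat (\<Sum>i\<in>UNIV. \<bar>vec_nth w i\<bar>)" for w :: "int ^ 'n::{finite,linorder}"
  have "s \<in> L" using s S by (auto simp: L_def hull_inc)
  then obtain v where v: "v \<in> L" "v \<noteq> 0" and least: "\<And>w. w \<in> L \<Longrightarrow> w \<noteq> 0 \<Longrightarrow> size v \<le> size w"
    using s ex_has_least_nat[of "\<lambda>w. w \<in> L \<and> w \<noteq> 0" s size] by blast
  obtain t0 where t0: "real_pt v = t0 *\<^sub>R b" "0 \<le> t0" using v \<rho>b by (auto simp: L_def)
  then have t0pos: "0 < t0" using v by (cases "t0 = 0") (auto simp: order_less_le)
  have \<rho>v: "\<rho> = {t *\<^sub>R real_pt v | t. 0 \<le> t}"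
  proof -
    have "x \<in> {t *\<^sub>R real_pt v | t. 0 \<le> t}" if x: "x \<in> \<rho>" for x
    proof -
      obtain t where "x = t *\<^sub>R b" "0 \<le> t" using x unfolding \<rho>b by blast
      then have "x = (t / t0) *\<^sub>R real_pt v" "0 \<le> t / t0" using t0 t0pos by simp_all
      then show ?thesis by blast
    qed
    moreover have "x \<in> \<rho>" if x: "x \<in> {t *\<^sub>R real_pt v | t. 0 \<le> t}" for x
    proof -
      obtain t where "x = t *\<^sub>R real_pt v" "0 \<le> t" using x by blast
      then have "x = (t * t0) *\<^sub>R b" "0 \<le> t * t0" using t0 by simp_all
      then show ?thesis unfolding \<rho>b by blast
    qed
    ultimately show ?thesis by blast
  qed
  have multiple: "\<exists>k::nat. w = int k *s v" if w: "w \<in> L" for w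
  proof -
    obtain t where t: "real_pt w = t *\<^sub>R real_pt v" "0 \<le> t" using w \<rho>v by (auto simp: L_def)
    \<comment> \<open>The fractional part of the multiple gives a lattice point of the ray smaller
      than \<open>v\<close>, so it must vanish.\<close>
    define w' where "w' = w - \<lfloor>t\<rfloor> *s v"
    have w': "real_pt w' = frac t *\<^sub>R real_pt v" by (simp add: w'_def t frac_def scaleR_diff_left)
    then have w'L: "w' \<in> L" unfolding L_def \<rho>v using frac_ge_0 by blast
    have "w' = 0"
    proof (rule ccontr)
      assume "w' \<noteq> 0"
      have size: "of_nat (size u) = (\<Sum>i\<in>UNIV. \<bar>vec_nth (real_pt u) i\<bar>)" for u
        by (simp add: size_def real_pt_def sum_nonneg)
      have "real (size w') = frac t * real (size v)"
        unfolding size w' by (simp add: abs_mult sum_distrib_left frac_ge_0)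
      moreover have "size v \<noteq> 0"
      proof
        assume "size v = 0"
        then have "(\<Sum>i\<in>UNIV. \<bar>vec_nth v i\<bar>) = 0" by (simp add: size_def antisym sum_nonneg)
        then have "v = 0" by (subst (asm) sum_nonneg_eq_0_iff) (auto simp: Finite_Cartesian_Product.vec_eq_iff)
        then show False using v by simp
      qed
      ultimately have "real (size w') < real (size v)"
        using frac_lt_1[of t] by (simp add: mult_less_cancel_right1)
      then show False using least[OF w'L \<open>w' \<noteq> 0\<close>] by simp
    qed
    then have "w = int (nat \<lfloor>t\<rfloor>) *s v" using t by (simp add: w'_def)
    then show ?thesis by blast
  qed
  have L: "L = range (\<lambda>k::nat. int k *s v)"
  proof (intro equalityI subsetI)
    fix w assume "w \<in> range (\<lambda>k::nat. int k *s v)"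
    then obtain k :: nat where "w = int k *s v" by blast
    then have "real_pt w = real k *\<^sub>R real_pt v" by simp
    then show "w \<in> L" unfolding L_def \<rho>v using of_nat_0_le_iff by blast
  qed (use multiple in blast)
  have "\<exists>m. pairing m v = 1"
  proof -
    obtain i where i: "vec_nth v i \<noteq> 0" using v by (auto simp: Finite_Cartesian_Product.vec_eq_iff)
    have e: "pairing (Poly_Mapping.single j 1) v = vec_nth v j" for j
      by (simp add: pairing_def lookup_single when_def if_distrib[of "\<lambda>x. x * _"] cong: if_cong)
    define P where "P m \<longleftrightarrow> 0 < pairing m v" for m
    have "P (Poly_Mapping.single i 1) \<or> P (- Poly_Mapping.single i 1)"
      using i by (auto simp: P_def e)
    then obtain m where m: "P m" and min: "\<And>m'. P m' \<Longrightarrow> nat (pairing m v) \<le> nat (pairing m' v)"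
      using ex_has_least_nat[of P _ "\<lambda>m. nat (pairing m v)"] by metis
    \<comment> \<open>The least positive value on \<open>v\<close> divides all values, so
      \<open>v\<close> divided by \<open>d\<close> is a lattice point of the ray. Being a multiple
      of \<open>v\<close>, it forces \<open>d = 1\<close>.\<close>
    define d where "d = pairing m v"
    have d: "0 < d" using m by (simp add: P_def d_def)
    have dvd: "d dvd pairing m' v" for m'
    proof -
      have "pairing (m' - frag_cmul (pairing m' v div d) m) v = pairing m' v mod d"
        by (simp add: d_def minus_div_mult_eq_mod)
      then have "\<not> 0 < pairing m' v mod d"
        using min[of "m' - frag_cmul (pairing m' v div d) m"] pos_mod_bound[OF d, of "pairing m' v"]
        by (auto simp: P_def d_def)
      then show ?thesis using pos_mod_sign[OF d, of "pairing m' v"] by (simp add: dvd_eq_mod_eq_0)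
    qed
    define v' where "v' = (\<chi> j. vec_nth v j div d)"
    have vv': "v = d *s v'"
      using dvd[of "Poly_Mapping.single _ 1"] by (simp add: Finite_Cartesian_Product.vec_eq_iff v'_def e)
    have "real_pt v' = (1 / of_int d) *\<^sub>R real_pt v" using d by (simp add: vv')
    then have "v' \<in> L" unfolding L_def \<rho>v using d by (auto intro!: exI[of _ "1 / of_int d"])
    then obtain k :: nat where "v' = int k *s v" using multiple by blast
    then have "(d * int k) * vec_nth v i = vec_nth v i" using vv' by (metis vector_smult_assoc vector_smult_component)
    then have "d * int k = 1" using i by simp
    then have "d = 1" using d by (simp add: zmult_eq_1_iff)
    then show ?thesis by (auto simp: d_def)
  qed
  then show ?thesis
    using v(2) L \<rho>v by (intro exI[of _ v]) (simp add: L_def convex_cone_hull_singleton)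
qed

text \<open>Two generators of the same monoid are natural multiples of each other, and the
  multipliers have product 1.\<close>

lemma ray_gen_eqI:
  assumes "v \<noteq> 0" "{w. real_pt w \<in> \<rho>} = range (\<lambda>k::nat. int k *s v)"
  shows "ray_gen \<rho> = v"
  unfolding ray_gen_def
proof (rule the_equality)
  fix v' assume v': "{w. real_pt w \<in> \<rho>} = range (\<lambda>k::nat. int k *s v')"
  have "v = int 1 *s v" "v' = int 1 *s v'" by simp_all
  then have "v \<in> range (\<lambda>k::nat. int k *s v')" "v' \<in> range (\<lambda>k::nat. int k *s v)"
    unfolding v'[symmetric] assms(2) by (blast, metis assms(2) rangeI v')
  then obtain k l :: nat where kl: "v = int k *s v'" "v' = int l *s v" by blast
  obtain i where i: "vec_nth v i \<noteq> 0" using assms by (auto simp: Finite_Cartesian_Product.vec_eq_iff)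
  have "vec_nth v i = int k * (int l * vec_nth v i)" using kl by (metis vector_smult_component)
  then have "int k * int l = 1" using i by simp
  then have "int k = 1" by (metis of_nat_1 of_nat_eq_iff of_nat_mult nat_mult_eq_1_iff)
  then show "v' = v" using kl by simp
qed (rule assms(2))

lemma ray_gen:
  assumes "\<rho> \<in> rays \<Sigma>"
  shows "ray_gen \<rho> \<noteq> 0" "\<rho> = convex_cone hull {real_pt (ray_gen \<rho>)}" "\<exists>m. pairing m (ray_gen \<rho>) = 1"
proof -
  obtain v where v: "v \<noteq> 0" "{w. real_pt w \<in> \<rho>} = range (\<lambda>k::nat. int k *s v)"
    "\<rho> = convex_cone hull {real_pt v}" "\<exists>m. pairing m v = 1"
    using primitive_generator[OF assms] by blast
  have "ray_gen \<rho> = v" using v(1,2) by (rule ray_gen_eqI)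
  then show "ray_gen \<rho> \<noteq> 0" "\<rho> = convex_cone hull {real_pt (ray_gen \<rho>)}" "\<exists>m. pairing m (ray_gen \<rho>) = 1"
    using v(1,3,4) by simp_all
qed

lemma inj_on_ray_gen: "inj_on ray_gen (rays \<Sigma>)"
  by (metis inj_onI ray_gen(2))

text \<open>Passage from a real basis of the cone to integral data: each basis vector is rescaled to
  the generator of its ray, and \<open>dual_vector\<close> turns real independence into integral
  dual functionals.\<close>

lemma cone_gens:
  assumes \<sigma>: "\<sigma> \<in> \<Sigma>"
  obtains V where "V \<subseteq> ray_gen ` rays \<Sigma>" "simplicial_gens V" "\<sigma> = convex_cone hull (real_pt ` V)"
proof -
  obtain B where B: "independent B" "finite B" "\<sigma> = convex_cone hull B" by (rule simplicial_coneE[OF \<sigma>])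
  define v where "v b = ray_gen (convex_cone hull {b})" for b :: "real ^ 'n::{finite,linorder}"
  have ray: "convex_cone hull {b} \<in> rays \<Sigma>" if "b \<in> B" for b using face_ray[OF \<sigma> B(1,3) that] .
  have "\<exists>c>0. real_pt (v b) = c *\<^sub>R b" if b: "b \<in> B" for b
  proof -
    have "real_pt (v b) \<in> convex_cone hull {b}"
      using ray_gen(2)[OF ray[OF b]] hull_inc[of "real_pt (v b)" "{real_pt (v b)}" convex_cone] by (simp add: v_def)
    then obtain c where c: "real_pt (v b) = c *\<^sub>R b" "0 \<le> c" unfolding convex_cone_hull_singleton by blast
    moreover have "c \<noteq> 0" using c ray_gen(1)[OF ray[OF b]] by (auto simp: v_def)
    ultimately show ?thesis by (intro exI[of _ c]) simp
  qed
  then obtain c where c: "\<And>b. b \<in> B \<Longrightarrow> 0 < c b" "\<And>b. b \<in> B \<Longrightarrow> real_pt (v b) = c b *\<^sub>R b" by metis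
  show thesis
  proof (rule that[of "v ` B"])
    show "v ` B \<subseteq> ray_gen ` rays \<Sigma>" using ray by (auto simp: v_def)
    show "\<sigma> = convex_cone hull (real_pt ` v ` B)"
      unfolding B(3)
    proof (intro subset_antisym hull_minimal convex_cone_convex_cone_hull)
      show "B \<subseteq> convex_cone hull (real_pt ` v ` B)"
      proof
        fix b assume b: "b \<in> B"
        have "b = (1 / c b) *\<^sub>R real_pt (v b)" using c[OF b] by simp
        moreover have "real_pt (v b) \<in> convex_cone hull (real_pt ` v ` B)" using b by (auto intro: hull_inc)
        ultimately show "b \<in> convex_cone hull (real_pt ` v ` B)"
          using convex_cone_hull_mul[of "real_pt (v b)" _ "1 / c b"] c(1)[OF b] by simp
      qed
      show "real_pt ` v ` B \<subseteq> convex_cone hull B"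
      proof
        fix x assume "x \<in> real_pt ` v ` B"
        then obtain b where b: "b \<in> B" "x = c b *\<^sub>R b" using c by auto
        then show "x \<in> convex_cone hull B" using c(1)[OF b(1)]
            convex_cone_hull_mul[OF hull_inc[OF b(1)], of "c b"] by simp
      qed
    qed
    show "simplicial_gens (v ` B)"
    proof
      show "finite (v ` B)" using B by simp
      show "\<exists>m. pairing m w = 1" if "w \<in> v ` B" for w
        using that ray ray_gen(3) by (auto simp: v_def)
      show "\<exists>m. 0 < pairing m w \<and> (\<forall>w'\<in>v ` B - {w}. pairing m w' = 0)" if w: "w \<in> v ` B" for w
      proof (rule dual_vector)
        obtain b where b: "b \<in> B" "w = v b" using w by blast
        \<comment> \<open>Discarding \<open>w\<close> discards \<open>b\<close>, so the other
          generators are rescaled elements of \<open>B - {b}\<close>.\<close>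
        have "real_pt ` (v ` B - {w}) \<subseteq> span (B - {b})"
        proof
          fix x assume "x \<in> real_pt ` (v ` B - {w})"
          then obtain d where "d \<in> B" "v d \<noteq> w" "x = real_pt (v d)" by blast
          then have "d \<in> B - {b}" "x = c d *\<^sub>R d" using b c by auto
          then show "x \<in> span (B - {b})" by (auto intro: span_scale span_base)
        qed
        then have "span (real_pt ` (v ` B - {w})) \<subseteq> span (B - {b})"
          by (rule span_minimal) (rule subspace_span)
        moreover have "b \<notin> span (B - {b})" using B(1) b by (auto simp: dependent_def)
        then have "real_pt w \<notin> span (B - {b})"
          using c[OF b(1)] b span_scale[of "c b *\<^sub>R b" "B - {b}" "1 / c b"] by auto
        ultimately show "real_pt w \<notin> span (real_pt ` (v ` B - {w}))" by blast
      qed (use B in simp)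
    qed
  qed
qed

text \<open>Completeness puts \<open>w\<close> into some cone and so into the real span of its
  generators. Thus the ray subgroup has full rank and its quotient is torsion.\<close>

lemma rays_multiple: "\<exists>k>0. k *s w \<in> zspan (ray_gen ` rays \<Sigma>)"
proof -
  have "real_pt w \<in> \<Union>\<Sigma>" using complete by (simp add: complete_fan_def)
  then obtain \<sigma> where \<sigma>: "\<sigma> \<in> \<Sigma>" "real_pt w \<in> \<sigma>" by blast
  obtain V where V: "V \<subseteq> ray_gen ` rays \<Sigma>" "simplicial_gens V" "\<sigma> = convex_cone hull (real_pt ` V)"
    using cone_gens[OF \<sigma>(1)] .
  have "real_pt w \<in> span (real_pt ` V)" using \<sigma>(2) convex_cone_hull_subset_span V(3) by blast
  then show ?thesis
    using span_imp_zspan_multiple[OF simplicial_gens.fin[OF V(2)]] zspan_mono[OF V(1)] by blast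
qed

lemma chart_ring_eq:
  fixes V :: "(int ^ 'n::{finite,linorder}) set"
  assumes "\<sigma> = convex_cone hull (real_pt ` V)"
  shows "chart_ring \<sigma> = fract_embed (dual_ring V)"
proof -
  define ev where "ev m x = (\<Sum>i\<in>UNIV. of_int (Poly_Mapping.lookup m i) * vec_nth x i)"
    for m :: "'n \<Rightarrow>\<^sub>0 int" and x :: "real ^ 'n::{finite,linorder}"
  have ev: "ev m (real_pt v) = of_int (pairing m v)" for m v
    by (simp add: ev_def pairing_def real_pt_def)
  have "m \<in> dual_monoid \<sigma> \<longleftrightarrow> (\<forall>v\<in>V. 0 \<le> pairing m v)" for m
  proof
    assume m: "m \<in> dual_monoid \<sigma>"
    show "\<forall>v\<in>V. 0 \<le> pairing m v"
    proof
      fix v assume "v \<in> V"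
      then have "real_pt v \<in> \<sigma>" using assms by (auto intro: hull_inc)
      then have "0 \<le> ev m (real_pt v)" using m by (simp add: dual_monoid_def ev_def)
      then show "0 \<le> pairing m v" by (simp add: ev)
    qed
  next
    assume m: "\<forall>v\<in>V. 0 \<le> pairing m v"
    have "convex_cone {x. 0 \<le> ev m x}"
      unfolding convex_cone_iff
    proof (intro conjI ballI allI impI)
      fix x c assume "x \<in> {x. 0 \<le> ev m x}" "0 \<le> (c::real)"
      moreover have "ev m (c *\<^sub>R x) = c * ev m x" by (simp add: ev_def sum_distrib_left algebra_simps)
      ultimately show "c *\<^sub>R x \<in> {x. 0 \<le> ev m x}" by simp
    qed (simp_all add: ev_def algebra_simps sum.distrib)
    then have "\<sigma> \<subseteq> {x. 0 \<le> ev m x}" unfolding assms using m by (intro hull_minimal) (auto simp: ev)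
    then show "m \<in> dual_monoid \<sigma>" by (auto simp: dual_monoid_def ev_def)
  qed
  then show ?thesis by (auto simp: chart_ring_def dual_ring_def subset_iff)
qed

end

section \<open>Divisors on a simplicial toric variety\<close>

context simplicial_complete_fan
begin

abbreviation X :: "'n ratfun set set" where
  "X \<equiv> toric_variety \<Sigma>"

lemma point_cases:
  assumes "R \<in> X"
  shows "R = UNIV \<or> (\<exists>g. prime_elem g \<and> R \<subseteq> prime_ring g) \<or> (\<exists>\<rho>\<in>rays \<Sigma>. R \<subseteq> ray_ring (ray_gen \<rho>))"
proof -
  obtain \<sigma> P where \<sigma>: "\<sigma> \<in> \<Sigma>" "R = localization (chart_ring \<sigma>) P" "primeideal P (subring_struct (chart_ring \<sigma>))"
    using assms by (auto simp: toric_variety_def affine_points_def)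
  obtain V where V: "V \<subseteq> ray_gen ` rays \<Sigma>" "simplicial_gens V" "\<sigma> = convex_cone hull (real_pt ` V)"
    by (rule cone_gens[OF \<sigma>(1)])
  have "primeideal P (subring_struct (fract_embed (dual_ring V)))"
    using \<sigma>(3) by (simp only: chart_ring_eq[OF V(3)])
  from simplicial_gens.chart_point_cases[OF V(2) this]
  show ?thesis using V(1) unfolding \<sigma>(2) chart_ring_eq[OF V(3)] by blast
qed

lemma point_mult_closed: "R \<in> X \<Longrightarrow> x \<in> R \<Longrightarrow> y \<in> R \<Longrightarrow> x * y \<in> R"
  by (auto simp: toric_variety_def affine_points_def intro: localization_mult_closed)

lemma prime_ring_in_X:
  assumes "prime_elem g"
  shows "prime_ring g \<in> X"
proof -
  have "{0} = convex_cone hull (real_pt ` {} :: (real ^ 'n::{finite,linorder}) set)" by simp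
  from chart_ring_eq[OF this] have "chart_ring {0} = fract_embed (UNIV :: 'n laurent set)"
    by (simp add: dual_ring_def)
  then have "prime_ring g \<in> affine_points (chart_ring {0})"
    unfolding affine_points_def using localization_prime_elem[OF assms] by (auto intro!: exI)
  then show ?thesis using zero_cone by (auto simp: toric_variety_def)
qed

text \<open>The chart of the ray itself already contains this point; for a single generator the
  functional of value 1 is also the dual one.\<close>

lemma ray_ring_in_X:
  assumes "\<rho> \<in> rays \<Sigma>"
  shows "ray_ring (ray_gen \<rho>) \<in> X"
proof -
  let ?V = "{ray_gen \<rho>}"
  have "simplicial_gens ?V"
  proof
    show "\<exists>m. pairing m v = 1" if "v \<in> ?V" for v using that ray_gen(3)[OF assms] by simp
    fix v assume v: "v \<in> ?V"
    obtain m where m: "pairing m (ray_gen \<rho>) = 1" using ray_gen(3)[OF assms] by blast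
    show "\<exists>m. 0 < pairing m v \<and> (\<forall>v'\<in>?V - {v}. pairing m v' = 0)"
      by (rule exI[of _ m]) (use v m in simp)
  qed simp
  then interpret simplicial_gens ?V .
  have "\<rho> = convex_cone hull (real_pt ` ?V)" using ray_gen(2)[OF assms] by simp
  from chart_ring_eq[OF this] have "chart_ring \<rho> = fract_embed (dual_ring ?V)" .
  then have "ray_ring (ray_gen \<rho>) \<in> affine_points (chart_ring \<rho>)"
    unfolding affine_points_def using localization_ray_ideal[of "ray_gen \<rho>"] ray_ideal_prime[of "ray_gen \<rho>"] by auto
  moreover have "\<rho> \<in> \<Sigma>" using assms by (simp add: rays_def)
  ultimately show ?thesis by (auto simp: toric_variety_def)
qed

lemma field_valuation_divisor:
  assumes "(\<exists>g. prime_elem g \<and> P = prime_ring g) \<or> (\<exists>\<rho>\<in>rays \<Sigma>. P = ray_ring (ray_gen \<rho>))"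
  obtains w t where "field_valuation w t" "P = valuation_ring w"
  using assms field_valuation_prime_exp field_valuation_low ray_gen(3)
  unfolding prime_ring_def ray_ring_def by metis

text \<open>A listed ring is maximal, so only the generic point lies above it. Conversely
  \<open>point_cases\<close> puts a point of codimension one inside a listed ring, which is itself a
  proper point and hence equal to it.\<close>

lemma prime_divisors_eq:
  "prime_divisors X = {prime_ring g | g. prime_elem g} \<union> (\<lambda>\<rho>. ray_ring (ray_gen \<rho>)) ` rays \<Sigma>" (is "_ = ?D")
proof (intro equalityI subsetI)
  fix P assume P: "P \<in> ?D"
  then have PX: "P \<in> X" using prime_ring_in_X ray_ring_in_X by blast
  have "(\<exists>g. prime_elem g \<and> P = prime_ring g) \<or> (\<exists>\<rho>\<in>rays \<Sigma>. P = ray_ring (ray_gen \<rho>))" using P by blast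
  then obtain w t where w: "field_valuation w t" "P = valuation_ring w" by (rule field_valuation_divisor)
  have "R = UNIV" if "R \<in> X" "P \<subset> R" for R
    using field_valuation.valuation_ring_maximal[OF w(1), of R] point_mult_closed[OF that(1)] that(2) w(2) by blast
  then show "P \<in> prime_divisors X"
    using PX field_valuation.valuation_ring_neq_UNIV[OF w(1)] w(2) by (simp add: prime_divisors_def)
next
  fix P assume "P \<in> prime_divisors X"
  then have P: "P \<in> X" "P \<noteq> UNIV" "\<And>R. R \<in> X \<Longrightarrow> P \<subset> R \<Longrightarrow> R = UNIV"
    by (auto simp: prime_divisors_def)
  then obtain R where R: "P \<subseteq> R" "(\<exists>g. prime_elem g \<and> R = prime_ring g) \<or> (\<exists>\<rho>\<in>rays \<Sigma>. R = ray_ring (ray_gen \<rho>))"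
    using point_cases[OF P(1)] by blast
  have "R \<in> X" using R(2) prime_ring_in_X ray_ring_in_X by blast
  moreover have "R \<noteq> UNIV"
    using field_valuation_divisor[OF R(2)] field_valuation.valuation_ring_neq_UNIV by metis
  ultimately have "P = R" using P(3)[of R] R(1) by blast
  then show "P \<in> ?D" using R(2) by blast
qed

lemma val_divisor:
  assumes "P \<in> prime_divisors X"
  shows "f \<noteq> 0 \<Longrightarrow> g \<noteq> 0 \<Longrightarrow> val P (f * g) = val P f + val P g"
    "f \<noteq> 0 \<Longrightarrow> val P (f powi k) = k * val P f"
proof -
  have "(\<exists>g. prime_elem g \<and> P = prime_ring g) \<or> (\<exists>\<rho>\<in>rays \<Sigma>. P = ray_ring (ray_gen \<rho>))"
    using assms unfolding prime_divisors_eq by blast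
  then obtain w t where w: "field_valuation w t" "P = valuation_ring w" by (rule field_valuation_divisor)
  interpret field_valuation w t by (rule w(1))
  show "f \<noteq> 0 \<Longrightarrow> g \<noteq> 0 \<Longrightarrow> val P (f * g) = val P f + val P g"
    by (simp add: w(2) val_valuation_ring w_mult)
  show "f \<noteq> 0 \<Longrightarrow> val P (f powi k) = k * val P f"
    by (simp add: w(2) val_valuation_ring w_powi)
qed

section \<open>Principal divisors\<close>

lemma principal_iff:
  "D \<in> principal_divisors X \<longleftrightarrow> Poly_Mapping.keys D \<subseteq> prime_divisors X \<and>
    (\<exists>f. f \<noteq> 0 \<and> (\<forall>P\<in>prime_divisors X. Poly_Mapping.lookup D P = val P f))"
  by (simp add: principal_divisors_def weil_divisors_def)

lemma principal_add:
  assumes "D \<in> principal_divisors X" "E \<in> principal_divisors X"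
  shows "D + E \<in> principal_divisors X"
proof -
  obtain f g where "f \<noteq> 0" "\<forall>P\<in>prime_divisors X. Poly_Mapping.lookup D P = val P f"
    "g \<noteq> 0" "\<forall>P\<in>prime_divisors X. Poly_Mapping.lookup E P = val P g"
    using assms by (auto simp: principal_iff)
  then have "f * g \<noteq> 0" "\<forall>P\<in>prime_divisors X. Poly_Mapping.lookup (D + E) P = val P (f * g)"
    by (simp_all add: lookup_add val_divisor)
  then show ?thesis using assms keys_add[of D E] unfolding principal_iff by blast
qed

lemma principal_cmul:
  assumes "D \<in> principal_divisors X"
  shows "frag_cmul c D \<in> principal_divisors X"
proof -
  obtain f where "f \<noteq> 0" "\<forall>P\<in>prime_divisors X. Poly_Mapping.lookup D P = val P f"
    using assms by (auto simp: principal_iff)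
  then have "f powi c \<noteq> 0" "\<forall>P\<in>prime_divisors X. Poly_Mapping.lookup (frag_cmul c D) P = val P (f powi c)"
    by (simp_all add: val_divisor)
  then show ?thesis using assms keys_cmul[of c D] unfolding principal_iff by blast
qed

lemma principal_0: "0 \<in> principal_divisors X"
  unfolding principal_iff using val_divisor(2)[of _ 1 0] by (auto intro!: exI[of _ 1])

lemma principal_subgroup: "subgroup (principal_divisors X) (weil_divisors X)"
proof -
  interpret comm_group "weil_divisors X"
    unfolding weil_divisors_def by (rule abelian_free_Abelian_group)
  show ?thesis
  proof (rule subgroupI)
    show "principal_divisors X \<subseteq> carrier (weil_divisors X)" by (auto simp: principal_divisors_def)
    show "principal_divisors X \<noteq> {}" using principal_0 by blast
    fix D assume D: "D \<in> principal_divisors X"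
    then have "inv\<^bsub>weil_divisors X\<^esub> D = - D" by (simp add: weil_divisors_def principal_iff)
    then show "inv\<^bsub>weil_divisors X\<^esub> D \<in> principal_divisors X" using principal_cmul[OF D, of "-1"] by simp
    fix E assume "E \<in> principal_divisors X"
    then show "D \<otimes>\<^bsub>weil_divisors X\<^esub> E \<in> principal_divisors X"
      using principal_add[OF D] by (simp add: weil_divisors_def)
  qed
qed

section \<open>Telling prime divisors apart by the values of monomials\<close>

lemma prime_exp_chi: "prime_elem g \<Longrightarrow> prime_exp g (chi m) = 0"
  using prime_exp_eq_0_iff[of g "chi m"] dvd_trans[OF _ chi_dvd_1] prime_elem_not_unit by auto

lemma val_ray_chi: "\<rho> \<in> rays \<Sigma> \<Longrightarrow> val (ray_ring (ray_gen \<rho>)) (Fract (chi m) 1) = pairing m (ray_gen \<rho>)"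
  using ray_gen(3)[of \<rho>] by (auto simp: val_ray_ring)

lemma val_prime_chi: "prime_elem g \<Longrightarrow> val (prime_ring g) (Fract (chi m) 1) = 0"
  using prime_exp_chi[of g 0] by (simp add: val_prime_ring prime_exp_chi)

text \<open>A monomial of value 1 along the ray has value 0 along every divisor of the
  torus.\<close>

lemma ray_ring_neq_prime_ring:
  assumes "\<rho> \<in> rays \<Sigma>" "prime_elem g"
  shows "ray_ring (ray_gen \<rho>) \<noteq> prime_ring g"
  using ray_gen(3)[OF assms(1)] val_ray_chi[OF assms(1)] val_prime_chi[OF assms(2)] by (metis zero_neq_one)

text \<open>The values of the monomials recover the coordinates of the ray generator, hence the
  ray.\<close>

lemma ray_ring_inj:
  assumes "\<rho> \<in> rays \<Sigma>" "\<rho>' \<in> rays \<Sigma>" "ray_ring (ray_gen \<rho>) = ray_ring (ray_gen \<rho>')"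
  shows "\<rho> = \<rho>'"
proof -
  have "pairing m (ray_gen \<rho>) = pairing m (ray_gen \<rho>')" for m
    using val_ray_chi[OF assms(1)] val_ray_chi[OF assms(2)] assms(3) by metis
  from this[of "Poly_Mapping.single _ 1"] have "ray_gen \<rho> = ray_gen \<rho>'"
    by (simp add: Finite_Cartesian_Product.vec_eq_iff pairing_def lookup_single when_def if_distrib[of "\<lambda>x. x * _"] cong: if_cong)
  then show ?thesis using inj_on_ray_gen assms by (auto dest: inj_onD)
qed

lemma prime_ring_eqI:
  assumes "prime_elem g" "prime_elem h" "h dvd g"
  shows "prime_ring h = prime_ring g"
proof -
  obtain c where c: "g = h * c" using assms(3) by blast
  have "g dvd h * c" by (simp add: c)
  then have "g dvd h \<or> g dvd c" by (rule prime_elem_dvd_multD[OF assms(1)])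
  moreover have "g \<noteq> 0" using assms(1) by auto
  ultimately have "c dvd 1"
    using cofactor_unit[of h c] prime_elem_not_unit[OF assms(2)] by (simp add: c)
  then have "g dvd h * 1" unfolding c by (intro mult_dvd_mono) auto
  then have "g dvd h" by simp
  then have "{p. h dvd p} = {p. g dvd p}" using assms(3) dvd_trans by blast
  then show ?thesis using localization_prime_elem(2) assms(1,2) by metis
qed

text \<open>This is the divisor of \<open>g\<close>. In the torus it is the single prime of
  \<open>g\<close>; beyond that only the finitely many rays can occur, so its support is
  finite.\<close>

lemma prime_principal_divisor:
  assumes g: "prime_elem g"
  obtains E where "E \<in> principal_divisors X" "Poly_Mapping.lookup E (prime_ring g) = 1"
    "\<And>h. prime_elem h \<Longrightarrow> prime_ring h \<noteq> prime_ring g \<Longrightarrow> Poly_Mapping.lookup E (prime_ring h) = 0"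
proof -
  define d where "d P = (if P \<in> prime_divisors X then val P (Fract g 1) else 0)" for P
  have gnz: "g \<noteq> 0" using g by auto
  have exp1: "prime_exp h 1 = 0" if "prime_elem h" for h using prime_exp_chi[OF that, of 0] by simp
  have zero: "val (prime_ring h) (Fract g 1) = 0" if "prime_elem h" "prime_ring h \<noteq> prime_ring g" for h
    using prime_ring_eqI[OF g that(1)] that gnz prime_exp_eq_0_iff[OF that(1) gnz]
    by (auto simp: val_prime_ring exp1)
  have "{P. d P \<noteq> 0} \<subseteq> insert (prime_ring g) ((\<lambda>\<rho>. ray_ring (ray_gen \<rho>)) ` rays \<Sigma>)"
    using zero by (auto simp: d_def prime_divisors_eq split: if_splits)
  then have fin: "finite {P. d P \<noteq> 0}" by (rule finite_subset) (simp add: finite_rays)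
  define E where "E = Abs_poly_mapping d"
  have E: "Poly_Mapping.lookup E = d" unfolding E_def by (rule lookup_Abs_poly_mapping[OF fin])
  show thesis
  proof (rule that[of E])
    have "Poly_Mapping.keys E \<subseteq> prime_divisors X" by (auto simp: in_keys_iff E d_def split: if_splits)
    moreover have "Fract g 1 \<noteq> 0" using gnz by (simp add: Fract_eq_0_iff)
    ultimately show "E \<in> principal_divisors X"
      unfolding principal_iff by (auto simp: E d_def intro!: exI[of _ "Fract g 1"])
    show "Poly_Mapping.lookup E (prime_ring g) = 1"
      using g gnz by (auto simp: E d_def prime_divisors_eq val_prime_ring prime_exp_self exp1)
    show "Poly_Mapping.lookup E (prime_ring h) = 0" if "prime_elem h" "prime_ring h \<noteq> prime_ring g" for h
      using zero[OF that] by (simp add: E d_def)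
  qed
qed

text \<open>Subtracting a multiple of the divisor of one \<open>g\<close> removes that prime and
  otherwise changes only coefficients along rays, so the number of torus primes in the support
  decreases.\<close>

lemma toric_representative:
  assumes "Poly_Mapping.keys D \<subseteq> prime_divisors X"
  shows "\<exists>E\<in>principal_divisors X. \<forall>g. prime_elem g \<longrightarrow> Poly_Mapping.lookup (D - E) (prime_ring g) = 0"
  using assms
proof (induction "card (Poly_Mapping.keys D \<inter> {prime_ring g | g. prime_elem g})" arbitrary: D rule: less_induct)
  case less
  let ?N = "{prime_ring g | g. prime_elem g}"
  show ?case
  proof (cases "Poly_Mapping.keys D \<inter> ?N = {}")
    case True
    then show ?thesis using principal_0 by (intro bexI[of _ 0]) (auto simp: in_keys_iff)
  next
    case False
    then obtain g where g: "prime_elem g" "prime_ring g \<in> Poly_Mapping.keys D" by blast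
    obtain E where E: "E \<in> principal_divisors X" "Poly_Mapping.lookup E (prime_ring g) = 1"
      "\<And>h. prime_elem h \<Longrightarrow> prime_ring h \<noteq> prime_ring g \<Longrightarrow> Poly_Mapping.lookup E (prime_ring h) = 0"
      using prime_principal_divisor[OF g(1)] by blast
    define c where "c = Poly_Mapping.lookup D (prime_ring g)"
    define D' where "D' = D - frag_cmul c E"
    have kE: "Poly_Mapping.keys E \<subseteq> prime_divisors X" using E(1) by (simp add: principal_iff)
    have "Poly_Mapping.keys D' \<subseteq> prime_divisors X"
      using keys_diff[of D "frag_cmul c E"] keys_cmul[of c E] kE less.prems unfolding D'_def by blast
    moreover have "Poly_Mapping.keys D' \<inter> ?N \<subset> Poly_Mapping.keys D \<inter> ?N"
    proof -
      have "prime_ring g \<notin> Poly_Mapping.keys D'" by (simp add: in_keys_iff D'_def lookup_minus c_def E(2))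
      moreover have "Poly_Mapping.keys D' \<inter> ?N \<subseteq> Poly_Mapping.keys D"
      proof
        fix P assume "P \<in> Poly_Mapping.keys D' \<inter> ?N"
        then obtain h where h: "prime_elem h" "P = prime_ring h" "P \<in> Poly_Mapping.keys D'" by blast
        show "P \<in> Poly_Mapping.keys D"
        proof (cases "P = prime_ring g")
          case False
          then have "Poly_Mapping.lookup E P = 0" using E(3) h by simp
          then show ?thesis using h(3) by (simp add: in_keys_iff D'_def lookup_minus)
        qed (use g in simp)
      qed
      moreover have "prime_ring g \<in> Poly_Mapping.keys D \<inter> ?N" using g by blast
      ultimately show ?thesis by blast
    qed
    then have "card (Poly_Mapping.keys D' \<inter> ?N) < card (Poly_Mapping.keys D \<inter> ?N)"
      by (intro psubset_card_mono) simp_all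
    ultimately obtain E' where E': "E' \<in> principal_divisors X"
      "\<forall>g. prime_elem g \<longrightarrow> Poly_Mapping.lookup (D' - E') (prime_ring g) = 0"
      using less.hyps by blast
    have eq: "D - (frag_cmul c E + E') = D' - E'" by (simp add: D'_def)
    have "\<forall>g. prime_elem g \<longrightarrow> Poly_Mapping.lookup (D - (frag_cmul c E + E')) (prime_ring g) = 0"
      unfolding eq by (rule E'(2))
    then show ?thesis
      by (rule bexI) (rule principal_add[OF principal_cmul[OF E(1)] E'(1)])
  qed
qed

text \<open>A function without zeros and poles on the torus is a unit of the Laurent ring, hence a
  monomial up to a constant, and constants have order zero.\<close>

lemma toric_principal_iff:
  assumes D: "Poly_Mapping.keys D \<subseteq> prime_divisors X"
    and toric: "\<And>g. prime_elem g \<Longrightarrow> Poly_Mapping.lookup D (prime_ring g) = 0"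
  shows "D \<in> principal_divisors X \<longleftrightarrow>
    (\<exists>m. \<forall>\<rho>\<in>rays \<Sigma>. Poly_Mapping.lookup D (ray_ring (ray_gen \<rho>)) = pairing m (ray_gen \<rho>))"
proof
  assume "D \<in> principal_divisors X"
  then obtain f where f: "f \<noteq> 0" "\<forall>P\<in>prime_divisors X. Poly_Mapping.lookup D P = val P f"
    by (auto simp: principal_iff)
  obtain a b where ab: "f = Fract a b" "b \<noteq> 0" by (metis Fract_cases)
  have a: "a \<noteq> 0" using f ab by (auto simp: Fract_eq_0_iff)
  have "prime_exp g a = prime_exp g b" if g: "prime_elem g" for g
  proof -
    have "prime_ring g \<in> prime_divisors X" using g by (auto simp: prime_divisors_eq)
    then have "val (prime_ring g) (Fract a b) = 0" using f toric[OF g] ab by auto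
    then show ?thesis using g a ab by (simp add: val_prime_ring)
  qed
  then obtain u where u: "u dvd 1" "a = u * b" using prime_exps_eq_imp_unit[OF a ab(2)] by blast
  obtain m c where c: "c \<noteq> 0" "u = Poly_Mapping.single m c" using laurent_unit[OF u(1)] .
  have "Poly_Mapping.lookup D (ray_ring (ray_gen \<rho>)) = pairing m (ray_gen \<rho>)" if \<rho>: "\<rho> \<in> rays \<Sigma>" for \<rho>
  proof -
    have "ray_ring (ray_gen \<rho>) \<in> prime_divisors X" using \<rho> by (auto simp: prime_divisors_eq)
    moreover obtain m1 where "pairing m1 (ray_gen \<rho>) = 1" using ray_gen(3)[OF \<rho>] by blast
    moreover have "low (ray_gen \<rho>) u = pairing m (ray_gen \<rho>)" using c by (simp add: low_const)
    moreover have "u \<noteq> 0" using c by (metis lookup_single_eq lookup_zero)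
    ultimately show ?thesis
      using f(2) ab u(2) a by (simp add: val_ray_ring low_mult)
  qed
  then show "\<exists>m. \<forall>\<rho>\<in>rays \<Sigma>. Poly_Mapping.lookup D (ray_ring (ray_gen \<rho>)) = pairing m (ray_gen \<rho>)" by blast
next
  assume "\<exists>m. \<forall>\<rho>\<in>rays \<Sigma>. Poly_Mapping.lookup D (ray_ring (ray_gen \<rho>)) = pairing m (ray_gen \<rho>)"
  then obtain m where m: "\<forall>\<rho>\<in>rays \<Sigma>. Poly_Mapping.lookup D (ray_ring (ray_gen \<rho>)) = pairing m (ray_gen \<rho>)" ..
  have "Fract (chi m) 1 \<noteq> 0" by (simp add: Fract_eq_0_iff)
  moreover have "\<forall>P\<in>prime_divisors X. Poly_Mapping.lookup D P = val P (Fract (chi m) 1)"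
    using m toric by (auto simp: prime_divisors_eq val_prime_chi val_ray_chi)
  ultimately show "D \<in> principal_divisors X" using D unfolding principal_iff by blast
qed

end

section \<open>Bases adapted to a sublattice\<close>

lemma zspan_sum: "(\<And>i. i \<in> I \<Longrightarrow> f i \<in> zspan B) \<Longrightarrow> (\<Sum>i\<in>I. f i) \<in> zspan B"
  by (induction I rule: infinite_finite_induct) (auto simp: zspan_0 zspan_add)

lemma dot_sum_left: "dot (\<Sum>i\<in>I. f i) w = (\<Sum>i\<in>I. dot (f i) w)"
  by (induction I rule: infinite_finite_induct) (auto simp: dot_simps)

lemma dot_sum_right: "dot w (\<Sum>i\<in>I. f i) = (\<Sum>i\<in>I. dot w (f i))"
  by (induction I rule: infinite_finite_induct) (auto simp: dot_simps)

lemma dot_axis: "dot (axis i 1) w = vec_nth w i"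
proof -
  have "dot (axis i 1) w = (\<Sum>j\<in>UNIV. if j = i then vec_nth w i else 0)"
    unfolding dot_def by (rule sum.cong) (auto simp: axis_def)
  then show ?thesis by simp
qed

text \<open>A stage in the construction of a basis \<open>e\<close> of the lattice whose multiples \<open>d i *s e i\<close> form a
  basis of the sublattice \<open>L\<close>.\<close>
definition adapted ::
    "(int ^ 'n::finite) set \<Rightarrow> nat \<Rightarrow> (nat \<Rightarrow> int ^ 'n) \<Rightarrow> (nat \<Rightarrow> int ^ 'n) \<Rightarrow> (nat \<Rightarrow> int) \<Rightarrow> bool" where
  "adapted L k e \<phi> d \<longleftrightarrow> (\<forall>i<k. 0 < d i \<and> d i *s e i \<in> L \<and> (\<forall>l\<in>L. d i dvd dot (\<phi> i) l) \<and>
     (\<forall>j<k. dot (\<phi> i) (e j) = (if i = j then 1 else 0)))"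

text \<open>The dual functionals force the vectors \<open>e i\<close> to be linearly independent
  over the reals.\<close>

lemma adapted_bound:
  fixes L :: "(int ^ 'n::finite) set"
  assumes "adapted L k e \<phi> d"
  shows "k \<le> CARD('n)"
proof -
  let ?f = "\<lambda>i. real_pt (e i)"
  have dual: "inner (real_pt (\<phi> j)) (?f i) = (if j = i then 1 else 0)" if "i < k" "j < k" for i j
    using assms that by (simp add: real_pt_inner adapted_def)
  have inj: "inj_on ?f {..<k}"
  proof (rule inj_onI)
    fix i j assume "i \<in> {..<k}" "j \<in> {..<k}" "?f i = ?f j"
    then show "i = j" using dual[of i i] dual[of j i] by (auto split: if_splits)
  qed
  have "independent (?f ` {..<k})"
  proof
    assume "dependent (?f ` {..<k})"
    then obtain u v where u: "v \<in> ?f ` {..<k}" "u v \<noteq> 0" "(\<Sum>w\<in>?f ` {..<k}. u w *\<^sub>R w) = 0"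
      by (auto simp: dependent_finite)
    then obtain j where j: "j < k" "v = ?f j" by blast
    have "(\<Sum>i<k. u (?f i) *\<^sub>R ?f i) = 0" using u(3) by (simp add: sum.reindex[OF inj])
    then have "0 = inner (real_pt (\<phi> j)) (\<Sum>i<k. u (?f i) *\<^sub>R ?f i)" by simp
    also have "\<dots> = (\<Sum>i<k. if i = j then u (?f j) else 0)"
      unfolding inner_sum_right by (rule sum.cong) (use dual j in auto)
    also have "\<dots> = u v" using j by simp
    finally show False using u(2) by simp
  qed
  then have "card (?f ` {..<k}) \<le> DIM(real ^ 'n)"
    using independent_card_le by blast
  then show ?thesis by (simp add: card_image[OF inj])
qed

text \<open>One step of the Smith normal form without matrices. The new \<open>c\<close> is the
  least positive value of a functional vanishing on the earlier basis vectors at a sublattice point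
  killed by the earlier functionals; division with remainder in either argument then gives
  divisibility by \<open>c\<close>.\<close>

lemma adapted_extend:
  fixes G :: "(int ^ 'n::finite) set"
  assumes ad: "adapted (zspan G) k e \<phi> d"
    and l0: "l0 \<in> zspan G" "l0 \<noteq> 0" "\<And>i. i < k \<Longrightarrow> dot (\<phi> i) l0 = 0"
  shows "\<exists>e \<phi> d. adapted (zspan G) (Suc k) e \<phi> d"
proof -
  let ?L = "zspan G"
  have ad': "0 < d i" "d i *s e i \<in> ?L" "\<And>l. l \<in> ?L \<Longrightarrow> d i dvd dot (\<phi> i) l"
    "\<And>j. j < k \<Longrightarrow> dot (\<phi> i) (e j) = (if i = j then 1 else 0)" if "i < k" for i
    using ad that by (auto simp: adapted_def)
  define K where "K = {l \<in> ?L. \<forall>i<k. dot (\<phi> i) l = 0}"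
  \<comment> \<open>Corrects a functional so that it annihilates the earlier \<open>e j\<close>; on
    \<open>K\<close> its values do not change.\<close>
  define red where "red \<psi> = \<psi> - (\<Sum>j<k. dot \<psi> (e j) *s \<phi> j)" for \<psi> :: "int ^ 'n"
  have red_e: "dot (red \<psi>) (e i) = 0" if "i < k" for \<psi> i
  proof -
    have "(\<Sum>j<k. dot \<psi> (e j) * dot (\<phi> j) (e i)) = (\<Sum>j<k. if j = i then dot \<psi> (e i) else 0)"
      using ad'(4) that by (intro sum.cong) auto
    then show ?thesis using that by (simp add: red_def dot_simps dot_sum_left)
  qed
  have red_K: "dot (red \<psi>) l = dot \<psi> l" if "l \<in> K" for \<psi> l
    using that by (simp add: red_def dot_simps dot_sum_left K_def)
  define P where "P = (\<lambda>(\<psi>, l). l \<in> K \<and> (\<forall>j<k. dot \<psi> (e j) = 0) \<and> 0 < dot \<psi> l)"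
  have l0K: "l0 \<in> K" using l0 by (simp add: K_def)
  \<comment> \<open>Read as a functional, \<open>l0\<close> is positive on itself; its correction
    gives a pair from which to minimize.\<close>
  have "0 < dot l0 l0" using l0(2) dot_self_nonneg[of l0] dot_self_eq_0[of l0] by linarith
  then have "P (red l0, l0)" using l0K red_e red_K by (simp add: P_def)
  then obtain \<psi>l where "P \<psi>l" and least: "\<And>y. P y \<Longrightarrow> nat (dot (fst \<psi>l) (snd \<psi>l)) \<le> nat (dot (fst y) (snd y))"
    using ex_has_least_nat[of P "(red l0, l0)" "\<lambda>y. nat (dot (fst y) (snd y))"] by blast
  then obtain \<psi> l where \<psi>l: "\<psi>l = (\<psi>, l)" "l \<in> K" "\<And>j. j < k \<Longrightarrow> dot \<psi> (e j) = 0" "0 < dot \<psi> l"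
    by (cases \<psi>l) (auto simp: P_def)
  define c where "c = dot \<psi> l"
  have c: "0 < c" using \<psi>l by (simp add: c_def)
  have least': "c \<le> dot \<eta> m" if "m \<in> K" "\<forall>j<k. dot \<eta> (e j) = 0" "0 < dot \<eta> m" for \<eta> m
    using least[of "(\<eta>, m)"] that c by (simp add: P_def \<psi>l(1) c_def)
  have dvd1: "c dvd dot \<eta> l" for \<eta>
  proof -
    define \<eta>' where "\<eta>' = red \<eta> - (dot \<eta> l div c) *s \<psi>"
    have val: "dot \<eta>' l = dot \<eta> l mod c"
      using red_K[OF \<psi>l(2)] by (simp add: \<eta>'_def dot_simps minus_div_mult_eq_mod flip: c_def)
    have "\<forall>j<k. dot \<eta>' (e j) = 0" using red_e \<psi>l(3) by (simp add: \<eta>'_def dot_simps)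
    then have "\<not> 0 < dot \<eta> l mod c"
      using least'[OF \<psi>l(2), of \<eta>'] pos_mod_bound[OF c, of "dot \<eta> l"] unfolding val by auto
    then show ?thesis using pos_mod_sign[OF c, of "dot \<eta> l"] by (simp add: dvd_eq_mod_eq_0)
  qed
  have dvd2: "c dvd dot \<psi> m" if m: "m \<in> K" for m
  proof -
    define m' where "m' = m - (dot \<psi> m div c) *s l"
    have val: "dot \<psi> m' = dot \<psi> m mod c"
      by (simp add: m'_def dot_simps minus_div_mult_eq_mod flip: c_def)
    have "m' \<in> K" using m \<psi>l(2) by (auto simp: m'_def K_def dot_simps intro: zspan_diff zspan_scale)
    then have "\<not> 0 < dot \<psi> m mod c"
      using least'[of m' \<psi>] \<psi>l(3) pos_mod_bound[OF c, of "dot \<psi> m"] unfolding val by auto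
    then show ?thesis using pos_mod_sign[OF c, of "dot \<psi> m"] by (simp add: dvd_eq_mod_eq_0)
  qed
  \<comment> \<open>Every functional takes a multiple of \<open>c\<close> on \<open>l\<close>, in
    particular every coordinate, so \<open>l\<close> is \<open>c\<close> times a lattice vector, the
    new basis vector.\<close>
  define f where "f = (\<chi> i. vec_nth l i div c)"
  have lf: "c *s f = l"
    using dvd1[of "axis _ 1"] by (simp add: f_def Finite_Cartesian_Product.vec_eq_iff dot_axis)
  have \<psi>f: "dot \<psi> f = 1"
  proof -
    have "c * dot \<psi> f = c" using lf by (metis c_def dot_simps(6))
    then show ?thesis using c by simp
  qed
  have \<phi>f: "dot (\<phi> i) f = 0" if "i < k" for i
  proof -
    have "c * dot (\<phi> i) f = dot (\<phi> i) l" by (simp flip: lf add: dot_simps)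
    then show ?thesis using c \<psi>l(2) that by (simp add: K_def)
  qed
  \<comment> \<open>Divisibility extends from \<open>K\<close> to the whole sublattice by
    subtracting the components along the earlier basis vectors, on which \<open>\<psi>\<close>
    vanishes.\<close>
  have dvdL: "c dvd dot \<psi> m" if m: "m \<in> ?L" for m
  proof -
    define s where "s = (\<Sum>j<k. (dot (\<phi> j) m div d j) *s (d j *s e j))"
    have sL: "s \<in> ?L" unfolding s_def by (intro zspan_sum zspan_scale ad'(2)) simp
    have "dot (\<phi> i) s = dot (\<phi> i) m" if i: "i < k" for i
    proof -
      have "dot (\<phi> i) s = (\<Sum>j<k. if j = i then dot (\<phi> i) m div d i * d i else 0)"
        unfolding s_def dot_sum_right dot_simps(6) using ad'(4)[OF i] by (intro sum.cong) auto
      then show ?thesis using i ad'(3)[OF i m] by simp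
    qed
    then have "m - s \<in> K" using m sL by (auto simp: K_def dot_simps intro: zspan_diff)
    then have "c dvd dot \<psi> (m - s)" by (rule dvd2)
    moreover have "dot \<psi> s = 0" using \<psi>l(3) by (simp add: s_def dot_sum_right dot_simps(6))
    ultimately show ?thesis by (simp add: dot_simps)
  qed
  have "l \<in> ?L" using \<psi>l(2) by (simp add: K_def)
  then have "adapted ?L (Suc k) (e(k := f)) (\<phi>(k := \<psi>)) (d(k := c))"
    unfolding adapted_def
    using ad' c lf \<psi>f \<phi>f dvdL \<psi>l(3) by (auto simp: less_Suc_eq)
  then show ?thesis by blast
qed

text \<open>The bound on \<open>k\<close> stops the extension, and it stops only when the
  functionals detect every nonzero vector of the sublattice. By full rank they then detect every
  nonzero lattice vector, which gives the expansion.\<close>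

lemma adapted_basis_exists:
  fixes G :: "(int ^ 'n::finite) set"
  assumes full: "\<And>w. \<exists>k>0. k *s w \<in> zspan G"
  shows "\<exists>k e \<phi> d. adapted (zspan G) k e \<phi> d \<and> (\<forall>w. w = (\<Sum>i<k. dot (\<phi> i) w *s e i))"
proof -
  have "\<exists>k e \<phi> d. adapted (zspan G) k e \<phi> d \<and> (\<forall>l\<in>zspan G. (\<forall>i<k. dot (\<phi> i) l = 0) \<longrightarrow> l = 0)"
  proof (rule ccontr)
    assume contra: "\<not> ?thesis"
    have "\<exists>e \<phi> d. adapted (zspan G) k e \<phi> d" for k
    proof (induction k)
      case 0 show ?case by (simp add: adapted_def)
    next
      case (Suc k) then show ?case using contra adapted_extend[of G k] by blast
    qed
    from this[of "Suc CARD('n)"] show False using adapted_bound by (metis not_less_eq_eq order_refl)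
  qed
  then obtain k e \<phi> d where ad: "adapted (zspan G) k e \<phi> d"
    and zero: "\<And>l. l \<in> zspan G \<Longrightarrow> \<forall>i<k. dot (\<phi> i) l = 0 \<Longrightarrow> l = 0" by blast
  have "w = (\<Sum>i<k. dot (\<phi> i) w *s e i)" for w
  proof -
    define z where "z = w - (\<Sum>i<k. dot (\<phi> i) w *s e i)"
    obtain m where m: "0 < m" "m *s z \<in> zspan G" using full by blast
    have "dot (\<phi> i) z = 0" if i: "i < k" for i
    proof -
      have "dot (\<phi> i) (\<Sum>j<k. dot (\<phi> j) w *s e j) = (\<Sum>j<k. if j = i then dot (\<phi> i) w else 0)"
        unfolding dot_sum_right dot_simps(6) using ad i by (intro sum.cong) (auto simp: adapted_def)
      then show ?thesis using i by (simp add: z_def dot_simps)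
    qed
    then have "m *s z = 0" by (intro zero m) (simp add: dot_simps)
    then have "z = 0" using m by (simp add: Finite_Cartesian_Product.vec_eq_iff)
    then show ?thesis by (simp add: z_def)
  qed
  then show ?thesis using ad by blast
qed

text \<open>The functionals \<open>b w\<close> are the linear forms that are integral on the sublattice, and \<open>w\<close> lies in
  the sublattice iff \<open>b w\<close> is integral on the whole lattice: this is the (non-canonical)
  self-duality of the finite quotient.\<close>
lemma sublattice_self_dual:
  fixes G :: "(int ^ 'n::finite) set"
  assumes full: "\<And>w. \<exists>k>0. k *s w \<in> zspan G"
  shows "\<exists>b N. (\<forall>w w' g. b (w + w') g = b w g + b w' g) \<and>
    (\<forall>w. (\<exists>x. \<forall>g\<in>G. b w g = dot x g) \<longleftrightarrow> w \<in> zspan G) \<and>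
    (\<forall>m x c. 0 < m \<longrightarrow> (\<forall>g\<in>G. m * c g = dot x g) \<longrightarrow> (\<exists>w. \<forall>g\<in>G. b w g = c g)) \<and>
    0 < N \<and> (\<forall>w. \<exists>x. \<forall>g\<in>G. N * b w g = dot x g)"
proof -
  obtain k e \<phi> d where ad: "adapted (zspan G) k e \<phi> d" and expand: "\<And>w. w = (\<Sum>i<k. dot (\<phi> i) w *s e i)"
    using adapted_basis_exists[OF full] by blast
  have d: "0 < d i" and de: "d i *s e i \<in> zspan G"
    and dvd: "\<And>l. l \<in> zspan G \<Longrightarrow> d i dvd dot (\<phi> i) l"
    and dual: "\<And>j. j < k \<Longrightarrow> dot (\<phi> i) (e j) = (if i = j then 1 else 0)" if "i < k" for i
    using ad that by (auto simp: adapted_def)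
  \<comment> \<open>The form is diagonal in the adapted basis with entries \<open>1 / d i\<close>.
    On the sublattice the integer division is exact, since \<open>d i\<close> divides
    \<open>dot (\<phi> i) g\<close>.\<close>
  define b where "b w g = (\<Sum>i<k. dot (\<phi> i) w * (dot (\<phi> i) g div d i))" for w g
  \<comment> \<open>Exact division is additive, so agreement on \<open>G\<close> extends to
    \<open>zspan G\<close> and can be tested on the vectors \<open>d j *s e j\<close>.\<close>
  have ext: "b w l = dot x l" if "\<forall>g\<in>G. b w g = dot x g" "l \<in> zspan G" for w x l
  proof -
    have "b w l = dot x l \<and> (\<forall>i<k. d i dvd dot (\<phi> i) l)"
      using that(2)
    proof (induction rule: zspan_induct)
      case zero then show ?case by (simp add: b_def dot_simps)
    next
      case (base g) then show ?case using that(1) dvd zspan_base by blast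
    next
      case (neg g)
      then have *: "\<forall>i<k. d i dvd dot (\<phi> i) g" using dvd zspan_base by blast
      then have "b w (- g) = - b w g" by (simp add: b_def dot_simps dvd_neg_div sum_negf)
      then show ?case using that(1) neg * by (simp add: dot_simps)
    next
      case (add l m)
      then have "b w (l + m) = b w l + b w m"
        by (simp add: b_def dot_simps div_add distrib_left sum.distrib)
      then show ?case using add by (simp add: dot_simps)
    qed
    then show ?thesis ..
  qed
  have mult: "d i * (dot (\<phi> i) g div d i) = dot (\<phi> i) g" if "i < k" "g \<in> G" for i g
    using dvd[OF that(1)] zspan_base[OF that(2)] by simp
  have expand_dot: "dot x g = (\<Sum>i<k. dot (\<phi> i) g * dot x (e i))" for x g
    by (subst expand[of g]) (simp add: dot_sum_right dot_simps(6))
  \<comment> \<open>The product of the \<open>d i\<close> is a common denominator of the form: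
    multiplication by it makes every \<open>b w\<close> integral on the whole lattice.\<close>
  show ?thesis
  proof (intro exI[of _ b] exI[of _ "\<Prod>i<k. d i"] conjI allI impI)
    show "b (w + w') g = b w g + b w' g" for w w' g
      by (simp add: b_def dot_simps distrib_right sum.distrib)
    show "(\<exists>x. \<forall>g\<in>G. b w g = dot x g) \<longleftrightarrow> w \<in> zspan G" for w
    proof
      assume "\<exists>x. \<forall>g\<in>G. b w g = dot x g"
      then obtain x where x: "\<forall>g\<in>G. b w g = dot x g" ..
      have "dot (\<phi> j) w = d j * dot x (e j)" if j: "j < k" for j
      proof -
        have "b w (d j *s e j) = (\<Sum>i<k. if i = j then dot (\<phi> j) w else 0)"
          unfolding b_def using dual d[OF j] j by (intro sum.cong) (auto simp: dot_simps(6))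
        then show ?thesis using ext[OF x de[OF j]] j by (simp add: dot_simps(6))
      qed
      then have "w = (\<Sum>i<k. dot x (e i) *s (d i *s e i))"
        by (subst expand[of w]) (intro sum.cong, auto simp: vector_smult_assoc mult.commute)
      also have "\<dots> \<in> zspan G" by (intro zspan_sum zspan_scale de) simp
      finally show "w \<in> zspan G" .
    next
      assume w: "w \<in> zspan G"
      have "b w g = dot (\<Sum>i<k. (dot (\<phi> i) w div d i) *s \<phi> i) g" if g: "g \<in> G" for g
        unfolding b_def dot_sum_left dot_simps(3)
      proof (rule sum.cong)
        fix i assume "i \<in> {..<k}"
        then have i: "i < k" by simp
        have "dot (\<phi> i) w * (dot (\<phi> i) g div d i) = (dot (\<phi> i) w div d i) * (d i * (dot (\<phi> i) g div d i))"
          using dvd[OF i w] by (simp flip: mult.assoc)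
        then show "dot (\<phi> i) w * (dot (\<phi> i) g div d i) = (dot (\<phi> i) w div d i) * dot (\<phi> i) g"
          unfolding mult[OF i g] .
      qed simp
      then show "\<exists>x. \<forall>g\<in>G. b w g = dot x g" by blast
    qed
    show "\<exists>w. \<forall>g\<in>G. b w g = c g" if m: "0 < m" "\<forall>g\<in>G. m * c g = dot x g" for m x c
    proof -
      have "m dvd dot x l" if "l \<in> zspan G" for l
        using that
      proof (induction rule: zspan_induct)
        case (base g) then show ?case using m(2) by (metis dvd_triv_left)
      next
        case (neg g) then show ?case using m(2) by (metis dot_simps(7) dvd_minus_iff dvd_triv_left)
      qed (simp_all add: dot_simps)
      then have mdvd: "m dvd d i * dot x (e i)" if "i < k" for i
        using de[OF that] by (metis dot_simps(6))
      define y where "y i = d i * dot x (e i) div m" for i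
      have my: "m * y i = d i * dot x (e i)" if "i < k" for i using mdvd[OF that] by (simp add: y_def)
      \<comment> \<open>Solves \<open>b w = c\<close> on the vectors \<open>d i *s e i\<close>,
        where the functional \<open>dot x\<close> divided by \<open>m\<close> takes the value
        \<open>y i\<close>.\<close>
      define w where "w = (\<Sum>i<k. y i *s e i)"
      have \<phi>w: "dot (\<phi> j) w = y j" if j: "j < k" for j
      proof -
        have "dot (\<phi> j) w = (\<Sum>i<k. if i = j then y j else 0)"
          unfolding w_def dot_sum_right dot_simps(6) using dual[OF j] by (intro sum.cong) auto
        then show ?thesis using j by simp
      qed
      have "b w g = c g" if g: "g \<in> G" for g
      proof -
        have "m * b w g = (\<Sum>i<k. dot (\<phi> i) g * dot x (e i))"
          unfolding b_def sum_distrib_left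
        proof (rule sum.cong)
          fix i assume "i \<in> {..<k}"
          then have i: "i < k" by simp
          have "m * (dot (\<phi> i) w * (dot (\<phi> i) g div d i)) = (m * y i) * (dot (\<phi> i) g div d i)"
            by (simp add: \<phi>w[OF i])
          also have "\<dots> = (d i * (dot (\<phi> i) g div d i)) * dot x (e i)" by (simp add: my[OF i])
          also have "\<dots> = dot (\<phi> i) g * dot x (e i)" by (simp add: mult[OF i g])
          finally show "m * (dot (\<phi> i) w * (dot (\<phi> i) g div d i)) = dot (\<phi> i) g * dot x (e i)" .
        qed simp
        then have "m * b w g = m * c g" using m(2) g by (simp flip: expand_dot)
        then show ?thesis using m(1) by simp
      qed
      then show ?thesis by blast
    qed
    show "0 < (\<Prod>i<k. d i)" using d by (auto intro: prod_pos)
    show "\<exists>x. \<forall>g\<in>G. (\<Prod>i<k. d i) * b w g = dot x g" for w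
    proof -
      define N where "N = (\<Prod>i<k. d i)"
      have Ndvd: "d i dvd N" if "i < k" for i using that by (auto simp: N_def intro: dvd_prodI)
      have "N * b w g = dot (\<Sum>i<k. (N div d i * dot (\<phi> i) w) *s \<phi> i) g" if g: "g \<in> G" for g
        unfolding b_def dot_sum_left dot_simps(3) sum_distrib_left
      proof (rule sum.cong)
        fix i assume "i \<in> {..<k}"
        then have i: "i < k" by simp
        have "N * (dot (\<phi> i) w * (dot (\<phi> i) g div d i)) = (N div d i * d i) * (dot (\<phi> i) w * (dot (\<phi> i) g div d i))"
          using Ndvd[OF i] by simp
        also have "\<dots> = N div d i * dot (\<phi> i) w * (d i * (dot (\<phi> i) g div d i))" by (simp only: mult_ac)
        finally show "N * (dot (\<phi> i) w * (dot (\<phi> i) g div d i)) = N div d i * dot (\<phi> i) w * dot (\<phi> i) g"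
          unfolding mult[OF i g] .
      qed simp
      then show ?thesis unfolding N_def by blast
    qed
  qed
qed

section \<open>The torsion of the class group\<close>

lemma (in comm_group) torsion_subgroup:
  "subgroup {x \<in> carrier G. \<exists>k::nat. k > 0 \<and> x [^] k = \<one>} G"
proof (rule subgroupI)
  show "{x \<in> carrier G. \<exists>k::nat. k > 0 \<and> x [^] k = \<one>} \<noteq> {}"
  proof -
    have "\<one> \<in> {x \<in> carrier G. \<exists>k::nat. k > 0 \<and> x [^] k = \<one>}" by (auto intro!: exI[of _ "1 :: nat"])
    then show ?thesis by blast
  qed
  fix x assume "x \<in> {x \<in> carrier G. \<exists>k::nat. k > 0 \<and> x [^] k = \<one>}"
  then obtain k :: nat where x: "x \<in> carrier G" "k > 0" "x [^] k = \<one>" by blast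
  then have "(inv x) [^] k = \<one>" by (simp add: nat_pow_inv)
  then show "inv x \<in> {x \<in> carrier G. \<exists>k::nat. k > 0 \<and> x [^] k = \<one>}" using x by blast
  fix y assume "y \<in> {x \<in> carrier G. \<exists>k::nat. k > 0 \<and> x [^] k = \<one>}"
  then obtain l :: nat where y: "y \<in> carrier G" "l > 0" "y [^] l = \<one>" by blast
  have "x [^] (k * l) = \<one>" using x nat_pow_pow[of x k l] by simp
  moreover have "y [^] (k * l) = \<one>" using y nat_pow_pow[of y l k] by (simp add: mult.commute)
  ultimately have "(x \<otimes> y) [^] (k * l) = \<one>" using x y by (simp add: nat_pow_distrib)
  moreover have "k * l > 0" using x y by simp
  ultimately show "x \<otimes> y \<in> {x \<in> carrier G. \<exists>k::nat. k > 0 \<and> x [^] k = \<one>}" using x y by blast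
qed blast

context simplicial_complete_fan
begin

section \<open>Divisors supported on the rays\<close>

definition toric_divisor :: "(int ^ 'n::{finite,linorder} \<Rightarrow> int) \<Rightarrow> 'n ratfun set \<Rightarrow>\<^sub>0 int" where
  "toric_divisor c = (\<Sum>\<rho>\<in>rays \<Sigma>. Poly_Mapping.single (ray_ring (ray_gen \<rho>)) (c (ray_gen \<rho>)))"

lemma lookup_toric_divisor:
  assumes "\<rho> \<in> rays \<Sigma>"
  shows "Poly_Mapping.lookup (toric_divisor c) (ray_ring (ray_gen \<rho>)) = c (ray_gen \<rho>)"
proof -
  have "Poly_Mapping.lookup (toric_divisor c) (ray_ring (ray_gen \<rho>)) =
      (\<Sum>\<rho>'\<in>rays \<Sigma>. if \<rho>' = \<rho> then c (ray_gen \<rho>) else 0)"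
    unfolding toric_divisor_def lookup_sum
    by (rule sum.cong) (use ray_ring_inj[OF _ assms] in \<open>auto simp: lookup_single when_def\<close>)
  then show ?thesis using assms finite_rays by simp
qed

lemma keys_toric_divisor:
  "Poly_Mapping.keys (toric_divisor c) \<subseteq> (\<lambda>\<rho>. ray_ring (ray_gen \<rho>)) ` rays \<Sigma>"
proof -
  have "Poly_Mapping.keys (toric_divisor c) \<subseteq>
      (\<Union>\<rho>\<in>rays \<Sigma>. Poly_Mapping.keys (Poly_Mapping.single (ray_ring (ray_gen \<rho>)) (c (ray_gen \<rho>))))"
    unfolding toric_divisor_def by (rule keys_sum)
  also have "\<dots> \<subseteq> (\<lambda>\<rho>. ray_ring (ray_gen \<rho>)) ` rays \<Sigma>" by auto
  finally show ?thesis .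
qed

lemma toric_divisor_weil: "Poly_Mapping.keys (toric_divisor c) \<subseteq> prime_divisors X"
  using keys_toric_divisor[of c] unfolding prime_divisors_eq by blast

lemma toric_divisor_prime_ring:
  assumes "prime_elem g"
  shows "Poly_Mapping.lookup (toric_divisor c) (prime_ring g) = 0"
proof -
  have "prime_ring g \<notin> Poly_Mapping.keys (toric_divisor c)"
    using keys_toric_divisor[of c] ray_ring_neq_prime_ring[OF _ assms] by fastforce
  then show ?thesis by (simp add: in_keys_iff)
qed

lemma toric_divisor_principal_iff:
  "toric_divisor c \<in> principal_divisors X \<longleftrightarrow> (\<exists>x. \<forall>v\<in>ray_gen ` rays \<Sigma>. c v = dot x v)"
proof -
  have "(\<exists>m. \<forall>v\<in>ray_gen ` rays \<Sigma>. c v = pairing m v) \<longleftrightarrow> (\<exists>x. \<forall>v\<in>ray_gen ` rays \<Sigma>. c v = dot x v)"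
    using pairing_realize by (metis pairing_eq_dot)
  moreover have "toric_divisor c \<in> principal_divisors X \<longleftrightarrow>
    (\<exists>m. \<forall>\<rho>\<in>rays \<Sigma>. Poly_Mapping.lookup (toric_divisor c) (ray_ring (ray_gen \<rho>)) = pairing m (ray_gen \<rho>))"
    by (rule toric_principal_iff[OF toric_divisor_weil toric_divisor_prime_ring])
  ultimately show ?thesis by (simp add: lookup_toric_divisor)
qed

lemma toric_divisor_add: "toric_divisor (\<lambda>v. c v + c' v) = toric_divisor c + toric_divisor c'"
  by (simp add: toric_divisor_def single_add sum.distrib)

lemma toric_divisor_cmul: "toric_divisor (\<lambda>v. k * c v) = frag_cmul k (toric_divisor c)"
proof (rule poly_mapping_eqI)
  fix P
  show "Poly_Mapping.lookup (toric_divisor (\<lambda>v. k * c v)) P = Poly_Mapping.lookup (frag_cmul k (toric_divisor c)) P"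
    by (simp add: toric_divisor_def lookup_sum lookup_single when_def sum_distrib_left if_distrib cong: if_cong)
qed

lemma toric_divisor_eqI:
  assumes "Poly_Mapping.keys D \<subseteq> prime_divisors X"
    and "\<And>g. prime_elem g \<Longrightarrow> Poly_Mapping.lookup D (prime_ring g) = 0"
    and "\<And>\<rho>. \<rho> \<in> rays \<Sigma> \<Longrightarrow> Poly_Mapping.lookup D (ray_ring (ray_gen \<rho>)) = c (ray_gen \<rho>)"
  shows "D = toric_divisor c"
proof (rule poly_mapping_eqI)
  fix P
  show "Poly_Mapping.lookup D P = Poly_Mapping.lookup (toric_divisor c) P"
  proof (cases "P \<in> prime_divisors X")
    case True
    then show ?thesis using assms(2,3) unfolding prime_divisors_eq
      by (auto simp: lookup_toric_divisor toric_divisor_prime_ring)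
  next
    case False
    then have "P \<notin> Poly_Mapping.keys D" "P \<notin> Poly_Mapping.keys (toric_divisor c)"
      using assms(1) toric_divisor_weil by blast+
    then show ?thesis by (simp add: in_keys_iff)
  qed
qed

text \<open>The map sends \<open>w\<close> to the class of the divisor with coefficients
  \<open>b w\<close>. The clauses of \<open>sublattice_self_dual\<close> give its kernel, its values
  in the torsion, and surjectivity: a torsion class has a representative on the rays, and a multiple
  of its coefficients is an integral functional.\<close>

theorem ray_quotient_iso_torsion:
  "lattice_group Mod ray_subgroup \<Sigma> \<cong> torsion_group (class_group X)"
proof -
  let ?G = "ray_gen ` rays \<Sigma>" and ?W = "weil_divisors X" and ?H = "principal_divisors X"
  obtain b N where b: "\<forall>w w' g. b (w + w') g = b w g + b w' g"
    "\<forall>w. (\<exists>x. \<forall>g\<in>?G. b w g = dot x g) \<longleftrightarrow> w \<in> zspan ?G"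
    "\<forall>m x c. 0 < m \<longrightarrow> (\<forall>g\<in>?G. m * c g = dot x g) \<longrightarrow> (\<exists>w. \<forall>g\<in>?G. b w g = c g)"
    "0 < N" "\<forall>w. \<exists>x. \<forall>g\<in>?G. N * b w g = dot x g"
    using sublattice_self_dual[OF rays_multiple] by (elim exE conjE)
  interpret W: comm_group ?W
    unfolding weil_divisors_def by (rule abelian_free_Abelian_group)
  interpret H: normal ?H ?W
    by (rule W.subgroup_imp_normal[OF principal_subgroup])
  interpret C: comm_group "class_group X"
    unfolding class_group_def by (rule W.abelian_FactGroup[OF principal_subgroup])
  let ?T = "torsion_group (class_group X)"
  have T: "subgroup {x \<in> carrier (class_group X). \<exists>k::nat. k > 0 \<and> x [^]\<^bsub>class_group X\<^esub> k = \<one>\<^bsub>class_group X\<^esub>} (class_group X)"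
    by (rule C.torsion_subgroup)
  have T_group: "group ?T"
    unfolding torsion_group_def by (rule subgroup.subgroup_is_group[OF T C.is_group])
  have carrier: "D \<in> carrier ?W \<longleftrightarrow> Poly_Mapping.keys D \<subseteq> prime_divisors X" for D
    by (simp add: weil_divisors_def)
  have mult: "D \<otimes>\<^bsub>?W\<^esub> E = D + E" for D E by (simp add: weil_divisors_def)
  have pow: "D [^]\<^bsub>?W\<^esub> (k::nat) = frag_cmul (int k) D" for D k by (simp add: weil_divisors_def)
  have coset: "?H #>\<^bsub>?W\<^esub> D = ?H \<longleftrightarrow> D \<in> ?H" if "D \<in> carrier ?W" for D
    using W.coset_join1[OF _ that principal_subgroup] W.coset_join2[OF that principal_subgroup] by blast
  have in_T: "?H #>\<^bsub>?W\<^esub> D \<in> carrier ?T \<longleftrightarrow> (\<exists>k::nat. k > 0 \<and> frag_cmul (int k) D \<in> ?H)"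
    if D: "D \<in> carrier ?W" for D
  proof -
    have "?H #>\<^bsub>?W\<^esub> D \<in> carrier (class_group X)"
      using D by (auto simp: class_group_def carrier_FactGroup)
    moreover have "(?H #>\<^bsub>?W\<^esub> D) [^]\<^bsub>class_group X\<^esub> k = \<one>\<^bsub>class_group X\<^esub> \<longleftrightarrow> frag_cmul (int k) D \<in> ?H" for k :: nat
      unfolding class_group_def H.FactGroup_pow[OF D] using coset[of "D [^]\<^bsub>?W\<^esub> k"] W.nat_pow_closed[OF D]
      by (simp add: pow)
    ultimately show ?thesis by (simp add: torsion_group_def)
  qed
  define h where "h w = ?H #>\<^bsub>?W\<^esub> toric_divisor (b w)" for w
  have h_T: "h w \<in> carrier ?T" for w
  proof -
    \<comment> \<open>Multiplied by \<open>N\<close>, the coefficients become an integral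
      functional, so the multiple is the divisor of a monomial.\<close>
    have "frag_cmul (int (nat N)) (toric_divisor (b w)) \<in> ?H"
      using b(4) spec[OF b(5), of w] by (simp flip: toric_divisor_cmul add: toric_divisor_principal_iff)
    then show ?thesis
      unfolding h_def using in_T toric_divisor_weil carrier b(4) by (metis zero_less_nat_eq)
  qed
  have h_hom: "h \<in> hom lattice_group ?T"
  proof (rule homI)
    fix w w' :: "int ^ 'n::{finite,linorder}"
    have "toric_divisor (b (w + w')) = toric_divisor (b w) \<otimes>\<^bsub>?W\<^esub> toric_divisor (b w')"
    proof -
      have "b (w + w') = (\<lambda>v. b w v + b w' v)" using b(1) by blast
      then show ?thesis by (simp add: mult flip: toric_divisor_add)
    qed
    then show "h (w \<otimes>\<^bsub>lattice_group\<^esub> w') = h w \<otimes>\<^bsub>?T\<^esub> h w'"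
      using H.rcos_sum[of "toric_divisor (b w)" "toric_divisor (b w')"] toric_divisor_weil
      by (simp add: h_def torsion_group_def class_group_def carrier)
  qed (rule h_T)
  interpret L: comm_group "lattice_group :: (int ^ 'n::{finite,linorder}) monoid" by (rule group_lattice_group)
  interpret h: group_hom lattice_group ?T h
    by (intro group_hom.intro group_hom_axioms.intro L.is_group T_group h_hom)
  have "kernel lattice_group ?T h = ray_subgroup \<Sigma>"
  proof -
    have "h w = \<one>\<^bsub>?T\<^esub> \<longleftrightarrow> w \<in> zspan ?G" for w
      using coset[of "toric_divisor (b w)"] toric_divisor_weil spec[OF b(2), of w]
      by (simp add: h_def torsion_group_def class_group_def carrier toric_divisor_principal_iff)
    then show ?thesis by (auto simp: kernel_def ray_subgroup_def zspan_def)
  qed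
  moreover have "h ` carrier lattice_group = carrier ?T"
  proof
    show "h ` carrier lattice_group \<subseteq> carrier ?T" using h_T by blast
    show "carrier ?T \<subseteq> h ` carrier lattice_group"
    proof
      fix Z assume Z: "Z \<in> carrier ?T"
      then obtain D where D: "D \<in> carrier ?W" "Z = ?H #>\<^bsub>?W\<^esub> D"
        by (auto simp: torsion_group_def class_group_def carrier_FactGroup)
      then obtain k :: nat where k: "k > 0" "frag_cmul (int k) D \<in> ?H" using Z in_T by blast
      have "Poly_Mapping.keys D \<subseteq> prime_divisors X" using D(1) carrier by simp
      from toric_representative[OF this]
      obtain E where E: "E \<in> ?H" "\<forall>g. prime_elem g \<longrightarrow> Poly_Mapping.lookup (D - E) (prime_ring g) = 0"
        by (elim bexE)
      have EW: "E \<in> carrier ?W" by (rule subgroup.mem_carrier[OF principal_subgroup E(1)])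
      define c where "c v = Poly_Mapping.lookup (D - E) (ray_ring v)" for v
      have DE: "D - E = toric_divisor c"
      proof (rule toric_divisor_eqI)
        show "Poly_Mapping.keys (D - E) \<subseteq> prime_divisors X"
          using D(1) EW keys_diff[of D E] unfolding carrier by blast
      qed (use E(2) in \<open>simp_all add: c_def\<close>)
      have "frag_cmul (int k) (D - E) = frag_cmul (int k) D + frag_cmul (- int k) E"
        by (rule poly_mapping_eqI) (simp add: lookup_add lookup_minus algebra_simps)
      \<comment> \<open>The multiple that kills the class of \<open>D\<close> also kills that of
        \<open>D - E\<close>, because \<open>E\<close> is principal.\<close>
      then have "toric_divisor (\<lambda>v. int k * c v) \<in> ?H"
        using principal_add[OF k(2) principal_cmul[OF E(1), of "- int k"]] DE by (simp add: toric_divisor_cmul)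
      then obtain x where "\<forall>v\<in>?G. int k * c v = dot x v" unfolding toric_divisor_principal_iff by (elim exE)
      moreover have "0 < int k" using k(1) by simp
      ultimately obtain w where w: "\<forall>g\<in>?G. b w g = c g" using b(3) by meson
      have "toric_divisor (b w) = toric_divisor c"
        unfolding toric_divisor_def by (rule sum.cong) (use w in auto)
      then have "h w = ?H #>\<^bsub>?W\<^esub> (D - E)" by (simp add: h_def DE)
      also have "\<dots> = Z"
      proof -
        have "D - E \<in> carrier ?W" using DE toric_divisor_weil carrier by metis
        moreover have "D \<in> ?H #>\<^bsub>?W\<^esub> (D - E)"
          unfolding r_coset_def using E(1) by (auto simp: mult intro!: bexI[of _ E])
        ultimately show ?thesis unfolding D(2) by (intro W.repr_independence principal_subgroup)
      qed
      finally show "Z \<in> h ` carrier lattice_group" by force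
    qed
  qed
  ultimately show ?thesis using h.FactGroup_iso by metis
qed

end

section \<open>Row lattices and Hermite normal forms\<close>

lemma row_lattice_subgroup:
  fixes A :: "int mat"
  shows "subgroup (row_lattice A) (monoid_vec TYPE(int) (dim_col A))"
proof -
  interpret comm_group "monoid_vec TYPE(int) (dim_col A)" by (rule comm_group_vec)
  show ?thesis
    unfolding row_lattice_def
    by (rule generate_is_subgroup) (auto simp: monoid_vec_simps rows_def)
qed

lemma row_lattice_smult:
  fixes A :: "int mat"
  assumes "x \<in> row_lattice A"
  shows "c \<cdot>\<^sub>v x \<in> row_lattice A"
proof -
  let ?G = "monoid_vec TYPE(int) (dim_col A)"
  interpret comm_group ?G by (rule comm_group_vec)
  note S = row_lattice_subgroup[of A]
  have x: "x \<in> carrier_vec (dim_col A)" using subgroup.mem_carrier[OF S assms] by (simp add: monoid_vec_simps)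
  have neg: "inv\<^bsub>?G\<^esub> x = - x"
    by (rule inv_equality) (use x in \<open>simp_all add: monoid_vec_simps\<close>)
  have add: "y + x \<in> row_lattice A" "y - x \<in> row_lattice A" if y: "y \<in> row_lattice A" for y
  proof -
    show "y + x \<in> row_lattice A" using subgroup.m_closed[OF S y assms] by (simp add: monoid_vec_simps)
    have yc: "y \<in> carrier_vec (dim_col A)" using subgroup.mem_carrier[OF S y] by (simp add: monoid_vec_simps)
    have "y \<otimes>\<^bsub>?G\<^esub> inv\<^bsub>?G\<^esub> x \<in> row_lattice A"
      by (intro subgroup.m_closed[OF S] subgroup.m_inv_closed[OF S] y assms)
    moreover have "y + - x = y - x" using x yc by auto
    ultimately show "y - x \<in> row_lattice A" by (simp add: neg monoid_vec_simps)
  qed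
  show ?thesis
  proof (induction c rule: int_induct[where k = 0])
    case base
    have "0 \<cdot>\<^sub>v x = 0\<^sub>v (dim_col A)" using x by auto
    then show ?case using subgroup.one_closed[OF S] by (simp add: monoid_vec_simps)
  next
    case (step1 i)
    have "(i + 1) \<cdot>\<^sub>v x = i \<cdot>\<^sub>v x + x" by (rule eq_vecI) (simp_all add: algebra_simps)
    then show ?case using add(1)[OF step1(2)] by simp
  next
    case (step2 i)
    have "(i - 1) \<cdot>\<^sub>v x = i \<cdot>\<^sub>v x - x" by (rule eq_vecI) (simp_all add: algebra_simps)
    then show ?case using add(2)[OF step2(2)] by simp
  qed
qed

text \<open>Each row of the product is an integer combination of the rows of \<open>A\<close>; the
  combinations are built up one row at a time.\<close>

lemma row_lattice_mult_subset:
  fixes A U :: "int mat"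
  assumes U: "U \<in> carrier_mat k (dim_row A)"
  shows "row_lattice (U * A) \<subseteq> row_lattice A"
proof -
  let ?q = "dim_col A"
  interpret comm_group "monoid_vec TYPE(int) ?q" by (rule comm_group_vec)
  note S = row_lattice_subgroup[of A]
  have comb: "Matrix.vec ?q (\<lambda>j. \<Sum>l<m. u l * A $$ (l, j)) \<in> row_lattice A" if "m \<le> dim_row A" for m and u :: "nat \<Rightarrow> int"
    using that
  proof (induction m)
    case 0
    have "Matrix.vec ?q (\<lambda>j. \<Sum>l<0. u l * A $$ (l, j)) = 0\<^sub>v ?q" by auto
    then show ?case using subgroup.one_closed[OF S] by (simp add: monoid_vec_simps)
  next
    case (Suc m)
    have "row A m \<in> set (rows A)" using Suc.prems by (auto simp: rows_def)
    then have "row A m \<in> row_lattice A" unfolding row_lattice_def by (rule generate.incl)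
    then have "u m \<cdot>\<^sub>v row A m \<in> row_lattice A" by (rule row_lattice_smult)
    moreover have "Matrix.vec ?q (\<lambda>j. \<Sum>l<Suc m. u l * A $$ (l, j)) =
        Matrix.vec ?q (\<lambda>j. \<Sum>l<m. u l * A $$ (l, j)) + u m \<cdot>\<^sub>v row A m"
      by (rule eq_vecI) (use Suc.prems in auto)
    ultimately show ?case using Suc subgroup.m_closed[OF S] by (simp add: monoid_vec_simps)
  qed
  have "row (U * A) i \<in> row_lattice A" if i: "i < k" for i
  proof -
    have "row (U * A) i = Matrix.vec ?q (\<lambda>j. \<Sum>l<dim_row A. U $$ (i, l) * A $$ (l, j))"
      by (rule eq_vecI) (use U i in \<open>auto simp: scalar_prod_def atLeast0LessThan\<close>)
    then show ?thesis using comb[of "dim_row A" "\<lambda>l. U $$ (i, l)"] by simp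
  qed
  then have "set (rows (U * A)) \<subseteq> row_lattice A" using U by (auto simp: rows_def)
  then show ?thesis
    unfolding row_lattice_def[of "U * A"] using generate_subgroup_incl[OF _ S] by simp
qed

lemma row_lattice_hermite:
  assumes "hermite_normal_form_of A B"
  shows "row_lattice B = row_lattice A" "dim_row B = dim_row A" "dim_col B = dim_col A"
proof -
  obtain U where U: "U \<in> carrier_mat (dim_row A) (dim_row A)" "invertible_mat U" "B = U * A"
    using assms by (auto simp: hermite_normal_form_of_def)
  then show dims: "dim_row B = dim_row A" "dim_col B = dim_col A" by auto
  obtain W where W: "U * W = 1\<^sub>m (dim_row U)" "W * U = 1\<^sub>m (dim_row W)"
    using U(2) by (auto simp: invertible_mat_def inverts_mat_def)
  have "dim_col (U * W) = dim_row U" "dim_col (W * U) = dim_row W" using W by simp_all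
  then have Wc: "W \<in> carrier_mat (dim_row A) (dim_row A)" using U(1) by (intro carrier_matI) auto
  have "W * B = (W * U) * A" unfolding U(3) by (rule assoc_mult_mat[symmetric, OF Wc U(1) carrier_matI[OF refl refl]])
  then have "W * B = A" using W(2) Wc by simp
  then show "row_lattice B = row_lattice A"
    using row_lattice_mult_subset[OF U(1)] row_lattice_mult_subset[of W _ B] Wc U(3) dims by auto
qed

text \<open>Pivot columns are distinct, so there are at most \<open>n\<close> pivots, and every row
  with index \<open>n\<close> or more is zero.\<close>

lemma row_lattice_upper_square:
  assumes hnf: "hermite_normal_form B" and col: "dim_col B = n" and row: "n \<le> dim_row B"
  shows "row_lattice (upper_square n B) = row_lattice B"
proof -
  let ?G = "monoid_vec TYPE(int) n"
  interpret comm_group ?G by (rule comm_group_vec)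
  obtain s f where f: "f ` {..<s} \<subseteq> {..<dim_col B}" "strict_mono_on {..<s} f"
    and zero: "\<And>i j. s \<le> i \<Longrightarrow> i < dim_row B \<Longrightarrow> j < dim_col B \<Longrightarrow> B $$ (i, j) = 0"
    using hnf unfolding hermite_normal_form_def by (elim exE conjE) (rule_tac that, auto)
  have "inj_on f {..<s}" using f(2) by (rule strict_mono_on_imp_inj_on)
  then have "card {..<s} \<le> card {..<dim_col B}" using card_inj_on_le f(1) by blast
  then have s: "s \<le> n" by (simp add: col)
  have rows_eq: "row (upper_square n B) i = row B i" if "i < n" for i
    by (rule eq_vecI) (use that col row in \<open>auto simp: upper_square_def\<close>)
  have dims: "dim_row (upper_square n B) = n" "dim_col (upper_square n B) = n" by (simp_all add: upper_square_def)
  have B: "set (rows B) \<subseteq> carrier ?G" by (auto simp: rows_def monoid_vec_simps col intro!: carrier_vecI)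
  have "set (rows (upper_square n B)) \<subseteq> set (rows B)"
    using row rows_eq dims by (auto simp: rows_def)
  then have "generate ?G (set (rows (upper_square n B))) \<subseteq> generate ?G (set (rows B))"
    by (rule mono_generate)
  moreover have "set (rows B) \<subseteq> generate ?G (set (rows (upper_square n B)))"
  proof
    fix x assume "x \<in> set (rows B)"
    then obtain i where i: "i < dim_row B" "x = row B i" by (auto simp: rows_def)
    show "x \<in> generate ?G (set (rows (upper_square n B)))"
    proof (cases "i < n")
      case True
      then show ?thesis using i rows_eq dims by (intro generate.incl) (auto simp: rows_def intro!: image_eqI[of _ _ i])
    next
      case False
      then have "x = 0\<^sub>v n" using zero i s col by (intro eq_vecI) auto
      then show ?thesis using generate.one[of ?G] by (simp add: monoid_vec_simps)
    qed
  qed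
  then have "generate ?G (set (rows B)) \<subseteq> generate ?G (set (rows (upper_square n B)))"
    using generate_subgroup_incl[OF _ generate_is_subgroup] rows_eq row dims B
    by (metis \<open>set (rows (upper_square n B)) \<subseteq> set (rows B)\<close> order_trans)
  ultimately show ?thesis by (simp add: row_lattice_def dims col)
qed

section \<open>Coordinates on the lattice\<close>

lemma coord_vec_index:
  fixes v :: "int ^ 'n::{finite,linorder}"
  assumes "i < CARD('n)"
  shows "vec_index (coord_vec v) i = vec_nth v (sorted_list_of_set UNIV ! i)"
  using assms by (simp add: coord_vec_def vec_of_list_index)

lemma dim_coord_vec [simp]: "dim_vec (coord_vec (v :: int ^ 'n::{finite,linorder})) = CARD('n)"
  by (simp add: coord_vec_def)

lemma coord_vec_add: "coord_vec (v + w) = coord_vec v + coord_vec w"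
  by (rule eq_vecI) (simp_all add: coord_vec_index)

lemma bij_betw_sorted_UNIV:
  "bij_betw ((!) (sorted_list_of_set UNIV)) {..<CARD('n)} (UNIV :: 'n::{finite,linorder} set)"
  by (rule bij_betw_nth) simp_all

lemma bij_betw_coord_vec:
  "bij_betw coord_vec (UNIV :: (int ^ 'n::{finite,linorder}) set) (carrier_vec CARD('n))"
  unfolding bij_betw_def
proof
  let ?l = "sorted_list_of_set UNIV :: 'n list"
  show "inj (coord_vec :: int ^ 'n::{finite,linorder} \<Rightarrow> _)"
  proof (rule injI)
    fix v w :: "int ^ 'n::{finite,linorder}" assume eq: "coord_vec v = coord_vec w"
    have "vec_nth v j = vec_nth w j" for j
    proof -
      have "j \<in> (!) ?l ` {..<CARD('n)}" by (simp add: bij_betw_imp_surj_on[OF bij_betw_sorted_UNIV])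
      then obtain i where "i < CARD('n)" "j = ?l ! i" by auto
      then show ?thesis using eq coord_vec_index[of i v] coord_vec_index[of i w] by simp
    qed
    then show "v = w" by (simp add: Finite_Cartesian_Product.vec_eq_iff)
  qed
  show "range (coord_vec :: int ^ 'n::{finite,linorder} \<Rightarrow> _) = carrier_vec CARD('n)"
  proof (intro equalityI subsetI)
    fix x :: "int Matrix.vec" assume x: "x \<in> carrier_vec CARD('n)"
    define v :: "int ^ 'n::{finite,linorder}"
      where "v = (\<chi> j. vec_index x (inv_into {..<CARD('n)} ((!) ?l) j))"
    have "coord_vec v = x"
    proof (rule eq_vecI)
      fix i assume "i < dim_vec x"
      then have i: "i < CARD('n)" using x by simp
      then have "inv_into {..<CARD('n)} ((!) ?l) (?l ! i) = i"
        using inv_into_f_f[OF bij_betw_imp_inj_on[OF bij_betw_sorted_UNIV]] by blast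
      then show "vec_index (coord_vec v) i = vec_index x i" by (simp add: coord_vec_index[OF i] v_def)
    qed (use x in simp)
    then show "x \<in> range (coord_vec :: int ^ 'n::{finite,linorder} \<Rightarrow> _)" by blast
  qed (auto intro: carrier_vecI)
qed

lemma group_hom_coord_vec:
  "group_hom (lattice_group :: (int ^ 'n::{finite,linorder}) monoid) (monoid_vec TYPE(int) CARD('n)) coord_vec"
proof (intro group_hom.intro group_hom_axioms.intro)
  show "Group.group (lattice_group :: (int ^ 'n::{finite,linorder}) monoid)"
    by (rule comm_group.axioms(2)[OF group_lattice_group])
  show "Group.group (monoid_vec TYPE(int) CARD('n))" by (rule comm_group.axioms(2)[OF comm_group_vec])
  show "coord_vec \<in> hom (lattice_group :: (int ^ 'n::{finite,linorder}) monoid) (monoid_vec TYPE(int) CARD('n))"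
    by (rule homI) (simp_all add: monoid_vec_simps coord_vec_add carrier_vecI)
qed

lemma lattice_quotient_iso:
  fixes G :: "(int ^ 'n::{finite,linorder}) set"
  assumes L: "L = coord_vec ` zspan G"
  shows "lattice_group Mod zspan G \<cong> monoid_vec TYPE(int) CARD('n) Mod L"
proof -
  let ?M = "monoid_vec TYPE(int) CARD('n)"
  interpret c: group_hom "lattice_group :: (int ^ 'n::{finite,linorder}) monoid" ?M coord_vec
    by (rule group_hom_coord_vec)
  interpret M: comm_group ?M by (rule comm_group_vec)
  have "subgroup (zspan G) lattice_group" unfolding zspan_def by (rule c.G.generate_is_subgroup) simp
  then have LS: "subgroup L ?M" unfolding L by (rule c.subgroup_img_is_subgroup)
  interpret L: normal L ?M by (rule M.subgroup_imp_normal[OF LS])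
  define h where "h v = L #>\<^bsub>?M\<^esub> coord_vec v" for v :: "int ^ 'n::{finite,linorder}"
  have h: "h \<in> hom lattice_group (?M Mod L)"
    using hom_compose[OF c.homh L.r_coset_hom_Mod] by (simp add: h_def[abs_def] comp_def)
  interpret h: group_hom lattice_group "?M Mod L" h
    by (intro group_hom.intro group_hom_axioms.intro c.G.is_group L.factorgroup_is_group h)
  have carrier: "coord_vec v \<in> carrier ?M" for v :: "int ^ 'n::{finite,linorder}"
    by (simp add: monoid_vec_simps carrier_vecI)
  have "h v = L \<longleftrightarrow> v \<in> zspan G" for v
  proof -
    have "h v = L \<longleftrightarrow> coord_vec v \<in> L"
      unfolding h_def using c.H.coset_join1[OF _ carrier LS] c.H.coset_join2[OF carrier LS] by blast
    also have "\<dots> \<longleftrightarrow> v \<in> zspan G"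
      using bij_betw_coord_vec[where 'n = 'n] unfolding L by (auto simp: bij_betw_def dest: injD)
    finally show ?thesis .
  qed
  then have "kernel lattice_group (?M Mod L) h = zspan G" by (auto simp: kernel_def)
  moreover have "h ` carrier lattice_group =
      (\<lambda>x. L #>\<^bsub>?M\<^esub> x) ` coord_vec ` (UNIV :: (int ^ 'n::{finite,linorder}) set)"
    by (simp add: h_def[abs_def] image_image)
  then have "h ` carrier lattice_group = carrier (?M Mod L)"
    by (simp add: bij_betw_imp_surj_on[OF bij_betw_coord_vec] carrier_FactGroup monoid_vec_simps)
  ultimately show ?thesis using h.FactGroup_iso by metis
qed

context simplicial_complete_fan
begin

text \<open>The ray generators span the real space because the cones cover it. The bound ensures
  that the upper square part consists of actual rows of the Hermite form.\<close>

lemma card_rays_ge: "CARD('n) \<le> card (rays \<Sigma>)"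
proof -
  have "x \<in> span (real_pt ` ray_gen ` rays \<Sigma>)" for x
  proof -
    have "x \<in> \<Union>\<Sigma>" using complete by (simp add: complete_fan_def)
    then obtain \<sigma> where \<sigma>: "\<sigma> \<in> \<Sigma>" "x \<in> \<sigma>" by blast
    obtain V where V: "V \<subseteq> ray_gen ` rays \<Sigma>" "\<sigma> = convex_cone hull (real_pt ` V)"
      by (rule cone_gens[OF \<sigma>(1)])
    have "x \<in> span (real_pt ` V)" using \<sigma>(2) convex_cone_hull_subset_span unfolding V(2) by blast
    then show ?thesis using span_mono[OF image_mono[OF V(1)]] by blast
  qed
  then have "dim (UNIV :: (real ^ 'n::{finite,linorder}) set) \<le> card (real_pt ` ray_gen ` rays \<Sigma>)"
    using finite_rays by (intro dim_le_card) auto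
  also have "\<dots> \<le> card (rays \<Sigma>)"
    using card_image_le[of "rays \<Sigma>" "\<lambda>\<rho>. real_pt (ray_gen \<rho>)"] finite_rays by (simp add: image_image)
  finally show ?thesis by simp
qed

lemma row_lattice_fan_matrix:
  assumes "fan_matrix \<Sigma> V"
  shows "row_lattice (transpose_mat V) = coord_vec ` zspan (ray_gen ` rays \<Sigma>)"
    "dim_row (transpose_mat V) = card (rays \<Sigma>)" "dim_col (transpose_mat V) = CARD('n)"
proof -
  obtain \<rho>s where \<rho>s: "distinct \<rho>s" "set \<rho>s = rays \<Sigma>"
    and V: "V = mat_of_cols CARD('n) (map (\<lambda>\<rho>. coord_vec (ray_gen \<rho>)) \<rho>s)"
    using assms by (auto simp: fan_matrix_def)
  show "dim_row (transpose_mat V) = card (rays \<Sigma>)" "dim_col (transpose_mat V) = CARD('n)"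
    using distinct_card[OF \<rho>s(1)] by (simp_all add: V \<rho>s(2))
  interpret c: group_hom "lattice_group :: (int ^ 'n::{finite,linorder}) monoid" "monoid_vec TYPE(int) CARD('n)" coord_vec
    by (rule group_hom_coord_vec)
  have "set (rows (transpose_mat V)) = coord_vec ` ray_gen ` rays \<Sigma>"
    unfolding rows_transpose V by (subst cols_mat_of_cols) (auto simp: \<rho>s(2) carrier_vecI)
  then have "row_lattice (transpose_mat V) = generate (monoid_vec TYPE(int) CARD('n)) (coord_vec ` ray_gen ` rays \<Sigma>)"
    by (simp add: row_lattice_def V)
  then show "row_lattice (transpose_mat V) = coord_vec ` zspan (ray_gen ` rays \<Sigma>)"
    unfolding zspan_def using c.generate_img[of "ray_gen ` rays \<Sigma>"] by simp
qed

end

text \<open>The third group is compared with the first rather than with the second: in coordinates,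
  its row lattice is the ray subgroup.\<close>

theorem theorem2p4:
  fixes \<Sigma> :: "(real ^ 'n::{finite,linorder}) set set" and r :: nat and V B :: "int mat"
  assumes "fan \<Sigma>" and "simplicial_fan \<Sigma>" and "complete_fan \<Sigma>"
    and "has_rank (picard_group (toric_variety \<Sigma>)) r" and "r \<ge> 1"
    and "fan_matrix \<Sigma> V"
    and "hermite_normal_form_of (transpose_mat V) B"
  shows "lattice_group Mod ray_subgroup \<Sigma> \<cong> torsion_group (class_group (toric_variety \<Sigma>)) \<and>
    torsion_group (class_group (toric_variety \<Sigma>)) \<cong>
      monoid_vec TYPE(int) CARD('n) Mod row_lattice (upper_square CARD('n) B)"
proof
  interpret simplicial_complete_fan \<Sigma> by unfold_locales fact+
  show iso: "lattice_group Mod ray_subgroup \<Sigma> \<cong> torsion_group (class_group (toric_variety \<Sigma>))"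
    by (rule ray_quotient_iso_torsion)
  have "row_lattice (upper_square CARD('n) B) = row_lattice B"
  proof (rule row_lattice_upper_square)
    show "hermite_normal_form B" using assms(7) by (simp add: hermite_normal_form_of_def)
    show "dim_col B = CARD('n)" "CARD('n) \<le> dim_row B"
      using row_lattice_hermite(2,3)[OF assms(7)] row_lattice_fan_matrix(2,3)[OF assms(6)] card_rays_ge by simp_all
  qed
  then have "row_lattice (upper_square CARD('n) B) = coord_vec ` zspan (ray_gen ` rays \<Sigma>)"
    using row_lattice_hermite(1)[OF assms(7)] row_lattice_fan_matrix(1)[OF assms(6)] by simp
  from lattice_quotient_iso[OF this]
  have iso': "lattice_group Mod ray_subgroup \<Sigma> \<cong>
      monoid_vec TYPE(int) CARD('n) Mod row_lattice (upper_square CARD('n) B)"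
    by (simp add: zspan_def ray_subgroup_def)
  interpret L: comm_group "lattice_group :: (int ^ 'n::{finite,linorder}) monoid" by (rule group_lattice_group)
  have "subgroup (ray_subgroup \<Sigma>) lattice_group"
    unfolding ray_subgroup_def by (rule L.generate_is_subgroup) simp
  \<comment> \<open>The group structure on the quotient allows the first isomorphism to be
    reversed.\<close>
  then have "Group.group (lattice_group Mod ray_subgroup \<Sigma>)"
    by (intro normal.factorgroup_is_group L.subgroup_imp_normal)
  then show "torsion_group (class_group (toric_variety \<Sigma>)) \<cong>
      monoid_vec TYPE(int) CARD('n) Mod row_lattice (upper_square CARD('n) B)"
    by (rule iso_trans[OF group.iso_sym[OF _ iso] iso'])
qed

end
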